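(* Let $\chi$ be a bi-homomorphism on $\Pi$ with $|R^+(\chi)|<\infty$, put $n:=|R^+(\chi)|$, and let $f:\{1,\dots,n\}\to I$ be a map such that $1^\chi s_{f,n}=1^\chi w_0$ is the longest element. Let $\Lambda\in\mathrm{Ch}(U^0(\chi))$. Then $\dim\mathcal{L}_\chi(\Lambda)<\infty$ if and only if $H(\chi,\Lambda,f)=n$.
   Context: $\mathbb{K}$ is a field of characteristic $0$, $\mathbb{K}^\times=\mathbb{K}\setminus\{0\}$. $N\ge1$ is an integer, $I=\{1,\dots,N\}$, $\Pi=\{\alpha_i\mid i\in I\}$, $\mathbb{Z}\Pi=\bigoplus_{i\in I}\mathbb{Z}\alpha_i$ (free $\mathbb{Z}$-module), $\mathbb{Z}_{\ge0}\Pi=\bigoplus_{i\in I}\mathbb{Z}_{\ge0}\alpha_i$. A bi-homomorphism on $\Pi$ is a map $\chi:\mathbb{Z}\Pi\times\mathbb{Z}\Pi\to\mathbb{K}^\times$ with $\chi(\alpha,\beta+\gamma)=\chi(\alpha,\beta)\chi(\alpha,\gamma)$ and $\chi(\alpha+\beta,\gamma)=\chi(\alpha,\gamma)\chi(\beta,\gamma)$. Notation: $(m)_t=\sum_{j=0}^{m-1}t^j$, $(m)_t!=\prod_{j=1}^m(j)_t$, $(m;t_1,t_2)!=\prod_{j=1}^m(1-t_1^{j-1}t_2)$. Generalized quantum group $U(\chi)$: $\tilde U=\tilde U(\chi)$ is the unital associative $\mathbb{K}$-algebra with generators $\tilde K_\alpha,\tilde L_\alpha$ ($\alpha\in\mathbb{Z}\Pi$),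 $\tilde E_i,\tilde F_i$ ($i\in I$) and relations $\tilde K_0=\tilde L_0=1$, $\tilde K_\alpha\tilde K_\beta=\tilde K_{\alpha+\beta}$, $\tilde L_\alpha\tilde L_\beta=\tilde L_{\alpha+\beta}$, $\tilde K_\alpha\tilde L_\beta=\tilde L_\beta\tilde K_\alpha$, $\tilde K_\alpha\tilde E_i=\chi(\alpha,\alpha_i)\tilde E_i\tilde K_\alpha$, $\tilde L_\alpha\tilde E_i=\chi(-\alpha_i,\alpha)\tilde E_i\tilde L_\alpha$, $\tilde K_\alpha\tilde F_i=\chi(\alpha,-\alpha_i)\tilde F_i\tilde K_\alpha$, $\tilde L_\alpha\tilde F_i=\chi(\alpha_i,\alpha)\tilde F_i\tilde L_\alpha$, $\tilde E_i\tilde F_j-\tilde F_j\tilde E_i=\delta_{ij}(-\tilde K_{\alpha_i}+\tilde L_{\alpha_i})$. It is $\mathbb{Z}\Pi$-graded with $\tilde K_\alpha,\tilde L_\alpha$ in degree $0$, $\tilde E_i$ in degree $\alpha_i$, $\tilde F_i$ in degree $-\alpha_i$. $\tilde U^0,\tilde U^+,\tilde U^-$ are the unital subalgebras generated by the $\tilde K_\alpha,\tilde L_\alpha$, by the $\tilde E_i$, and by the $\tilde F_i$. Define subspaces $\tilde{\mathcal I}^-_{-\alpha}\subseteq\tilde U^-_{-\alpha}$ ($\alpha\in\mathbb{Z}_{\ge0}\Pi$) inductively: $\tilde{\mathcal I}^-_0=0$ and, for $\alpha\ne0$, $\tilde{\mathcal I}^-_{-\alpha}$ is the set of $Y\in\tilde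 U^-_{-\alpha}$ with $[\tilde E_i,Y]\in\tilde{\mathcal I}^-_{-\alpha+\alpha_i}\tilde K_{\alpha_i}+\tilde{\mathcal I}^-_{-\alpha+\alpha_i}\tilde L_{\alpha_i}$ for all $i$ with $\alpha-\alpha_i\in\mathbb{Z}_{\ge0}\Pi$. Put $\tilde{\mathcal I}^-=\bigoplus_\alpha\tilde{\mathcal I}^-_{-\alpha}$ and $\tilde{\mathcal J}^-=\mathrm{Span}_{\mathbb{K}}(\tilde{\mathcal I}^-\tilde U^0\tilde U^+)$ (an ideal). Let $\tilde\Omega$ be the algebra automorphism of $\tilde U$ with $\tilde K_\alpha\mapsto\tilde K_{-\alpha}$, $\tilde L_\alpha\mapsto\tilde L_{-\alpha}$, $\tilde E_i\mapsto\tilde F_i\tilde L_{-\alpha_i}$, $\tilde F_i\mapsto\tilde K_{-\alpha_i}\tilde E_i$. Then $U(\chi)=\tilde U/(\tilde{\mathcal J}^-+\tilde\Omega(\tilde{\mathcal J}^-))$. Images of generators are written $K_\alpha,L_\alpha,E_i,F_i$; $U^0(\chi),U^\pm(\chi)$ are the images of $\tilde U^0,\tilde U^\pm$. Multiplication $U^-\otimes U^0\otimes U^+\to U$ is a linear isomorphism and the $K_\alpha L_\beta$ form a basis of $U^0$. Highest weight modules: $\mathrm{Ch}(U^0(\chi))$ is the set of unital $\mathbb{K}$-algebra homomorphisms $U^0(\chi)\to\mathbb{K}$. For $\Lambda\in\mathrm{Ch}(U^0(\chi))$, $\mathcal{M}_\chi(\Lambda)$ is the Verma module: generated by $\tilde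 v_\Lambda\neq0$ with $Z\tilde v_\Lambda=\Lambda(Z)\tilde v_\Lambda$ ($Z\in U^0$), $E_i\tilde v_\Lambda=0$ ($i\in I$), and $U^-\to\mathcal{M}_\chi(\Lambda)$, $Y\mapsto Y\tilde v_\Lambda$ bijective; it is graded by $\mathcal{M}_\chi(\Lambda)_\alpha=U^-_\alpha\tilde v_\Lambda$. $\mathcal{L}_\chi(\Lambda)$ is the quotient of $\mathcal{M}_\chi(\Lambda)$ by its maximal proper $\mathbb{Z}\Pi$-graded submodule. Kharchenko positive roots: for $\alpha\in\mathbb{Z}\Pi$ let $h^\chi(\alpha)=\sup\{m\ge1\mid (m)_{\chi(\alpha,\alpha)}!\neq0\}\in\mathbb{N}\cup\{\infty\}$. By Kharchenko's theorem there is a unique pair $(R^+(\chi),\varphi_\chi)$ of a subset $R^+(\chi)\subseteq\mathbb{Z}_{\ge0}\Pi\setminus\{0\}$ and a map $\varphi_\chi:R^+(\chi)\to\mathbb{N}$ for which there are $k\in\mathbb{N}\cup\{\infty\}$, a surjection $\psi$ from $\{1,\dots,k\}$ (or $\mathbb{N}$ if $k=\infty$) onto $R^+(\chi)$ with $|\psi^{-1}(\alpha)|=\varphi_\chi(\alpha)$, and nonzero elements $F[r]\in U^-(\chi)_{-\psi(r)}$ such that the ordered monomials $F[1]^{x_1}\cdots F[m]^{x_m}$ with $0\le x_y\le h^\chi(\psi(y))$ (finite) form a basis of $U^-(\chi)$. Reflections: with $q_{ij}=\chi(\alpha_i,\alpha_j)$ put $c^\chi_{ii}=2$ and, for $i\neq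 j$, $c^\chi_{ij}=-\max\{m\ge0\mid(m)_{q_{ii}}!(m;q_{ii},q_{ij}q_{ji})!\ne0\}$ ($-\infty$ if no maximum). If $|R^+(\chi)|<\infty$ then all $c_{ij}^\chi$ are finite; let $s_i^\chi(\alpha_j)=\alpha_j-c^\chi_{ij}\alpha_i$ (linear) and $\tau_i\chi(\alpha,\beta)=\chi(s^\chi_i(\alpha),s^\chi_i(\beta))$; it is known that $|R^+(\tau_i\chi)|=|R^+(\chi)|$, $s_i^{\tau_i\chi}=s_i^\chi$ and $\tau_i\tau_i\chi=\chi$. For a word $f$ in $I$: $\chi_{f,0}=\chi$, $1^\chi s_{f,0}=\mathrm{id}$, $\chi_{f,t}=\tau_{f(t)}\chi_{f,t-1}$, $1^\chi s_{f,t}=1^\chi s_{f,t-1}\,s_{f(t)}^{\chi_{f,t}}$. The longest element $1^\chi w_0$ is the unique map $w$ of the form $1^\chi s_{f,t}$ (any $f$, $t$) with $w(\Pi)=-\Pi$; equivalently the unique such $w$ with $w^{-1}(\beta)\in-\mathbb{Z}_{\ge0}\Pi$ for all $\beta\in R^+(\chi)$. Reflected weights: for $i\in I$ let $h_{\chi,\Lambda,i}=\max\{m\ge0\mid (m)_{q_{ii}}!\,(m;q_{ii}^{-1},\Lambda(K_{\alpha_i}L_{-\alpha_i}))!\neq0\}$ ($\infty$ if no maximum). If $h=h_{\chi,\Lambda,i}<\infty$, define $\tau_i^\chi\Lambda\in\mathrm{Ch}(U^0(\tau_i\chi))$ by $\tau_i^\chi\Lambda(K_\alpha L_\beta)=\Lambda(K_{s_i^{\tau_i\chi}(\alpha)}L_{s_i^{\tau_i\chi}(\beta)})\,\chi(\alpha_i,s_i^{\tau_i\chi}(\beta))^h\,\chi(s_i^{\tau_i\chi}(\alpha),\alpha_i)^{-h}$.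 Put $\Lambda_{\chi,f,0}=\Lambda$ and $\Lambda_{\chi,f,t}=\tau_{f(t)}^{\chi_{f,t-1}}\Lambda_{\chi,f,t-1}$ as long as $\Lambda_{\chi,f,t-1}$ is defined and $h_{\chi_{f,t-1},\Lambda_{\chi,f,t-1},f(t)}<\infty$. $H(\chi,\Lambda,f)\in\{0,\dots,n\}$ is the largest $t$ such that $h_{\chi_{f,k-1},\Lambda_{\chi,f,k-1},f(k)}<\infty$ for all $1\le k\le t$ (all these being defined successively). *)

theory Defs
  imports
    Complex_Main
    "HOL-Library.Poly_Mapping"
    "HOL-Library.Function_Algebras"
    "HOL-Library.Set_Algebras"
    "HOL-Library.Extended_Nat"
begin

section \<open>Root lattice and bi-homomorphisms\<close>

text \<open>
  The index set $I$ is a finite type \<^typ>\<open>'i\<close>, and the free $\mathbb{Z}$-module on the simple roots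
  is \<^typ>\<open>'i \<Rightarrow> int\<close> with pointwise operations. For the pointwise order, \<open>0 \<le> \<alpha>\<close> says that
  $\alpha\in\mathbb{Z}_{\ge0}\Pi$.
\<close>

type_synonym 'i lattice = "'i \<Rightarrow> int"
type_synonym ('i, 'k) bichar = "'i lattice \<Rightarrow> 'i lattice \<Rightarrow> 'k"

definition sroot :: "'i \<Rightarrow> 'i lattice" where
  "sroot i = (\<lambda>j. if j = i then 1 else 0)"

definition bihom :: "('i, 'k::field) bichar \<Rightarrow> bool" where
  "bihom X \<longleftrightarrow>
     (\<forall>\<alpha> \<beta>. X \<alpha> \<beta> \<noteq> 0) \<and>
     (\<forall>\<alpha> \<beta> \<gamma>. X \<alpha> (\<beta> + \<gamma>) = X \<alpha> \<beta> * X \<alpha> \<gamma>) \<and>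
     (\<forall>\<alpha> \<beta> \<gamma>. X (\<alpha> + \<beta>) \<gamma> = X \<alpha> \<gamma> * X \<beta> \<gamma>)"

definition qnum :: "nat \<Rightarrow> 'k::field \<Rightarrow> 'k" where
  "qnum m t = (\<Sum>j<m. t ^ j)"

definition qfact :: "nat \<Rightarrow> 'k::field \<Rightarrow> 'k" where
  "qfact m t = (\<Prod>j=1..m. qnum j t)"

definition qpoch :: "nat \<Rightarrow> 'k::field \<Rightarrow> 'k \<Rightarrow> 'k" where
  "qpoch m t1 t2 = (\<Prod>j=1..m. 1 - t1 ^ (j - 1) * t2)"


section \<open>Free algebras\<close>

text \<open>
  Finitely supported functions on the free monoid of words; the library's product on
  \<^typ>\<open>'a \<Rightarrow>\<^sub>0 'b\<close> is the convolution product, whose monoid is written additively, hence the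
  additive notation for concatenation.
\<close>

datatype 'g fword = Fword (letters: "'g list")

instantiation fword :: (type) monoid_add
begin
definition zero_fword :: "'a fword" where
  "zero_fword = Fword []"
definition plus_fword :: "'a fword \<Rightarrow> 'a fword \<Rightarrow> 'a fword" where
  "plus_fword u v = Fword (letters u @ letters v)"
instance
  by standard (simp_all add: zero_fword_def plus_fword_def)
end

type_synonym ('g, 'k) free_alg = "'g fword \<Rightarrow>\<^sub>0 'k"

definition fvar :: "'g \<Rightarrow> ('g, 'k::field) free_alg" where
  "fvar g = Poly_Mapping.single (Fword [g]) 1"

definition fconst :: "'k \<Rightarrow> ('g, 'k::field) free_alg" where
  "fconst c = Poly_Mapping.single 0 c"

definition fscale :: "'k \<Rightarrow> ('g, 'k) free_alg \<Rightarrow> ('g, 'k::field) free_alg" where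
  "fscale c x = fconst c * x"

global_interpretation falg: vector_space "fscale :: 'k \<Rightarrow> ('g, 'k::field) free_alg \<Rightarrow> _"
proof
  fix a b :: 'k and x y :: "('g, 'k) free_alg"
  show "fscale a (x + y) = fscale a x + fscale a y"
    by (simp add: fscale_def algebra_simps)
  show "fscale (a + b) x = fscale a x + fscale b x"
    by (simp add: fscale_def fconst_def single_add algebra_simps)
  show "fscale a (fscale b x) = fscale (a * b) x"
    by (simp add: fscale_def fconst_def mult_single flip: mult.assoc)
  show "fscale 1 x = x"
    by (simp add: fscale_def fconst_def)
qed

text \<open>
  The value of \<open>x\<close> under the algebra homomorphism to \<^typ>\<open>'b\<close> extending \<open>g\<close> on the generators,
  where \<open>\<iota>\<close> is the structure map of the \<^typ>\<open>'k\<close>-algebra \<^typ>\<open>'b\<close>.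
\<close>

definition feval :: "('k \<Rightarrow> 'b) \<Rightarrow> ('g \<Rightarrow> 'b) \<Rightarrow> ('g, 'k::field) free_alg \<Rightarrow> 'b::ring_1" where
  "feval \<iota> g x =
     (\<Sum>w\<in>Poly_Mapping.keys x. \<iota> (Poly_Mapping.lookup x w) * prod_list (map g (letters w)))"

definition subalgebra :: "('g, 'k::field) free_alg set \<Rightarrow> bool" where
  "subalgebra S \<longleftrightarrow> falg.subspace S \<and> 1 \<in> S \<and> (\<forall>x\<in>S. \<forall>y\<in>S. x * y \<in> S)"

definition ideal_gen :: "('g, 'k::field) free_alg set \<Rightarrow> ('g, 'k) free_alg set" where
  "ideal_gen S = falg.span {a * s * b | a s b. s \<in> S}"

definition left_ideal_gen :: "('g, 'k::field) free_alg set \<Rightarrow> ('g, 'k) free_alg set" where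
  "left_ideal_gen S = falg.span {a * s | a s. s \<in> S}"


section \<open>The algebras $\tilde U(\chi)$ and $U(\chi)$\<close>

text \<open>
  Everything below is a quotient of the free algebra $A$ on the symbols $K_\alpha$, $L_\alpha$,
  $E_i$, $F_i$ by an ideal or, for modules, a left ideal. An element of a quotient $A/J$ is
  represented by any of its preimages in $A$, and a subspace of $A/J$ by its full preimage: the
  subspace of $A/J$ spanned by the image of $S$ is \<open>S + J\<close>, and equality in $A/J$ is congruence
  modulo $J$.
\<close>

datatype 'i gen = GenK "'i lattice" | GenL "'i lattice" | GenE 'i | GenF 'i

type_synonym ('i, 'k) qalg = "('i gen, 'k) free_alg"

definition Kg :: "'i lattice \<Rightarrow> ('i, 'k::field) qalg" where "Kg \<alpha> = fvar (GenK \<alpha>)"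
definition Lg :: "'i lattice \<Rightarrow> ('i, 'k::field) qalg" where "Lg \<alpha> = fvar (GenL \<alpha>)"
definition Eg :: "'i \<Rightarrow> ('i, 'k::field) qalg" where "Eg i = fvar (GenE i)"
definition Fg :: "'i \<Rightarrow> ('i, 'k::field) qalg" where "Fg i = fvar (GenF i)"

fun gen_deg :: "'i gen \<Rightarrow> 'i lattice" where
  "gen_deg (GenK \<alpha>) = 0"
| "gen_deg (GenL \<alpha>) = 0"
| "gen_deg (GenE i) = sroot i"
| "gen_deg (GenF i) = - sroot i"

definition homog :: "'i lattice \<Rightarrow> ('i, 'k::field) qalg set" where
  "homog \<alpha> = {x. \<forall>w\<in>Poly_Mapping.keys x. sum_list (map gen_deg (letters w)) = \<alpha>}"

definition alg_zero :: "('i, 'k::field) qalg set" where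
  "alg_zero = subalgebra hull (range Kg \<union> range Lg)"

definition alg_plus :: "('i, 'k::field) qalg set" where
  "alg_plus = subalgebra hull (range Eg)"

definition alg_minus :: "('i, 'k::field) qalg set" where
  "alg_minus = subalgebra hull (range Fg)"

inductive_set Ut_relators :: "('i, 'k::field) bichar \<Rightarrow> ('i, 'k) qalg set"
  for X :: "('i, 'k) bichar" where
  "Kg 0 - 1 \<in> Ut_relators X"
| "Lg 0 - 1 \<in> Ut_relators X"
| "Kg \<alpha> * Kg \<beta> - Kg (\<alpha> + \<beta>) \<in> Ut_relators X"
| "Lg \<alpha> * Lg \<beta> - Lg (\<alpha> + \<beta>) \<in> Ut_relators X"
| "Kg \<alpha> * Lg \<beta> - Lg \<beta> * Kg \<alpha> \<in> Ut_relators X"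
| "Kg \<alpha> * Eg i - fscale (X \<alpha> (sroot i)) (Eg i * Kg \<alpha>) \<in> Ut_relators X"
| "Lg \<alpha> * Eg i - fscale (X (- sroot i) \<alpha>) (Eg i * Lg \<alpha>) \<in> Ut_relators X"
| "Kg \<alpha> * Fg i - fscale (X \<alpha> (- sroot i)) (Fg i * Kg \<alpha>) \<in> Ut_relators X"
| "Lg \<alpha> * Fg i - fscale (X (sroot i) \<alpha>) (Fg i * Lg \<alpha>) \<in> Ut_relators X"
| "Eg i * Fg j - Fg j * Eg i - (if i = j then - Kg (sroot i) + Lg (sroot i) else 0)
     \<in> Ut_relators X"

text \<open>$\tilde U(\chi)$ is the quotient of the free algebra by \<open>Ut_ideal \<chi>\<close>.\<close>

definition Ut_ideal :: "('i, 'k::field) bichar \<Rightarrow> ('i, 'k) qalg set" where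
  "Ut_ideal X = ideal_gen (Ut_relators X)"

text \<open>Preimage of $\tilde U^-_\alpha=\tilde U^-\cap\tilde U_\alpha$.\<close>

definition Ut_minus_deg :: "('i, 'k::field) bichar \<Rightarrow> 'i lattice \<Rightarrow> ('i, 'k) qalg set" where
  "Ut_minus_deg X \<alpha> = (alg_minus + Ut_ideal X) \<inter> (homog \<alpha> + Ut_ideal X)"

text \<open>\<open>It_minus_deg \<chi> \<alpha>\<close> is the preimage of $\tilde{\mathcal I}^-_{-\alpha}$ for
  $\alpha\in\mathbb{Z}_{\ge0}\Pi$; the value outside $\mathbb{Z}_{\ge0}\Pi$ is a dummy.\<close>

function It_minus_deg ::
  "('i::finite, 'k::field) bichar \<Rightarrow> 'i lattice \<Rightarrow> ('i, 'k) qalg set" where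
  "It_minus_deg X \<alpha> =
     (if \<alpha> = 0 then Ut_ideal X
      else if 0 \<le> \<alpha> then
        {Y \<in> Ut_minus_deg X (- \<alpha>).
           \<forall>i. 0 \<le> \<alpha> - sroot i \<longrightarrow>
             Eg i * Y - Y * Eg i
               \<in> It_minus_deg X (\<alpha> - sroot i) * {Kg (sroot i)}
                 + It_minus_deg X (\<alpha> - sroot i) * {Lg (sroot i)} + Ut_ideal X}
      else {})"
  by pat_completeness auto
termination
proof (relation "measure (\<lambda>(X, \<alpha>). nat (\<Sum>i\<in>UNIV. \<alpha> i))", goal_cases)
  case 1
  show ?case by simp
next
  case (2 X \<alpha> x i)
  have le: "(\<Sum>j\<in>UNIV. sroot i j) = (1 :: int)"
    by (simp add: sroot_def)
  have "0 \<le> (\<Sum>j\<in>UNIV. (\<alpha> - sroot i) j)"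
    using 2 by (intro sum_nonneg) (simp add: le_fun_def)
  then show ?case
    using le by (simp add: sum_subtractf)
next
  case (3 X \<alpha> x i)
  have le: "(\<Sum>j\<in>UNIV. sroot i j) = (1 :: int)"
    by (simp add: sroot_def)
  have "0 \<le> (\<Sum>j\<in>UNIV. (\<alpha> - sroot i) j)"
    using 3 by (intro sum_nonneg) (simp add: le_fun_def)
  then show ?case
    using le by (simp add: sum_subtractf)
qed

declare It_minus_deg.simps [simp del]

definition It_minus :: "('i::finite, 'k::field) bichar \<Rightarrow> ('i, 'k) qalg set" where
  "It_minus X = falg.span (\<Union>\<alpha>\<in>{\<alpha>. 0 \<le> \<alpha>}. It_minus_deg X \<alpha>)"

definition Jt_minus :: "('i::finite, 'k::field) bichar \<Rightarrow> ('i, 'k) qalg set" where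
  "Jt_minus X = falg.span (It_minus X * alg_zero * alg_plus) + Ut_ideal X"

fun Omega_gen :: "'i gen \<Rightarrow> ('i, 'k::field) qalg" where
  "Omega_gen (GenK \<alpha>) = Kg (- \<alpha>)"
| "Omega_gen (GenL \<alpha>) = Lg (- \<alpha>)"
| "Omega_gen (GenE i) = Fg i * Lg (- sroot i)"
| "Omega_gen (GenF i) = Kg (- sroot i) * Eg i"

text \<open>The endomorphism of the free algebra that induces $\tilde\Omega$.\<close>

definition Omega :: "('i, 'k::field) qalg \<Rightarrow> ('i, 'k) qalg" where
  "Omega = feval fconst Omega_gen"

text \<open>$U(\chi)$ is the quotient of the free algebra by \<open>U_ideal \<chi>\<close>.\<close>

definition U_ideal :: "('i::finite, 'k::field) bichar \<Rightarrow> ('i, 'k) qalg set" where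
  "U_ideal X = Jt_minus X + Omega ` Jt_minus X + Ut_ideal X"

text \<open>Preimages of $U^-(\chi)$ and $U^-(\chi)_\alpha$.\<close>

definition U_minus :: "('i::finite, 'k::field) bichar \<Rightarrow> ('i, 'k) qalg set" where
  "U_minus X = alg_minus + U_ideal X"

definition U_minus_deg ::
  "('i::finite, 'k::field) bichar \<Rightarrow> 'i lattice \<Rightarrow> ('i, 'k) qalg set" where
  "U_minus_deg X \<alpha> = U_minus X \<inter> (homog \<alpha> + U_ideal X)"


section \<open>Highest weight modules\<close>

text \<open>
  $U^0(\chi)$ is the image of \<open>alg_zero\<close>, so a unital algebra homomorphism
  $U^0(\chi)\to\mathbb{K}$ is one on \<open>alg_zero\<close> that vanishes on its intersection with
  \<open>U_ideal \<chi>\<close>; the values of \<open>\<Lambda>\<close> outside \<open>alg_zero\<close> play no role.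
\<close>

definition Ch :: "('i::finite, 'k::field) bichar \<Rightarrow> (('i, 'k) qalg \<Rightarrow> 'k) set" where
  "Ch X = {\<Lambda>.
     \<Lambda> 1 = 1 \<and>
     (\<forall>x\<in>alg_zero. \<forall>y\<in>alg_zero. \<Lambda> (x + y) = \<Lambda> x + \<Lambda> y \<and> \<Lambda> (x * y) = \<Lambda> x * \<Lambda> y) \<and>
     (\<forall>c. \<forall>x\<in>alg_zero. \<Lambda> (fscale c x) = c * \<Lambda> x) \<and>
     (\<forall>x\<in>alg_zero \<inter> U_ideal X. \<Lambda> x = 0)}"

text \<open>The Verma module is the quotient of the free algebra by the left ideal
  \<open>verma_ideal \<chi> \<Lambda>\<close>, with the class of 1 as highest weight vector.\<close>

definition verma_ideal ::
  "('i::finite, 'k::field) bichar \<Rightarrow> (('i, 'k) qalg \<Rightarrow> 'k) \<Rightarrow> ('i, 'k) qalg set" where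
  "verma_ideal X \<Lambda> =
     left_ideal_gen (U_ideal X \<union> {Z - fconst (\<Lambda> Z) | Z. Z \<in> alg_zero} \<union> range Eg)"

text \<open>Preimage of $\mathcal M_\chi(\Lambda)_\alpha=U^-(\chi)_\alpha\tilde v_\Lambda$.\<close>

definition verma_deg :: "('i::finite, 'k::field) bichar \<Rightarrow> (('i, 'k) qalg \<Rightarrow> 'k) \<Rightarrow>
    'i lattice \<Rightarrow> ('i, 'k) qalg set" where
  "verma_deg X \<Lambda> \<alpha> = U_minus_deg X \<alpha> + verma_ideal X \<Lambda>"

definition proper_graded_submodule :: "('i::finite, 'k::field) bichar \<Rightarrow>
    (('i, 'k) qalg \<Rightarrow> 'k) \<Rightarrow> ('i, 'k) qalg set \<Rightarrow> bool" where
  "proper_graded_submodule X \<Lambda> S \<longleftrightarrow>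
     falg.subspace S \<and> (\<forall>a. \<forall>x\<in>S. a * x \<in> S) \<and> verma_ideal X \<Lambda> \<subseteq> S \<and>
     S \<noteq> UNIV \<and> S = falg.span (\<Union>\<alpha>. S \<inter> verma_deg X \<Lambda> \<alpha>)"

text \<open>$\mathcal L_\chi(\Lambda)$ is the quotient of the free algebra by \<open>L_ideal \<chi> \<Lambda>\<close>.\<close>

definition L_ideal ::
  "('i::finite, 'k::field) bichar \<Rightarrow> (('i, 'k) qalg \<Rightarrow> 'k) \<Rightarrow> ('i, 'k) qalg set" where
  "L_ideal X \<Lambda> = (GREATEST S. proper_graded_submodule X \<Lambda> S)"

definition finite_dim_quotient :: "('g, 'k::field) free_alg set \<Rightarrow> bool" where
  "finite_dim_quotient S \<longleftrightarrow> (\<exists>B. finite B \<and> falg.span B + S = UNIV)"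

definition L_finite_dim ::
  "('i::finite, 'k::field) bichar \<Rightarrow> (('i, 'k) qalg \<Rightarrow> 'k) \<Rightarrow> bool" where
  "L_finite_dim X \<Lambda> \<longleftrightarrow> finite_dim_quotient (L_ideal X \<Lambda>)"


section \<open>Kharchenko's positive roots\<close>

definition root_height :: "('i, 'k::field) bichar \<Rightarrow> 'i lattice \<Rightarrow> enat" where
  "root_height X \<alpha> = Sup (enat ` {m. 1 \<le> m \<and> qfact m (X \<alpha> \<alpha>) \<noteq> 0})"

text \<open>The family \<open>b\<close> indexed by \<open>T\<close> is a basis of \<open>V/J\<close>; the independence clause includes
  injectivity of the family modulo \<open>J\<close>.\<close>

definition basis_mod :: "('g, 'k::field) free_alg set \<Rightarrow> ('g, 'k) free_alg set \<Rightarrow>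
    'x set \<Rightarrow> ('x \<Rightarrow> ('g, 'k) free_alg) \<Rightarrow> bool" where
  "basis_mod J V T b \<longleftrightarrow>
     V = falg.span (b ` T) + J \<and>
     (\<forall>T' c. finite T' \<and> T' \<subseteq> T \<and> (\<Sum>x\<in>T'. fscale (c x) (b x)) \<in> J \<longrightarrow> (\<forall>x\<in>T'. c x = 0))"

text \<open>Positions $1,\dots,k$, or all positive integers if $k=\infty$.\<close>

definition positions :: "enat \<Rightarrow> nat set" where
  "positions k = {r. 1 \<le> r \<and> enat r \<le> k}"

text \<open>Exponent sequences; the ordered monomial of a sequence with support in $\{1,\dots,m\}$ is
  $F[1]^{x_1}\cdots F[m]^{x_m}$, in which the factors with $x_r=0$ can be left out.\<close>

definition exponents ::
  "('i, 'k::field) bichar \<Rightarrow> enat \<Rightarrow> (nat \<Rightarrow> 'i lattice) \<Rightarrow> (nat \<Rightarrow> nat) set" where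
  "exponents X k \<psi> = {x. finite {r. x r \<noteq> 0} \<and> {r. x r \<noteq> 0} \<subseteq> positions k \<and>
     (\<forall>r\<in>positions k. enat (x r) \<le> root_height X (\<psi> r))}"

definition pbw_monomial :: "(nat \<Rightarrow> ('i, 'k::field) qalg) \<Rightarrow> (nat \<Rightarrow> nat) \<Rightarrow> ('i, 'k) qalg" where
  "pbw_monomial F x = prod_list (map (\<lambda>r. F r ^ x r) (sorted_list_of_set {r. x r \<noteq> 0}))"

text \<open>\<open>(R, \<phi>)\<close> is the pair $(R^+(\chi),\varphi_\chi)$. By Kharchenko's theorem such a pair exists and
  the condition determines \<open>R\<close> and the restriction of \<open>\<phi>\<close> to \<open>R\<close>.\<close>

definition kharchenko_pair ::
  "('i::finite, 'k::field) bichar \<Rightarrow> 'i lattice set \<Rightarrow> ('i lattice \<Rightarrow> nat) \<Rightarrow> bool" where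
  "kharchenko_pair X R \<phi> \<longleftrightarrow>
     R \<subseteq> {\<alpha>. 0 \<le> \<alpha>} - {0} \<and>
     (\<exists>k \<psi> F.
        \<psi> ` positions k = R \<and>
        (\<forall>\<alpha>\<in>R. finite {r \<in> positions k. \<psi> r = \<alpha>} \<and> card {r \<in> positions k. \<psi> r = \<alpha>} = \<phi> \<alpha>) \<and>
        (\<forall>r\<in>positions k. F r \<in> U_minus_deg X (- \<psi> r) \<and> F r \<notin> U_ideal X) \<and>
        basis_mod (U_ideal X) (U_minus X) (exponents X k \<psi>) (pbw_monomial F))"


section \<open>Reflections\<close>

text \<open>The sets whose supremum is taken here and in \<open>wt_height\<close> contain 0 and are downward closed,
  so the supremum is the maximum, and it is \<open>\<infinity>\<close> if there is none.\<close>

definition cartan_max :: "('i, 'k::field) bichar \<Rightarrow> 'i \<Rightarrow> 'i \<Rightarrow> enat" where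
  "cartan_max X i j =
     (let q = (\<lambda>a b. X (sroot a) (sroot b))
      in Sup (enat ` {m. qfact m (q i i) * qpoch m (q i i) (q i j * q j i) \<noteq> 0}))"

text \<open>The integer $c^\chi_{ij}$, a dummy if it is $-\infty$, which is impossible if $R^+(\chi)$ is
  finite.\<close>

definition cartan :: "('i, 'k::field) bichar \<Rightarrow> 'i \<Rightarrow> 'i \<Rightarrow> int" where
  "cartan X i j = (if i = j then 2 else - int (the_enat (cartan_max X i j)))"

definition srefl ::
  "('i::finite, 'k::field) bichar \<Rightarrow> 'i \<Rightarrow> 'i lattice \<Rightarrow> 'i lattice" where
  "srefl X i \<alpha> = (\<lambda>l. \<alpha> l - (\<Sum>j\<in>UNIV. \<alpha> j * cartan X i j) * sroot i l)"

definition bichar_refl :: "'i \<Rightarrow> ('i::finite, 'k::field) bichar \<Rightarrow> ('i, 'k) bichar" where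
  "bichar_refl i X = (\<lambda>\<alpha> \<beta>. X (srefl X i \<alpha>) (srefl X i \<beta>))"

primrec bichar_seq ::
  "('i::finite, 'k::field) bichar \<Rightarrow> (nat \<Rightarrow> 'i) \<Rightarrow> nat \<Rightarrow> ('i, 'k) bichar" where
  "bichar_seq X f 0 = X"
| "bichar_seq X f (Suc t) = bichar_refl (f (Suc t)) (bichar_seq X f t)"

primrec srefl_seq ::
  "('i::finite, 'k::field) bichar \<Rightarrow> (nat \<Rightarrow> 'i) \<Rightarrow> nat \<Rightarrow> 'i lattice \<Rightarrow> 'i lattice" where
  "srefl_seq X f 0 = id"
| "srefl_seq X f (Suc t) = srefl_seq X f t \<circ> srefl (bichar_seq X f (Suc t)) (f (Suc t))"

text \<open>\<open>w\<close> is the longest element $1^\chi w_0$.\<close>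

definition longest_element ::
  "('i::finite, 'k::field) bichar \<Rightarrow> ('i lattice \<Rightarrow> 'i lattice) \<Rightarrow> bool" where
  "longest_element X w \<longleftrightarrow>
     (\<exists>f t. w = srefl_seq X f t) \<and> w ` range sroot = uminus ` range sroot"


section \<open>Reflected weights\<close>

definition wt_height ::
  "('i, 'k::field) bichar \<Rightarrow> (('i, 'k) qalg \<Rightarrow> 'k) \<Rightarrow> 'i \<Rightarrow> enat" where
  "wt_height X \<Lambda> i =
     (let q = X (sroot i) (sroot i)
      in Sup (enat ` {m. qfact m q * qpoch m (inverse q) (\<Lambda> (Kg (sroot i) * Lg (- sroot i))) \<noteq> 0}))"

text \<open>
  A homomorphism on $U^0$ is determined by its values on the $K_\alpha$ and $L_\beta$; the values
  given here are the defining formula of $\tau_i^\chi\Lambda(K_\alpha L_\beta)$ split into its two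
  factors, see \<open>wt_refl_formula\<close>. The values on $E_j$ and $F_j$ are dummies.
\<close>

fun wt_refl_gen ::
  "('i::finite, 'k::field) bichar \<Rightarrow> 'i \<Rightarrow> (('i, 'k) qalg \<Rightarrow> 'k) \<Rightarrow> 'i gen \<Rightarrow> 'k" where
  "wt_refl_gen X i \<Lambda> (GenK \<alpha>) =
     (let s = srefl (bichar_refl i X) i; h = the_enat (wt_height X \<Lambda> i)
      in \<Lambda> (Kg (s \<alpha>)) * inverse (X (s \<alpha>) (sroot i) ^ h))"
| "wt_refl_gen X i \<Lambda> (GenL \<beta>) =
     (let s = srefl (bichar_refl i X) i; h = the_enat (wt_height X \<Lambda> i)
      in \<Lambda> (Lg (s \<beta>)) * X (sroot i) (s \<beta>) ^ h)"
| "wt_refl_gen X i \<Lambda> (GenE j) = 0"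
| "wt_refl_gen X i \<Lambda> (GenF j) = 0"

definition wt_refl ::
  "('i::finite, 'k::field) bichar \<Rightarrow> 'i \<Rightarrow> (('i, 'k) qalg \<Rightarrow> 'k) \<Rightarrow> ('i, 'k) qalg \<Rightarrow> 'k" where
  "wt_refl X i \<Lambda> = feval (\<lambda>c. c) (wt_refl_gen X i \<Lambda>)"

lemma wt_refl_formula:
  fixes X :: "('i::finite, 'k::field) bichar"
  assumes "\<Lambda> \<in> Ch X" and "wt_height X \<Lambda> i = enat h"
  shows "wt_refl X i \<Lambda> (Kg \<alpha> * Lg \<beta>) =
    \<Lambda> (Kg (srefl (bichar_refl i X) i \<alpha>) * Lg (srefl (bichar_refl i X) i \<beta>))
      * X (sroot i) (srefl (bichar_refl i X) i \<beta>) ^ h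
      * inverse (X (srefl (bichar_refl i X) i \<alpha>) (sroot i) ^ h)"
proof -
  have gens: "(Kg a :: ('i, 'k) qalg) \<in> alg_zero" "(Lg a :: ('i, 'k) qalg) \<in> alg_zero" for a
    by (auto simp: alg_zero_def intro: hull_inc)
  have mult: "\<Lambda> (Kg a * Lg b) = \<Lambda> (Kg a) * \<Lambda> (Lg b)" for a b
    using assms(1) gens by (simp add: Ch_def)
  have "Kg \<alpha> * Lg \<beta> = (Poly_Mapping.single (Fword [GenK \<alpha>, GenL \<beta>]) 1 :: ('i, 'k) qalg)"
    by (simp add: Kg_def Lg_def fvar_def mult_single plus_fword_def)
  then show ?thesis
    using assms(2) by (simp add: wt_refl_def feval_def mult Let_def)
qed

primrec wt_seq :: "('i::finite, 'k::field) bichar \<Rightarrow> (('i, 'k) qalg \<Rightarrow> 'k) \<Rightarrow> (nat \<Rightarrow> 'i) \<Rightarrow>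
    nat \<Rightarrow> ('i, 'k) qalg \<Rightarrow> 'k" where
  "wt_seq X \<Lambda> f 0 = \<Lambda>"
| "wt_seq X \<Lambda> f (Suc t) = wt_refl (bichar_seq X f t) (f (Suc t)) (wt_seq X \<Lambda> f t)"

text \<open>\<open>wt_seq \<chi> \<Lambda> f t\<close> is meaningful only while the preceding heights are finite, and the
  condition below depends on it only then. The last argument is the length of the word.\<close>

definition H_max :: "('i::finite, 'k::field) bichar \<Rightarrow> (('i, 'k) qalg \<Rightarrow> 'k) \<Rightarrow> (nat \<Rightarrow> 'i) \<Rightarrow>
    nat \<Rightarrow> nat" where
  "H_max X \<Lambda> f n = Max {t. t \<le> n \<and>
     (\<forall>k\<in>{1..t}. wt_height (bichar_seq X f (k - 1)) (wt_seq X \<Lambda> f (k - 1)) (f k) < \<infinity>)}"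

end

theory Submission
  imports Defs "HOL-Computational_Algebra.Polynomial" "HOL-Library.FuncSet"
begin

text \<open>
  Up to duality, $\mathcal L_\chi(\Lambda)$ is the submodule generated by the highest weight vector
  of a module of functions on words in \<open>I\<close>, on which $E_i$ removes a letter; up to rescaling of the
  generators it depends only on $\chi$ and the numbers $h_i=\Lambda(K_{\alpha_i}L_{-\alpha_i})$. If
  $h=h_{\chi,\Lambda,i}$ is finite, then $F_i^h\tilde v_\Lambda$ is a highest weight vector for the
  generators twisted by the Lusztig isomorphism $U(\tau_i\chi)\to U(\chi)$. This yields a linear
  isomorphism $\mathcal L_\chi(\Lambda)\to\mathcal L_{\tau_i\chi}(\tau_i\Lambda)$ that sends the weight
  $-\beta$ (relative to the highest weight) to $-s_i(\beta-h\alpha_i)$. If $h=\infty$, the vectors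
  $F_i^m\tilde v_\Lambda$ are nonzero of different weights. Hence finite dimension passes along the word
  and forces all heights to be finite. Conversely, if all heights are finite, then the $\beta$ with
  weight $-\beta$ occurring in $\mathcal L_\chi(\Lambda)$ have the form $w_0\gamma+c$ with a constant
  \<open>c\<close> and $\gamma\ge0$, so $0\le\beta\le c$.

  The reflections exist because a finite number of Kharchenko roots bounds the growth of $U^-(\chi)$
  by a polynomial, polynomial growth is inherited by $\tau_i\chi$, and $c^\chi_{ij}=-\infty$ would
  produce the strictly decreasing monomials in infinitely many linearly independent elements
  $\mathrm{ad}(F_i)^m(F_j)$, too many for polynomial growth.
\<close>

section \<open>Evaluation homomorphisms of free algebras\<close>

text \<open>Functions on words give two cheap vanishing criteria. An operator that commutes with all
  E_i is zero once all its vacuum coefficients vanish: this proves relations among lowering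
  operators on all functions. An operator that kills the highest weight vector and commutes with all
  F_i kills the submodule it generates: this proves relations among raising operators, but only
  there. Serre relations and the vanishing of the ideals defining U(\<chi>) come from these two
  criteria, which is why many statements are confined to \<open>Lmod\<close>. The obstacle is that
  finite Cartan entries are needed at every stage of the word. Growth is transported through the
  weight h with value 1 at i and 0 elsewhere: its height at i is 0 and its reflection is again the
  same h, so reflection compares quotients of U^-(\<chi>) and U^-(\<tau>_i\<chi>). What is lost
  between U^- and its quotient is measured by a second skew derivation at i. Its kernel lies in the
  quotient and its (M+1)-st power vanishes up to height M, so the dimension bound worsens by a
  factor M+1. Polynomial growth survives this; an exact dimension count would not.\<close>

lemma letters_zero [simp]: "letters 0 = []"
  by (simp add: zero_fword_def)

lemma letters_plus [simp]: "letters (u + v) = letters u @ letters v"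
  by (simp add: plus_fword_def)

lemma feval_superset:
  assumes "finite W" "Poly_Mapping.keys x \<subseteq> W" "\<iota> 0 = 0"
  shows "feval \<iota> g x = (\<Sum>w\<in>W. \<iota> (Poly_Mapping.lookup x w) * prod_list (map g (letters w)))"
  unfolding feval_def using assms
  by (intro sum.mono_neutral_left) (auto simp: in_keys_iff)

lemma feval_add:
  assumes "\<iota> 0 = 0" "\<And>a b. \<iota> (a + b) = \<iota> a + \<iota> b"
  shows "feval \<iota> g (x + y) = feval \<iota> g x + feval \<iota> g y"
proof -
  let ?W = "Poly_Mapping.keys x \<union> Poly_Mapping.keys y"
  have "Poly_Mapping.keys (x + y) \<subseteq> ?W"
    by (rule Poly_Mapping.keys_add)
  then show ?thesis
    using feval_superset[of ?W "x + y" \<iota> g] feval_superset[of ?W x \<iota> g] feval_superset[of ?W y \<iota> g] assms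
    by (simp add: lookup_add distrib_right sum.distrib)
qed

lemma feval_zero: "\<iota> 0 = 0 \<Longrightarrow> feval \<iota> g 0 = 0"
  by (simp add: feval_def)

lemma feval_sum:
  assumes "\<iota> 0 = 0" "\<And>a b. \<iota> (a + b) = \<iota> a + \<iota> b"
  shows "feval \<iota> g (sum x S) = (\<Sum>s\<in>S. feval \<iota> g (x s))"
  by (induction S rule: infinite_finite_induct) (simp_all add: feval_zero feval_add assms)

lemma feval_single:
  assumes "\<iota> 0 = 0"
  shows "feval \<iota> g (Poly_Mapping.single w c) = \<iota> c * prod_list (map g (letters w))"
  using assms by (simp add: feval_def)

lemma poly_mapping_expand:
  "x = (\<Sum>w\<in>Poly_Mapping.keys x. Poly_Mapping.single w (Poly_Mapping.lookup x w))"
proof (rule poly_mapping_eqI)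
  fix v
  have "Poly_Mapping.lookup x v = (\<Sum>w\<in>Poly_Mapping.keys x. if w = v then Poly_Mapping.lookup x w else 0)"
    by (auto simp: in_keys_iff)
  then show "Poly_Mapping.lookup x v = Poly_Mapping.lookup (\<Sum>w\<in>Poly_Mapping.keys x. Poly_Mapping.single w (Poly_Mapping.lookup x w)) v"
    by (simp add: lookup_sum lookup_single when_def)
qed

lemma feval_mult:
  assumes "\<iota> 0 = 0" "\<And>a b. \<iota> (a + b) = \<iota> a + \<iota> b" "\<And>a b. \<iota> (a * b) = \<iota> a * \<iota> b"
    and central: "\<And>a z. \<iota> a * z = z * \<iota> a"
  shows "feval \<iota> g (x * y) = feval \<iota> g x * feval \<iota> g y"
proof -
  have single: "feval \<iota> g (Poly_Mapping.single u a * Poly_Mapping.single v b) =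
      feval \<iota> g (Poly_Mapping.single u a) * feval \<iota> g (Poly_Mapping.single v b)" for u v a b
    using assms(1,3) central[of b "prod_list (map g (letters u))"]
    by (simp add: mult_single feval_single mult.assoc) (simp flip: mult.assoc)
  let ?s = "\<lambda>x w. Poly_Mapping.single w (Poly_Mapping.lookup x w)"
  have "feval \<iota> g (x * y) = feval \<iota> g ((\<Sum>w\<in>Poly_Mapping.keys x. ?s x w) * (\<Sum>w\<in>Poly_Mapping.keys y. ?s y w))"
    by (simp only: poly_mapping_expand[symmetric])
  also have "\<dots> = feval \<iota> g (\<Sum>w\<in>Poly_Mapping.keys x. ?s x w) * feval \<iota> g (\<Sum>w\<in>Poly_Mapping.keys y. ?s y w)"
    by (simp add: sum_product feval_sum assms(1,2) single)
  finally show ?thesis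
    by (simp only: poly_mapping_expand[symmetric])
qed

lemma feval_one: "\<iota> 0 = 0 \<Longrightarrow> \<iota> 1 = 1 \<Longrightarrow> feval \<iota> g 1 = 1"
  by (simp flip: single_one add: feval_single)

lemma feval_fvar: "\<iota> 0 = 0 \<Longrightarrow> \<iota> 1 = 1 \<Longrightarrow> feval \<iota> g (fvar a) = g a"
  by (simp add: fvar_def feval_single)

lemma feval_fconst: "\<iota> 0 = 0 \<Longrightarrow> feval \<iota> g (fconst c) = \<iota> c"
  by (simp add: fconst_def feval_single)

lemma fconst_simps [simp]:
  "fconst 0 = 0" "fconst 1 = 1" "fconst (a + b) = fconst a + fconst b"
  "fconst (a * b) = fconst a * fconst b"
  by (simp_all add: fconst_def single_add mult_single)

lemma fconst_central: "fconst c * x = x * (fconst c :: ('g, 'k::field) free_alg)"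
proof -
  have *: "fconst c * Poly_Mapping.single w d = Poly_Mapping.single w d * fconst c" for w :: "'g fword" and d
    by (simp add: fconst_def mult_single mult.commute)
  have "fconst c * (\<Sum>w\<in>Poly_Mapping.keys x. Poly_Mapping.single w (Poly_Mapping.lookup x w))
     = (\<Sum>w\<in>Poly_Mapping.keys x. Poly_Mapping.single w (Poly_Mapping.lookup x w)) * fconst c"
    by (simp add: sum_distrib_left sum_distrib_right *)
  then show ?thesis
    by (simp only: poly_mapping_expand[symmetric])
qed


section \<open>Linear operators on function spaces\<close>

text \<open>Functions serve as vectors here, and unfolding sums pointwise by default would hide the
  linear structure. Values are compared only where \<open>pointwise\<close> is supplied.\<close>

declare plus_fun_apply [simp del] zero_fun_apply [simp del] minus_apply [simp del] uminus_apply [simp del]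

definition fnscale :: "'k::field \<Rightarrow> ('w \<Rightarrow> 'k) \<Rightarrow> 'w \<Rightarrow> 'k" where
  "fnscale c g = (\<lambda>w. c * g w)"

lemma fnscale_apply: "fnscale c g w = c * g w"
  by (simp add: fnscale_def)

lemmas pointwise = fun_eq_iff plus_fun_apply zero_fun_apply minus_apply uminus_apply fnscale_apply

global_interpretation fnv: vector_space "fnscale :: 'k::field \<Rightarrow> ('w \<Rightarrow> 'k) \<Rightarrow> _"
  by standard (auto simp: pointwise algebra_simps)

text \<open>Linear operators form a type of their own so that they are an instance of
  \<open>ring_1\<close>: \<open>feval\<close> can then take values in operators, and commutation
  rules can be proved in an abstract ring.\<close>

typedef (overloaded) ('w, 'k::field) lop = "{T :: ('w \<Rightarrow> 'k) \<Rightarrow> 'w \<Rightarrow> 'k.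
    (\<forall>x y. T (x + y) = T x + T y) \<and> (\<forall>c x. T (fnscale c x) = fnscale c (T x))}"
  morphisms app Abs_lop
  by (rule exI[of _ id]) simp

setup_lifting type_definition_lop

instantiation lop :: (type, field) ring_1
begin
lift_definition zero_lop :: "('a, 'b) lop" is "\<lambda>g. 0"
  by (simp add: pointwise)
lift_definition one_lop :: "('a, 'b) lop" is "\<lambda>g. g"
  by simp
lift_definition plus_lop :: "('a, 'b) lop \<Rightarrow> ('a, 'b) lop \<Rightarrow> ('a, 'b) lop" is "\<lambda>S T g. S g + T g"
  by (simp add: algebra_simps pointwise)
lift_definition minus_lop :: "('a, 'b) lop \<Rightarrow> ('a, 'b) lop \<Rightarrow> ('a, 'b) lop" is "\<lambda>S T g. S g - T g"
  by (simp add: algebra_simps pointwise)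
lift_definition uminus_lop :: "('a, 'b) lop \<Rightarrow> ('a, 'b) lop" is "\<lambda>T g. - T g"
  by (simp add: algebra_simps pointwise)
lift_definition times_lop :: "('a, 'b) lop \<Rightarrow> ('a, 'b) lop \<Rightarrow> ('a, 'b) lop" is "\<lambda>S T g. S (T g)"
  by simp
instance
proof
  show "(0 :: ('a, 'b) lop) \<noteq> 1"
    by transfer (metis fun_eq_iff one_neq_zero zero_fun_def)
qed (transfer; simp add: algebra_simps pointwise)+
end

lemma app_simps [simp]:
  "app 0 g = 0" "app 1 g = g" "app (S + T) g = app S g + app T g"
  "app (S - T) g = app S g - app T g" "app (- T) g = - app T g"
  "app (S * T) g = app S (app T g)"
  by (transfer; simp)+

lemma app_lin [simp]:
  "app T (x + y) = app T x + app T y" "app T (fnscale c x) = fnscale c (app T x)"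
  by (transfer; simp)+

lemma app_zero [simp]: "app T 0 = 0"
  using app_lin(2)[of T 0 0] by (simp add: fnscale_def zero_fun_def)

lemma app_linear: "Vector_Spaces.linear fnscale fnscale (app T)"
  by unfold_locales simp_all

lemma app_minus_arg [simp]: "app T (x - y) = app T x - app T y"
  using app_lin(1)[of T "x - y" y] by (simp add: algebra_simps)

lemma app_sum: "app T (sum x S) = (\<Sum>s\<in>S. app T (x s))"
  by (induction S rule: infinite_finite_induct)
    (simp_all only: sum.infinite sum.empty sum.insert app_zero app_lin not_False_eq_True)

lemma lop_eqI: "(\<And>g. app S g = app T g) \<Longrightarrow> S = T"
  by transfer auto

lift_definition lsc :: "'k::field \<Rightarrow> ('w, 'k) lop" is "\<lambda>c g. fnscale c g"
  by (simp add: pointwise algebra_simps)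

lemma app_lsc [simp]: "app (lsc c) g = fnscale c g"
  by transfer simp

lemma lsc_simps: "lsc 0 = 0" "lsc 1 = 1" "lsc (a + b) = lsc a + lsc b" "lsc (a * b) = lsc a * lsc b"
  "lsc c * T = T * lsc c"
  by (rule lop_eqI; simp add: pointwise algebra_simps)+

section \<open>Commutation rules in a generalized quantum group\<close>

lemma bihom_simps:
  assumes "bihom X"
  shows "X \<alpha> \<beta> \<noteq> 0" "X \<alpha> (\<beta> + \<gamma>) = X \<alpha> \<beta> * X \<alpha> \<gamma>" "X (\<alpha> + \<beta>) \<gamma> = X \<alpha> \<gamma> * X \<beta> \<gamma>"
    "X 0 \<beta> = 1" "X \<alpha> 0 = 1" "X (- \<alpha>) \<beta> = inverse (X \<alpha> \<beta>)" "X \<alpha> (- \<beta>) = inverse (X \<alpha> \<beta>)"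
    "X (\<alpha> - \<beta>) \<gamma> = X \<alpha> \<gamma> * inverse (X \<beta> \<gamma>)" "X \<alpha> (\<beta> - \<gamma>) = X \<alpha> \<beta> * inverse (X \<alpha> \<gamma>)"
proof -
  show *: "X \<alpha> \<beta> \<noteq> 0" "X \<alpha> (\<beta> + \<gamma>) = X \<alpha> \<beta> * X \<alpha> \<gamma>" "X (\<alpha> + \<beta>) \<gamma> = X \<alpha> \<gamma> * X \<beta> \<gamma>" for \<alpha> \<beta> \<gamma>
    using assms by (simp_all add: bihom_def)
  show 0: "X 0 \<beta> = 1" "X \<alpha> 0 = 1" for \<alpha> \<beta>
    using *(3)[of 0 0 \<beta>] *(2)[of \<alpha> 0 0] *(1)[of 0 \<beta>] *(1)[of \<alpha> 0] by simp_all
  show l: "X (- \<alpha>) \<beta> = inverse (X \<alpha> \<beta>)" for \<alpha> \<beta>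
    using *(3)[of \<alpha> "- \<alpha>" \<beta>] 0(1)[of \<beta>] by (metis add.right_inverse inverse_unique)
  show r: "X \<alpha> (- \<beta>) = inverse (X \<alpha> \<beta>)" for \<alpha> \<beta>
    using *(2)[of \<alpha> \<beta> "- \<beta>"] 0(2)[of \<alpha>] by (metis add.right_inverse inverse_unique)
  show "X (\<alpha> - \<beta>) \<gamma> = X \<alpha> \<gamma> * inverse (X \<beta> \<gamma>)" "X \<alpha> (\<beta> - \<gamma>) = X \<alpha> \<beta> * inverse (X \<alpha> \<gamma>)"
    using *(3)[of \<alpha> "- \<beta>" \<gamma>] *(2)[of \<alpha> \<beta> "- \<gamma>"] by (simp_all add: l r)
qed

definition commutator :: "'b::ring_1 \<Rightarrow> 'b \<Rightarrow> 'b" where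
  "commutator x y = x * y - y * x"

lemma commutator_mult_left: "commutator (x * y) z = x * commutator y z + commutator x z * y"
  by (simp add: commutator_def algebra_simps)

lemma commutator_mult_right: "commutator x (y * z) = commutator x y * z + y * commutator x z"
  by (simp add: commutator_def algebra_simps)

lemma commutator_diff: "commutator (x - y) z = commutator x z - commutator y z"
  "commutator x (y - z) = commutator x y - commutator x z"
  by (simp_all add: commutator_def algebra_simps)

text \<open>The iterated braided adjoint action of x on y. In \<open>es\<close> the twist q^m r is
  the scalar by which K_i moves past the element reached after m steps; in \<open>fs\<close> it is
  the one for L_i.\<close>

primrec qadj :: "('k \<Rightarrow> 'b::ring_1) \<Rightarrow> 'k::field \<Rightarrow> 'k \<Rightarrow> 'b \<Rightarrow> 'b \<Rightarrow> nat \<Rightarrow> 'b" where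
  "qadj \<iota> q r x y 0 = y"
| "qadj \<iota> q r x y (Suc m) = x * qadj \<iota> q r x y m - \<iota> (q ^ m * r) * (qadj \<iota> q r x y m * x)"

section \<open>Quantum integers and factorials\<close>

lemma qnum_0 [simp]: "qnum 0 q = 0" and qnum_1 [simp]: "qnum (Suc 0) q = 1"
  by (simp_all add: qnum_def)

lemma qnum_Suc: "qnum (Suc m) q = qnum m q + q ^ m"
  by (simp add: qnum_def)

lemma qnum_Suc': "qnum (Suc m) q = 1 + q * qnum m q"
proof (induction m)
  case (Suc m)
  have "qnum (Suc (Suc m)) q = qnum (Suc m) q + q ^ Suc m"
    by (rule qnum_Suc)
  also have "\<dots> = 1 + q * (qnum m q + q ^ m)"
    by (simp only: Suc) (simp add: algebra_simps)
  finally show ?case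
    by (simp only: qnum_Suc[symmetric])
qed simp

lemma qnum_geometric: "(1 - q) * qnum m q = 1 - q ^ m"
proof (induction m)
  case (Suc m)
  then show ?case
    by (simp only: qnum_Suc distrib_left) (simp add: algebra_simps)
qed simp

lemma qnum_inverse: "q \<noteq> 0 \<Longrightarrow> qnum (Suc m) (inverse q) = qnum (Suc m) q / q ^ m"
proof (induction m)
  case (Suc m)
  have "qnum (Suc (Suc m)) (inverse q) = qnum (Suc m) q / q ^ m + 1 / q ^ Suc m"
    using qnum_Suc[of "Suc m" "inverse q"] Suc by (simp add: divide_inverse power_inverse del: power_Suc)
  also have "\<dots> = (1 + q * qnum (Suc m) q) / q ^ Suc m"
    using Suc.prems by (simp add: field_simps)
  finally show ?case
    by (simp only: qnum_Suc'[symmetric])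
qed simp

lemma qfact_0 [simp]: "qfact 0 q = 1"
  by (simp add: qfact_def)

lemma qfact_Suc: "qfact (Suc m) q = qfact m q * qnum (Suc m) q"
  by (simp add: qfact_def)

lemma qpoch_0 [simp]: "qpoch 0 q p = 1"
  by (simp add: qpoch_def)

lemma qpoch_Suc: "qpoch (Suc m) q p = qpoch m q p * (1 - q ^ m * p)"
  by (simp add: qpoch_def)

text \<open>The quotient (n+k)!/k! of quantum factorials, written as a product because k! may vanish
  when q is a root of unity.\<close>

definition qrising :: "nat \<Rightarrow> nat \<Rightarrow> 'k::field \<Rightarrow> 'k" where
  "qrising n k q = (\<Prod>s=Suc k..k+n. qnum s q)"

lemma qrising_0 [simp]: "qrising 0 k q = 1"
  by (simp add: qrising_def)

lemma qrising_Suc: "qrising (Suc n) k q = qrising n k q * qnum (Suc (n + k)) q"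
  by (simp add: qrising_def add.commute)

lemma qrising_Suc': "qrising (Suc n) k q = qnum (Suc k) q * qrising n (Suc k) q"
  unfolding qrising_def
  by (subst prod.atLeast_Suc_atMost) auto

lemma qrising_qfact: "qrising n 0 q = qfact n q"
  by (induction n) (simp_all add: qrising_Suc qfact_Suc)

text \<open>The constants \<open>a\<close> and \<open>b\<close> are left free so that the normalized
  operators, with a = 1 and b = h, and their mirror image with the roles exchanged are both
  instances.\<close>

locale qg =
  fixes \<iota> :: "'k::field \<Rightarrow> 'b::ring_1"
    and X :: "('i::finite, 'k) bichar" and a b :: "'i \<Rightarrow> 'k"
    and K L :: "'i lattice \<Rightarrow> 'b" and e f :: "'i \<Rightarrow> 'b"
  assumes iota: "\<iota> 0 = 0" "\<iota> 1 = 1" "\<And>c d. \<iota> (c + d) = \<iota> c + \<iota> d" "\<And>c d. \<iota> (c * d) = \<iota> c * \<iota> d"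
    and central: "\<And>c x. \<iota> c * x = x * \<iota> c"
    and bihom: "bihom X"
    and K_L: "K 0 = 1" "L 0 = 1" "\<And>\<alpha> \<beta>. K (\<alpha> + \<beta>) = K \<alpha> * K \<beta>" "\<And>\<alpha> \<beta>. L (\<alpha> + \<beta>) = L \<alpha> * L \<beta>"
      "\<And>\<alpha> \<beta>. K \<alpha> * L \<beta> = L \<beta> * K \<alpha>"
    and Ke: "\<And>\<alpha> i. K \<alpha> * e i = \<iota> (X \<alpha> (sroot i)) * (e i * K \<alpha>)"
    and Le: "\<And>\<alpha> i. L \<alpha> * e i = \<iota> (X (- sroot i) \<alpha>) * (e i * L \<alpha>)"
    and Kf: "\<And>\<alpha> i. K \<alpha> * f i = \<iota> (X \<alpha> (- sroot i)) * (f i * K \<alpha>)"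
    and Lf: "\<And>\<alpha> i. L \<alpha> * f i = \<iota> (X (sroot i) \<alpha>) * (f i * L \<alpha>)"
    and ef: "\<And>i j. commutator (e i) (f j) =
      (if i = j then \<iota> (a i) * L (sroot i) - \<iota> (b i) * K (sroot i) else 0)"
begin

definition sm :: "'k \<Rightarrow> 'b \<Rightarrow> 'b" (infixr "\<odot>" 75) where
  "c \<odot> x = \<iota> c * x"

lemma sm_simps [simp]: "0 \<odot> x = 0" "1 \<odot> x = x" "c \<odot> 0 = 0"
  "c \<odot> d \<odot> x = (c * d) \<odot> x" "(c \<odot> x) * y = c \<odot> (x * y)" "x * (c \<odot> y) = c \<odot> (x * y)"
  "c \<odot> (x + y) = c \<odot> x + c \<odot> y" "c \<odot> (x - y) = c \<odot> x - c \<odot> y" "c \<odot> (- x) = - (c \<odot> x)"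
proof -
  have "x * (\<iota> c * y) = \<iota> c * (x * y)"
    by (metis central mult.assoc)
  then show "x * (c \<odot> y) = c \<odot> (x * y)"
    by (simp add: sm_def)
qed (simp_all add: sm_def iota mult.assoc distrib_left right_diff_distrib)

lemma sm_add: "(c + d) \<odot> x = c \<odot> x + d \<odot> x"
  by (simp add: sm_def iota distrib_right)

lemma sm_minus: "(- c) \<odot> x = - (c \<odot> x)"
  using sm_add[of c "- c" x] by (simp add: eq_neg_iff_add_eq_0 add.commute)

lemma sm_diff: "(c - d) \<odot> x = c \<odot> x - d \<odot> x"
  using sm_add[of c "- d" x] by (simp add: sm_minus)

lemma commutator_sm [simp]: "commutator (c \<odot> x) y = c \<odot> commutator x y"
  "commutator x (c \<odot> y) = c \<odot> commutator x y"
  by (simp_all add: commutator_def)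

definition es :: "'i \<Rightarrow> 'i \<Rightarrow> nat \<Rightarrow> 'b" where
  "es i j = qadj \<iota> (X (sroot i) (sroot i)) (X (sroot i) (sroot j)) (e i) (e j)"

definition fs :: "'i \<Rightarrow> 'i \<Rightarrow> nat \<Rightarrow> 'b" where
  "fs i j = qadj \<iota> (X (sroot i) (sroot i)) (X (sroot j) (sroot i)) (f i) (f j)"

lemma es_simps: "es i j 0 = e j"
  "es i j (Suc m) = e i * es i j m - (X (sroot i) (sroot i) ^ m * X (sroot i) (sroot j)) \<odot> (es i j m * e i)"
  by (simp_all add: es_def sm_def)

lemma fs_simps: "fs i j 0 = f j"
  "fs i j (Suc m) = f i * fs i j m - (X (sroot i) (sroot i) ^ m * X (sroot j) (sroot i)) \<odot> (fs i j m * f i)"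
  by (simp_all add: fs_def sm_def)

lemma Ke': "K \<alpha> * e i = X \<alpha> (sroot i) \<odot> (e i * K \<alpha>)"
  and Le': "L \<alpha> * e i = inverse (X (sroot i) \<alpha>) \<odot> (e i * L \<alpha>)"
  and Kf': "K \<alpha> * f i = inverse (X \<alpha> (sroot i)) \<odot> (f i * K \<alpha>)"
  and Lf': "L \<alpha> * f i = X (sroot i) \<alpha> \<odot> (f i * L \<alpha>)"
  by (simp_all add: Ke Le Kf Lf sm_def bihom_simps[OF bihom])

lemma ef': "commutator (e i) (f i) = a i \<odot> L (sroot i) - b i \<odot> K (sroot i)"
  "i \<noteq> j \<Longrightarrow> commutator (e i) (f j) = 0"
  by (simp_all add: ef sm_def)

lemma left_commute:
  assumes "x * y = c \<odot> (y * x)"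
  shows "x * (y * z) = c \<odot> (y * (x * z))"
  by (metis assms mult.assoc sm_simps(5))

text \<open>The axioms are symmetric under exchanging e with f, K with L, a with b and transposing
  \<chi>. Every identity for \<open>es\<close> thus has a counterpart for \<open>fs\<close>.\<close>

lemma qg_swap: "qg \<iota> (\<lambda>\<alpha> \<beta>. X \<beta> \<alpha>) b a L K f e"
proof
  show "bihom (\<lambda>\<alpha> \<beta>. X \<beta> \<alpha>)"
    using bihom by (simp add: bihom_def)
  show "commutator (f i) (e j) =
      (if i = j then \<iota> (b i) * K (sroot i) - \<iota> (a i) * L (sroot i) else 0)" for i j
    using ef[of j i] by (auto simp: commutator_def algebra_simps)
  show "\<iota> c * x = x * \<iota> c" for c x
    by (rule central)
qed (simp_all add: iota K_L Ke Le Kf Lf bihom_simps[OF bihom])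

lemma K_es: "K \<alpha> * es i j m = (X \<alpha> (sroot j) * X \<alpha> (sroot i) ^ m) \<odot> (es i j m * K \<alpha>)"
proof (induction m)
  case (Suc m)
  show ?case
    by (simp add: es_simps algebra_simps left_commute[OF Ke'] Ke' Suc left_commute[OF Suc])
qed (simp add: es_simps Ke')

lemma L_es: "L \<alpha> * es i j m = inverse (X (sroot j) \<alpha> * X (sroot i) \<alpha> ^ m) \<odot> (es i j m * L \<alpha>)"
proof (induction m)
  case (Suc m)
  show ?case
    by (simp add: es_simps algebra_simps left_commute[OF Le'] Le' Suc left_commute[OF Suc])
qed (simp add: es_simps Le')

lemma commutator_epow:
  "commutator (e i ^ Suc m) (f i) =
     (a i * qnum (Suc m) (inverse (X (sroot i) (sroot i)))) \<odot> (e i ^ m * L (sroot i))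
     - (b i * qnum (Suc m) (X (sroot i) (sroot i))) \<odot> (e i ^ m * K (sroot i))"
proof (induction m)
  case 0
  show ?case by (simp add: ef' qnum_def)
next
  case (Suc m)
  let ?q = "X (sroot i) (sroot i)"
  have "commutator (e i ^ Suc (Suc m)) (f i) = e i * commutator (e i ^ Suc m) (f i) + commutator (e i) (f i) * e i ^ Suc m"
    by (simp add: commutator_mult_left)
  moreover have "L (sroot i) * e i ^ k = inverse ?q ^ k \<odot> (e i ^ k * L (sroot i))"
    "K (sroot i) * e i ^ k = ?q ^ k \<odot> (e i ^ k * K (sroot i))" for k
    by (induction k) (simp_all add: left_commute[OF Le'] left_commute[OF Ke'] mult.commute mult.assoc)
  ultimately show ?case
    by (simp add: Suc ef' left_diff_distrib right_diff_distrib qnum_Suc[of "Suc m"] distrib_left sm_add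
        mult.assoc del: power_Suc) (simp add: power_Suc[of _ m] mult.assoc)
qed

text \<open>The coefficient met when f_i takes \<open>es i j (Suc m)\<close> down to
  \<open>es i j m\<close>. Up to a unit it is the quotient of consecutive values of (m)!(m;q,rs)!,
  so its first zero is at m = -c_ij.\<close>

definition bcoef :: "'i \<Rightarrow> 'i \<Rightarrow> nat \<Rightarrow> 'k" where
  "bcoef i j m = (let q = X (sroot i) (sroot i); r = X (sroot i) (sroot j); s = X (sroot j) (sroot i)
     in qnum (Suc m) q * (1 - q ^ m * (r * s)) / (s * q ^ m))"

lemma bcoef_Suc: "bcoef i j (Suc m) = bcoef i j m + 
   (inverse (X (sroot j) (sroot i) * X (sroot i) (sroot i) ^ Suc m) - X (sroot i) (sroot i) ^ Suc m * X (sroot i) (sroot j))"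
proof -
  have nz: "X (sroot i) (sroot i) \<noteq> 0" "X (sroot j) (sroot i) \<noteq> 0"
    using bihom by (simp_all add: bihom_simps)
  define q r s where "q = X (sroot i) (sroot i)" and "r = X (sroot i) (sroot j)" and "s = X (sroot j) (sroot i)"
  define A where "A = qnum (Suc m) q"
  define Q where "Q = q ^ m"
  \<comment> \<open>The two recursions for the quantum integer of m+2 give the only relation between
    q, Q and A that the identity with cleared denominators requires.\<close>
  have "A + q * Q = 1 + q * A"
    unfolding A_def Q_def using qnum_Suc[of "Suc m" q] qnum_Suc'[of "Suc m" q] by simp
  then have A: "q * Q = 1 + q * A - A"
    by (simp add: algebra_simps)
  have nz': "q \<noteq> 0" "s \<noteq> 0" "Q \<noteq> 0"
    using nz by (simp_all add: q_def s_def Q_def)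
  have 2: "qnum (Suc (Suc m)) q = 1 + q * A"
    by (simp add: qnum_Suc' A_def)
  have "bcoef i j (Suc m) * (s * Q * q) = (1 + q * A) * (1 - q * Q * (r * s))"
    using nz' by (simp add: bcoef_def Let_def 2 field_simps flip: q_def r_def s_def Q_def)
  moreover have "(bcoef i j m + (inverse (s * q ^ Suc m) - q ^ Suc m * r)) * (s * Q * q)
     = q * (A * (1 - Q * (r * s))) + 1 - q * Q * r * s * (q * Q)"
    using nz' by (simp add: bcoef_def Let_def field_simps flip: q_def r_def s_def Q_def A_def)
  moreover have "(1 + q * A) * (1 - q * Q * (r * s)) = q * (A * (1 - Q * (r * s))) + 1 - q * Q * r * s * (q * Q)"
    using A by algebra
  ultimately have "bcoef i j (Suc m) * (s * Q * q)
      = (bcoef i j m + (inverse (s * q ^ Suc m) - q ^ Suc m * r)) * (s * Q * q)"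
    by (simp only:)
  then have "bcoef i j (Suc m) = bcoef i j m + (inverse (s * q ^ Suc m) - q ^ Suc m * r)"
    using nz' by (simp del: power_Suc)
  then show ?thesis
    by (simp only: q_def r_def s_def)
qed

text \<open>The twist in \<open>es\<close> makes the K_i parts of [e_i,f_i] cancel at every step.
  Only L_i remains, and its coefficients add up by \<open>bcoef_Suc\<close>.\<close>

lemma commutator_es_fi:
  assumes "i \<noteq> j"
  shows "commutator (es i j 0) (f i) = 0"
    "commutator (es i j (Suc m)) (f i) = (a i * bcoef i j m) \<odot> (es i j m * L (sroot i))"
proof -
  let ?q = "X (sroot i) (sroot i)" and ?r = "X (sroot i) (sroot j)" and ?s = "X (sroot j) (sroot i)"
  have nz: "?q \<noteq> 0" "?r \<noteq> 0" "?s \<noteq> 0"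
    using bihom by (simp_all add: bihom_simps)
  show z: "commutator (es i j 0) (f i) = 0"
    using assms by (simp add: es_simps ef')
  have step: "commutator (es i j (Suc m)) (f i) =
      e i * commutator (es i j m) (f i) - (?q ^ m * ?r) \<odot> (commutator (es i j m) (f i) * e i)
      + (a i * (inverse (?s * ?q ^ m) - ?q ^ m * ?r)) \<odot> (es i j m * L (sroot i))" for m
    by (simp add: es_simps commutator_diff commutator_mult_left ef' left_diff_distrib right_diff_distrib
        L_es K_es sm_diff algebra_simps)
  show "commutator (es i j (Suc m)) (f i) = (a i * bcoef i j m) \<odot> (es i j m * L (sroot i))"
  proof (induction m)
    case 0
    have "bcoef i j 0 = inverse ?s - ?r"
      using nz by (simp add: bcoef_def diff_divide_distrib inverse_eq_divide)
    then show ?case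
      by (simp add: step z)
  next
    case (Suc m)
    have cancel: "?q * (?r * (inverse ?q * z)) = ?r * z" for z
      using nz by simp
    have "commutator (es i j (Suc (Suc m))) (f i) = (a i * bcoef i j m) \<odot> (es i j (Suc m) * L (sroot i))
      + (a i * (inverse (?s * ?q ^ Suc m) - ?q ^ Suc m * ?r)) \<odot> (es i j (Suc m) * L (sroot i))"
      unfolding step[of "Suc m"] Suc
      by (simp add: cancel es_simps Le' mult.assoc left_diff_distrib mult_ac)
    then show ?case
      by (simp add: bcoef_Suc distrib_left sm_add)
  qed
qed

lemma commutator_es_fk: "k \<noteq> i \<Longrightarrow> k \<noteq> j \<Longrightarrow> commutator (es i j m) (f k) = 0"
  by (induction m) (simp_all add: es_simps ef' commutator_diff commutator_mult_left)

lemma fs_swap: "fs i j = qg.es \<iota> (\<lambda>\<alpha> \<beta>. X \<beta> \<alpha>) f i j"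
  by (simp add: fs_def qg.es_def[OF qg_swap])

lemmas commutator_fs_ei = qg.commutator_es_fi[OF qg_swap, folded fs_swap]
lemmas commutator_fs_ek = qg.commutator_es_fk[OF qg_swap, folded fs_swap]
lemmas commutator_fpow = qg.commutator_epow[OF qg_swap, folded fs_swap]
lemmas L_fs = qg.K_es[OF qg_swap, folded fs_swap]

abbreviation "acoef i j m \<equiv> qpoch m (X (sroot i) (sroot i)) (X (sroot i) (sroot j) * X (sroot j) (sroot i))"

text \<open>The first twisted commutator with e_i cancels the L_j term, whereas each passage of K_j
  past e_i contributes one factor of the shifted factorial.\<close>

lemma commutator_es_fj:
  assumes "i \<noteq> j"
  shows "commutator (es i j 0) (f j) = a j \<odot> L (sroot j) - b j \<odot> K (sroot j)"
    "commutator (es i j (Suc m)) (f j) = - ((acoef i j (Suc m) * b j) \<odot> (e i ^ Suc m * K (sroot j)))"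
proof -
  let ?q = "X (sroot i) (sroot i)" and ?r = "X (sroot i) (sroot j)" and ?s = "X (sroot j) (sroot i)"
  have nz: "?q \<noteq> 0" "?r \<noteq> 0" "?s \<noteq> 0"
    using bihom by (simp_all add: bihom_simps)
  show z: "commutator (es i j 0) (f j) = a j \<odot> L (sroot j) - b j \<odot> K (sroot j)"
    by (simp add: es_simps ef')
  have step: "commutator (es i j (Suc m)) (f j) =
      e i * commutator (es i j m) (f j) - (?q ^ m * ?r) \<odot> (commutator (es i j m) (f j) * e i)" for m
    using assms by (simp add: es_simps commutator_diff commutator_mult_left ef')
  show "commutator (es i j (Suc m)) (f j) = - ((acoef i j (Suc m) * b j) \<odot> (e i ^ Suc m * K (sroot j)))"
  proof (induction m)
    case 0
    show ?case
      unfolding step z using nz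
      by (simp add: qpoch_def left_diff_distrib right_diff_distrib Ke' Le' sm_diff mult_ac)
  next
    case (Suc m)
    show ?case
      unfolding step[of "Suc m"] Suc qpoch_Suc[of "Suc m"]
      by (simp add: power_commutes mult.assoc Ke' left_diff_distrib right_diff_distrib sm_diff mult_ac)
        (simp flip: mult.assoc add: power_commutes)
  qed
qed

section \<open>Commutators between iterated adjoints of raising and of lowering elements\<close>

lemma commutator_es_fs_step:
  assumes "i \<noteq> l"
  shows "commutator x (fs i l (Suc n)) =
    (f i * commutator x (fs i l n) - (X (sroot i) (sroot i) ^ n * X (sroot l) (sroot i)) \<odot> (commutator x (fs i l n) * f i))
    + (commutator x (f i) * fs i l n - (X (sroot i) (sroot i) ^ n * X (sroot l) (sroot i)) \<odot> (fs i l n * commutator x (f i)))"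
  by (simp add: fs_simps commutator_diff commutator_mult_right algebra_simps)

text \<open>The commutator of \<open>es i j (Suc m)\<close> with f_i is a multiple of
  \<open>es i j m\<close> times L_i, and L_i moves past \<open>fs i l n\<close> with exactly the
  scalar of the twist. Half of the Leibniz step thus collapses to a commutator one index lower in
  m.\<close>

lemma commutator_es_fs_corr:
  assumes "i \<noteq> j" "i \<noteq> l"
  shows "commutator (es i j (Suc m)) (f i) * fs i l n
      - (X (sroot i) (sroot i) ^ n * X (sroot l) (sroot i)) \<odot> (fs i l n * commutator (es i j (Suc m)) (f i))
    = (a i * bcoef i j m * (X (sroot i) (sroot i) ^ n * X (sroot l) (sroot i)))
       \<odot> (commutator (es i j m) (fs i l n) * L (sroot i))"
  unfolding commutator_es_fi(2)[OF assms(1)] commutator_def[of "es i j m"]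
  by (simp add: L_fs left_diff_distrib mult.assoc mult_ac)

lemma commutator_es_fs_distinct:
  assumes "i \<noteq> j" "i \<noteq> l" "j \<noteq> l"
  shows "commutator (es i j m) (fs i l n) = 0"
proof (induction n arbitrary: m)
  case 0
  show ?case using assms by (simp add: fs_simps commutator_es_fk)
next
  case (Suc n)
  show ?case
  proof (cases m)
    case 0
    then show ?thesis
      by (simp only: commutator_es_fs_step[OF assms(2)] Suc commutator_es_fi(1)[OF assms(1)]) simp
  next
    case (Suc m')
    then show ?thesis
      by (simp only: commutator_es_fs_step[OF assms(2)] Suc.IH commutator_es_fs_corr[OF assms(1,2)]) simp
  qed
qed

text \<open>The diagonal case depends on the case next to it, so all cases below the diagonal are
  treated at once. With the index written as \<open>Suc (n + r)\<close>, the step to n+1 uses the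
  hypothesis for n at r+1 and at r.\<close>

lemma commutator_es_fs_lower:
  assumes "i \<noteq> j"
  shows "commutator (es i j (Suc (n + r))) (fs i j n) =
    - ((acoef i j (Suc (n + r)) * qrising n (Suc r) (X (sroot i) (sroot i)) * b j * b i ^ n)
        \<odot> (e i ^ Suc r * K (sroot j) * K (sroot i) ^ n))"
proof (induction n arbitrary: r)
  case 0
  show ?case using assms by (simp add: fs_simps commutator_es_fj)
next
  case (Suc n)
  let ?q = "X (sroot i) (sroot i)" and ?r = "X (sroot i) (sroot j)" and ?s = "X (sroot j) (sroot i)"
  have nz: "?q \<noteq> 0" "?r \<noteq> 0" "?s \<noteq> 0"
    using bihom by (simp_all add: bihom_simps)
  define W where "W = K (sroot j) * K (sroot i) ^ n"
  define c where "c = ?q ^ n * ?s"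
  have c: "c \<noteq> 0"
    using nz by (simp add: c_def)
  have "K (sroot i) ^ n * f i = inverse ?q ^ n \<odot> (f i * K (sroot i) ^ n)"
    by (induction n) (simp_all add: mult.assoc left_commute[OF Kf'] Kf' mult_ac)
  then have Wf: "W * f i = inverse c \<odot> (f i * W)"
    by (simp add: W_def c_def mult.assoc left_commute[OF Kf'] power_inverse mult.commute)
  have "K (sroot i) ^ n * L (sroot i) = L (sroot i) * K (sroot i) ^ n"
    by (induction n) (simp_all add: mult.assoc K_L, metis K_L(5) mult.assoc)
  then have WL: "W * L (sroot i) = L (sroot i) * W"
    unfolding W_def by (metis K_L(5) mult.assoc)
  have WK: "K (sroot i) * W = K (sroot j) * K (sroot i) ^ Suc n"
    unfolding W_def by (metis K_L(3) add.commute mult.assoc power_Suc)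
  define z where "z = acoef i j (Suc (Suc (n + r))) * qrising n (Suc (Suc r)) ?q * b j * b i ^ n"
  define z' where "z' = acoef i j (Suc (n + r)) * qrising n (Suc r) ?q * b j * b i ^ n"
  have Z: "commutator (es i j (Suc (Suc (n + r)))) (fs i j n) = - (z \<odot> (e i ^ Suc (Suc r) * W))"
    using Suc[of "Suc r"] by (simp add: z_def W_def mult.assoc del: power_Suc)
  have Z': "commutator (es i j (Suc (n + r))) (fs i j n) = - (z' \<odot> (e i ^ Suc r * W))"
    using Suc[of r] by (simp add: z'_def W_def mult.assoc del: power_Suc)
  define EW where "EW = e i ^ Suc (Suc r) * W"
  have cc: "c \<odot> (EW * f i) = e i ^ Suc (Suc r) * f i * W"
    using c by (simp add: EW_def mult.assoc Wf)
  have "f i * commutator (es i j (Suc (Suc (n + r)))) (fs i j n)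
      - c \<odot> (commutator (es i j (Suc (Suc (n + r)))) (fs i j n) * f i)
     = z \<odot> (c \<odot> (EW * f i) - f i * EW)"
    unfolding Z EW_def[symmetric] by (simp add: mult.commute)
  also have "\<dots> = z \<odot> (commutator (e i ^ Suc (Suc r)) (f i) * W)"
    unfolding cc by (simp add: EW_def commutator_def left_diff_distrib mult.assoc del: power_Suc)
  finally have 1: "f i * commutator (es i j (Suc (Suc (n + r)))) (fs i j n)
      - c \<odot> (commutator (es i j (Suc (Suc (n + r)))) (fs i j n) * f i)
     = z \<odot> (commutator (e i ^ Suc (Suc r)) (f i) * W)" .
  \<comment> \<open>The L_i terms from the commutator of the power of e_i with f_i and from the
    lower commutator have equal coefficients and cancel. Only the K_i terms survive.\<close>
  have L: "z * (a i * qnum (Suc (Suc r)) (inverse ?q)) = a i * bcoef i j (Suc (n + r)) * c * z'"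
  proof -
    define A p N Q R1 R2 M where "A = acoef i j (Suc (n + r))" and "p = 1 - ?q ^ Suc (n + r) * (?r * ?s)"
      and "N = qnum (Suc (Suc (n + r))) ?q" and "Q = ?q ^ Suc r" and "R1 = qrising n (Suc r) ?q"
      and "R2 = qrising n (Suc (Suc r)) ?q" and "M = qnum (Suc (Suc r)) ?q"
    note defs = A_def p_def N_def Q_def R1_def R2_def M_def
    have B: "bcoef i j (Suc (n + r)) * c = N * p / Q"
      using nz by (simp add: bcoef_def c_def Let_def power_add field_simps defs)
    have M: "qnum (Suc (Suc r)) (inverse ?q) = M / Q"
      using qnum_inverse[OF nz(1), of "Suc r"] by (simp only: M_def Q_def)
    have R: "R2 * M = R1 * N"
      using qrising_Suc[of n "Suc r" ?q] qrising_Suc'[of n "Suc r" ?q] by (simp add: mult.commute defs)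
    have "A * p * R2 * b j * b i ^ n * (a i * (M / Q)) = (R2 * M) * (A * p * b j * b i ^ n * a i / Q)"
      by simp
    also have "\<dots> = a i * (N * p / Q) * (A * R1 * b j * b i ^ n)"
      unfolding R by simp
    finally show ?thesis
      unfolding z_def z'_def qpoch_Suc[of "Suc (n + r)"] M
      using B by (simp only: defs[symmetric] mult.assoc)
  qed
  have K: "z * (b i * qnum (Suc (Suc r)) ?q) =
      acoef i j (Suc (Suc n + r)) * qrising (Suc n) (Suc r) ?q * b j * b i ^ Suc n"
    by (simp add: z_def qrising_Suc' mult_ac)
  have "commutator (es i j (Suc (Suc n + r))) (fs i j (Suc n)) =
    z \<odot> (commutator (e i ^ Suc (Suc r)) (f i) * W)
     + (a i * bcoef i j (Suc (n + r)) * c) \<odot> (- (z' \<odot> (e i ^ Suc r * W)) * L (sroot i))"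
    unfolding commutator_es_fs_step[OF assms] c_def[symmetric]
    using 1 commutator_es_fs_corr[OF assms assms, of "Suc (n + r)" n, unfolded Z', folded c_def]
    by simp
  also have "\<dots> = - ((z * (b i * qnum (Suc (Suc r)) ?q)) \<odot> (e i ^ Suc r * (K (sroot i) * W)))"
    unfolding commutator_epow by (simp add: left_diff_distrib L WL mult.assoc del: power_Suc)
  finally show ?case
    unfolding K WK by (simp add: mult.assoc del: power_Suc)
qed

text \<open>Splitting f_i off \<open>fs i j (Suc n)\<close> leaves the commutator just below the
  diagonal and the previous diagonal one, whose mixed K-L terms cancel. At m = -c_ij this is the
  relation between the reflected generators E_j and F_j, with K and L taken at
  s_i(\<alpha>_j).\<close>

lemma commutator_es_fs_diag:
  assumes "i \<noteq> j"
  shows "commutator (es i j m) (fs i j m) = (acoef i j m * qfact m (X (sroot i) (sroot i))) \<odot>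
     ((a j * a i ^ m) \<odot> (L (sroot j) * L (sroot i) ^ m) - (b j * b i ^ m) \<odot> (K (sroot j) * K (sroot i) ^ m))"
proof (induction m)
  case 0
  show ?case using commutator_es_fj(1)[OF assms] by (simp add: fs_simps)
next
  case (Suc n)
  let ?q = "X (sroot i) (sroot i)" and ?r = "X (sroot i) (sroot j)" and ?s = "X (sroot j) (sroot i)"
  have nz: "?q \<noteq> 0" "?r \<noteq> 0" "?s \<noteq> 0"
    using bihom by (simp_all add: bihom_simps)
  define W where "W = K (sroot j) * K (sroot i) ^ n"
  define c where "c = ?q ^ n * ?s"
  have c: "c \<noteq> 0"
    using nz by (simp add: c_def)
  have "K (sroot i) ^ n * f i = inverse ?q ^ n \<odot> (f i * K (sroot i) ^ n)"
    by (induction n) (simp_all add: mult.assoc left_commute[OF Kf'] Kf' mult_ac)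
  then have Wf: "W * f i = inverse c \<odot> (f i * W)"
    by (simp add: W_def c_def mult.assoc left_commute[OF Kf'] power_inverse mult.commute)
  have "K (sroot i) ^ n * L (sroot i) = L (sroot i) * K (sroot i) ^ n"
    by (induction n) (simp_all add: mult.assoc K_L, metis K_L(5) mult.assoc)
  then have WL: "W * L (sroot i) = L (sroot i) * W"
    unfolding W_def by (metis K_L(5) mult.assoc)
  have WK: "K (sroot i) * W = K (sroot j) * K (sroot i) ^ Suc n"
    unfolding W_def by (metis K_L(3) add.commute mult.assoc power_Suc)
  have LL: "L (sroot j) * L (sroot i) ^ n * L (sroot i) = L (sroot j) * L (sroot i) ^ Suc n"
    by (simp add: mult.assoc power_commutes)
  define C where "C = acoef i j (Suc n) * qfact (Suc n) ?q"
  have "qrising n (Suc 0) ?q = qfact (Suc n) ?q"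
    using qrising_Suc'[of n 0 ?q] by (simp add: qrising_qfact)
  then have Z: "commutator (es i j (Suc n)) (fs i j n) = - ((C * b j * b i ^ n) \<odot> (e i * W))"
    using commutator_es_fs_lower[OF assms, of n 0] by (simp add: C_def W_def mult.assoc)
  have cc: "c * (inverse c * z) = z" for z
    using c by simp
  have 1: "f i * commutator (es i j (Suc n)) (fs i j n) - c \<odot> (commutator (es i j (Suc n)) (fs i j n) * f i)
     = (C * b j * b i ^ n) \<odot> (commutator (e i) (f i) * W)"
    unfolding Z unfolding commutator_def by (simp add: cc mult.assoc Wf left_diff_distrib mult_ac)
  have aC: "a i * bcoef i j n * c * (acoef i j n * qfact n ?q) = a i * C"
  proof -
    have "bcoef i j n * c = qnum (Suc n) ?q * (1 - ?q ^ n * (?r * ?s))"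
      using nz by (simp add: bcoef_def c_def Let_def)
    then have "a i * bcoef i j n * c * (acoef i j n * qfact n ?q)
        = a i * (qnum (Suc n) ?q * (1 - ?q ^ n * (?r * ?s))) * (acoef i j n * qfact n ?q)"
      by (simp only: mult.assoc)
    also have "\<dots> = a i * C"
      by (simp only: C_def qpoch_Suc qfact_Suc mult_ac)
    finally show ?thesis .
  qed
  define Y where "Y = (a j * a i ^ n) \<odot> (L (sroot j) * L (sroot i) ^ n) - (b j * b i ^ n) \<odot> W"
  have 2: "commutator (es i j (Suc n)) (f i) * fs i j n - c \<odot> (fs i j n * commutator (es i j (Suc n)) (f i))
      = (a i * C) \<odot> (Y * L (sroot i))"
    unfolding commutator_es_fs_corr[OF assms assms, of n n, folded c_def] Suc W_def[symmetric] Y_def[symmetric]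
    by (simp only: sm_simps(4,5) aC)
  have "commutator (es i j (Suc n)) (fs i j (Suc n)) =
      (C * b j * b i ^ n) \<odot> ((a i \<odot> L (sroot i) - b i \<odot> K (sroot i)) * W) + (a i * C) \<odot> (Y * L (sroot i))"
    unfolding commutator_es_fs_step[OF assms] c_def[symmetric] 1 2 ef' ..
  also have "\<dots> = C \<odot>
     ((a j * a i ^ Suc n) \<odot> (L (sroot j) * L (sroot i) ^ Suc n) - (b j * b i ^ Suc n) \<odot> (K (sroot i) * W))"
    by (simp add: Y_def left_diff_distrib WL LL mult_ac del: power_Suc) (simp add: mult_ac power_commutes)
  finally show ?case
    unfolding C_def WK .
qed

end

section \<open>Irreducible highest weight modules\<close>

definition wdeg :: "'i list \<Rightarrow> 'i lattice" where
  "wdeg w = sum_list (map sroot w)"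

lemma wdeg_simps [simp]: "wdeg [] = 0" "wdeg (i # w) = sroot i + wdeg w" "wdeg (u @ w) = wdeg u + wdeg w"
  by (simp_all add: wdeg_def)

lemma wdeg_count: "wdeg w i = int (count_list w i)"
  by (induction w) (auto simp: sroot_def plus_fun_apply zero_fun_apply)

lemma wdeg_nonneg: "0 \<le> wdeg w"
  by (simp add: le_fun_def wdeg_count zero_fun_apply)

definition height :: "'i::finite lattice \<Rightarrow> int" where
  "height \<beta> = (\<Sum>i\<in>UNIV. \<beta> i)"

lemma height_simps [simp]: "height 0 = 0" "height (\<alpha> + \<beta>) = height \<alpha> + height \<beta>"
  "height (\<alpha> - \<beta>) = height \<alpha> - height \<beta>" "height (sroot i) = 1"
  by (simp_all add: height_def sum.distrib sum_subtractf sroot_def plus_fun_apply minus_apply zero_fun_apply)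

lemma height_wdeg: "height (wdeg w) = int (length w)"
  by (induction w) simp_all

lemma finite_wdeg: "finite D \<Longrightarrow> finite {w :: 'i::finite list. wdeg w \<in> D}"
proof -
  assume D: "finite D"
  have "{w :: 'i list. wdeg w \<in> D} \<subseteq> (\<Union>\<beta>\<in>D. {w. set w \<subseteq> UNIV \<and> length w = nat (height \<beta>)})"
    by (auto simp: height_wdeg)
  moreover have "finite \<dots>"
    using D by (intro finite_UN_I finite_lists_length_eq) auto
  ultimately show ?thesis
    by (rule finite_subset)
qed

text \<open>
  The dual Verma module: a vector is given by the coefficients \<open>g w\<close> of the highest weight vector
  in $E_{w_n}\cdots E_{w_1} g$. With \<open>h = \<Lambda>(K\<^sub>i L\<^sub>-\<^sub>i)\<close> the operators satisfy
  $[E_i,F_i] = L_i - h_i K_i$, where $K$ and $L$ are normalized to be 1 on the highest weight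
  vector and $F_i$ is rescaled. This makes sense for \<open>h\<^sub>i = 0\<close> as well; for \<open>h = 0\<close> the submodule
  generated by the highest weight vector is $U^-(\chi)$ with skew derivations as $E_i$.
\<close>

primrec ffun :: "('i::finite, 'k::field) bichar \<Rightarrow> ('i \<Rightarrow> 'k) \<Rightarrow> 'i \<Rightarrow> 'i list \<Rightarrow> ('i list \<Rightarrow> 'k) \<Rightarrow> 'k" where
  "ffun X h j [] g = 0"
| "ffun X h j (i # w) g = ffun X h j w (\<lambda>u. g (i # u)) +
     (if i = j then (X (wdeg w) (sroot i) - h i * X (sroot i) (- wdeg w)) * g w else 0)"

lemma ffun_add: "ffun X h j w (x + y) = ffun X h j w x + ffun X h j w y"
proof (induction w arbitrary: x y)
  case (Cons i w)
  have "(\<lambda>u. (x + y) (i # u)) = (\<lambda>u. x (i # u)) + (\<lambda>u. y (i # u))"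
    by (simp add: pointwise)
  then show ?case
    by (simp only: ffun.simps Cons) (simp add: plus_fun_apply algebra_simps)
qed simp

lemma ffun_scale: "ffun X h j w (fnscale c x) = c * ffun X h j w x"
proof (induction w arbitrary: x)
  case (Cons i w)
  have "(\<lambda>u. fnscale c x (i # u)) = fnscale c (\<lambda>u. x (i # u))"
    by (simp add: pointwise)
  then show ?case
    by (simp only: ffun.simps Cons) (simp add: fnscale_apply algebra_simps)
qed simp

lift_definition fop :: "('i::finite, 'k::field) bichar \<Rightarrow> ('i \<Rightarrow> 'k) \<Rightarrow> 'i \<Rightarrow> ('i list, 'k) lop"
  is "\<lambda>X h j g w. ffun X h j w g"
  by (simp add: pointwise ffun_add ffun_scale)

lift_definition eop :: "'i \<Rightarrow> ('i list, 'k::field) lop" is "\<lambda>i g w. g (i # w)"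
  by (simp add: pointwise)

lift_definition Kop :: "('i, 'k::field) bichar \<Rightarrow> 'i lattice \<Rightarrow> ('i list, 'k) lop"
  is "\<lambda>X \<alpha> g w. X \<alpha> (- wdeg w) * g w"
  by (simp add: pointwise algebra_simps)

lift_definition Lop :: "('i, 'k::field) bichar \<Rightarrow> 'i lattice \<Rightarrow> ('i list, 'k) lop"
  is "\<lambda>X \<alpha> g w. X (wdeg w) \<alpha> * g w"
  by (simp add: pointwise algebra_simps)

lemma app_eop: "app (eop i) g w = g (i # w)"
  by transfer simp

lemma app_Kop: "app (Kop X \<alpha>) g w = X \<alpha> (- wdeg w) * g w"
  by transfer simp

lemma app_Lop: "app (Lop X \<alpha>) g w = X (wdeg w) \<alpha> * g w"
  by transfer simp

lemma app_fop: "app (fop X h j) g [] = 0"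
  "app (fop X h j) g (i # w) = app (fop X h j) (app (eop i) g) w +
     (if i = j then app (Lop X (sroot i)) g w - h i * app (Kop X (sroot i)) g w else 0)"
proof -
  have "(\<lambda>u. g (i # u)) = app (eop i) g"
    by (simp add: pointwise app_eop)
  then show "app (fop X h j) g (i # w) = app (fop X h j) (app (eop i) g) w +
     (if i = j then app (Lop X (sroot i)) g w - h i * app (Kop X (sroot i)) g w else 0)"
    by (simp add: fop.rep_eq app_Kop app_Lop algebra_simps)
qed (simp add: fop.rep_eq)

section \<open>Weight spaces and homogeneous operators\<close>

definition hom_space :: "'i lattice \<Rightarrow> ('i list \<Rightarrow> 'k::field) set" where
  "hom_space \<beta> = {g. \<forall>w. g w \<noteq> 0 \<longrightarrow> wdeg w = \<beta>}"

definition component :: "'i lattice \<Rightarrow> ('i list \<Rightarrow> 'k::field) \<Rightarrow> 'i list \<Rightarrow> 'k" where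
  "component \<beta> g = (\<lambda>w. if wdeg w = \<beta> then g w else 0)"

lemma component_in_hom: "component \<beta> g \<in> hom_space \<beta>"
  by (simp add: component_def hom_space_def)

lemma component_eq: "g \<in> hom_space \<beta> \<Longrightarrow> component \<gamma> g = (if \<gamma> = \<beta> then g else 0)"
  by (auto simp: component_def hom_space_def pointwise)

lemma component_lin: "component \<beta> (x + y) = component \<beta> x + component \<beta> y"
  "component \<beta> (fnscale c x) = fnscale c (component \<beta> x)" "component \<beta> 0 = 0"
  by (auto simp: component_def pointwise)

lemma app_Kop_hom: "g \<in> hom_space \<beta> \<Longrightarrow> app (Kop X \<alpha>) g = fnscale (X \<alpha> (- \<beta>)) g"
  and app_Lop_hom: "g \<in> hom_space \<beta> \<Longrightarrow> app (Lop X \<alpha>) g = fnscale (X \<beta> \<alpha>) g"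
  by (atomize (full), intro conjI impI ext) (force simp: app_Kop app_Lop fnscale_apply hom_space_def)+

text \<open>A function on words may have infinitely many nonzero components, so homogeneity is
  compatibility with all projections rather than a statement on sums of homogeneous vectors.\<close>

definition hom_op :: "'i lattice \<Rightarrow> ('i list, 'k::field) lop \<Rightarrow> bool" where
  "hom_op \<gamma> T \<longleftrightarrow> (\<forall>\<beta> g. app T (component \<beta> g) = component (\<beta> + \<gamma>) (app T g))"

lemma hom_opD: "hom_op \<gamma> T \<Longrightarrow> app T (component \<beta> g) = component (\<beta> + \<gamma>) (app T g)"
  by (simp add: hom_op_def)

lemma hom_op_hom: "hom_op \<gamma> T \<Longrightarrow> g \<in> hom_space \<beta> \<Longrightarrow> app T g \<in> hom_space (\<beta> + \<gamma>)"
  using component_eq[of g \<beta> \<beta>] component_in_hom[of "\<beta> + \<gamma>" "app T g"] by (simp add: hom_op_def) metis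

lemma component_diff: "component \<beta> (x - y) = component \<beta> x - component \<beta> y"
  by (auto simp: component_def pointwise)

lemma hom_op_mult: "hom_op \<gamma> S \<Longrightarrow> hom_op \<delta> T \<Longrightarrow> hom_op (\<delta> + \<gamma>) (S * T)"
  by (simp add: hom_op_def add.assoc)

lemma hom_op_diff: "hom_op \<gamma> S \<Longrightarrow> hom_op \<gamma> T \<Longrightarrow> hom_op \<gamma> (S - T)"
  by (simp add: hom_op_def component_diff)

lemma hom_op_scale: "hom_op \<gamma> T \<Longrightarrow> hom_op \<gamma> (lsc c * T)"
  by (simp add: hom_op_def component_lin)

lemma hom_op_eop: "hom_op (- sroot i) (eop i)"
  unfolding hom_op_def by (intro allI ext) (simp add: app_eop component_def eq_diff_eq add.commute)

lemma hom_op_Kop: "hom_op 0 (Kop X \<alpha>)" and hom_op_Lop: "hom_op 0 (Lop X \<alpha>)"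
  unfolding hom_op_def by (intro allI ext, simp add: app_Kop app_Lop component_def)+

lemma hom_op_fop: "hom_op (sroot i) (fop X h i)"
proof -
  have "app (fop X h i) (component \<beta> g) w = component (\<beta> + sroot i) (app (fop X h i) g) w" for \<beta> g w
  proof (induction w arbitrary: \<beta> g)
    case (Cons j w)
    have "app (eop j) (component \<beta> g) = component (\<beta> - sroot j) (app (eop j) g)"
      using hom_opD[OF hom_op_eop] by simp
    then have "app (fop X h i) (component \<beta> g) (j # w) =
        (if wdeg w = \<beta> - sroot j + sroot i then app (fop X h i) (app (eop j) g) w else 0)
        + (if j = i then app (Lop X (sroot j)) (component \<beta> g) w - h j * app (Kop X (sroot j)) (component \<beta> g) w else 0)"
      using Cons[of "\<beta> - sroot j" "app (eop j) g"] by (simp add: app_fop component_def)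
    then show ?case
      by (auto simp: app_fop component_def app_Lop app_Kop algebra_simps)
  qed (simp add: app_fop component_def)
  then show ?thesis
    by (simp add: hom_op_def fun_eq_iff)
qed

lemma fop_hom: "g \<in> hom_space \<beta> \<Longrightarrow> app (fop X h i) g \<in> hom_space (\<beta> + sroot i)"
  by (rule hom_op_hom[OF hom_op_fop])

definition vac :: "'i list \<Rightarrow> 'k::field" where
  "vac = (\<lambda>w. if w = [] then 1 else 0)"

lemma vac_Nil [simp]: "vac [] = 1"
  by (simp add: vac_def)

lemma vac_Cons [simp]: "vac (i # w) = 0"
  by (simp add: vac_def)

lemma vac_hom: "vac \<in> hom_space 0"
  by (simp add: vac_def hom_space_def)

lemma eop_vac [simp]: "app (eop i) vac = 0"
  by (simp add: pointwise app_eop vac_def)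

lemma vac_neq_0: "vac \<noteq> 0"
  by (metis vac_Nil zero_fun_apply zero_neq_one)

section \<open>The submodule generated by the highest weight vector\<close>

primrec fword :: "('i::finite, 'k::field) bichar \<Rightarrow> ('i \<Rightarrow> 'k) \<Rightarrow> 'i list \<Rightarrow> 'i list \<Rightarrow> 'k" where
  "fword X h [] = vac"
| "fword X h (i # y) = app (fop X h i) (fword X h y)"

definition Lmod :: "('i::finite, 'k::field) bichar \<Rightarrow> ('i \<Rightarrow> 'k) \<Rightarrow> ('i list \<Rightarrow> 'k) set" where
  "Lmod X h = fnv.span (range (fword X h))"

lemma Lmod_subspace: "fnv.subspace (Lmod X h)"
  by (simp add: Lmod_def)

lemma fword_in_Lmod: "fword X h y \<in> Lmod X h"
  by (simp add: Lmod_def fnv.span_base)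

lemma vac_in_Lmod: "vac \<in> Lmod X h"
  using fword_in_Lmod[of X h "[]"] by simp

lemma Lmod_induct [consumes 1, case_names zero add fword]:
  assumes "g \<in> Lmod X h" "P 0"
    "\<And>c y g. g \<in> Lmod X h \<Longrightarrow> P g \<Longrightarrow> P (fnscale c (fword X h y) + g)"
  shows "P g"
proof -
  have "g \<in> Lmod X h \<and> P g"
    using assms(1) unfolding Lmod_def
  proof (induction rule: fnv.span_induct_alt)
    case base
    show ?case
      by (intro conjI fnv.span_zero assms(2))
  next
    case (step c x g)
    then obtain y where y: "x = fword X h y"
      by auto
    have "g \<in> Lmod X h" "P g"
      unfolding Lmod_def using step by blast+
    then show ?case
      unfolding y using assms(3) fnv.span_add fnv.span_scale fword_in_Lmod unfolding Lmod_def by blast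
  qed
  then show ?thesis ..
qed

lemma Lmod_closedI:
  assumes "\<And>y. app T (fword X h y) \<in> Lmod X h" "g \<in> Lmod X h"
  shows "app T g \<in> Lmod X h"
  using assms(2)
  by (induction rule: Lmod_induct)
    (auto intro!: fnv.subspace_add fnv.subspace_scale fnv.subspace_0 Lmod_subspace assms(1))

lemma Lmod_minimal:
  assumes "fnv.subspace S" "vac \<in> S" "\<And>i g. g \<in> S \<Longrightarrow> app (fop X h i) g \<in> S"
  shows "Lmod X h \<subseteq> S"
proof -
  have "fword X h y \<in> S" for y
    by (induction y) (use assms in auto)
  then show ?thesis
    unfolding Lmod_def by (intro fnv.span_minimal assms(1)) auto
qed

lemma fop_Lmod: "g \<in> Lmod X h \<Longrightarrow> app (fop X h i) g \<in> Lmod X h"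
  by (erule Lmod_closedI[rotated]) (simp only: fword_in_Lmod flip: fword.simps)

lemma fword_hom: "fword X h y \<in> hom_space (wdeg y)"
proof (induction y)
  case (Cons i y)
  then show ?case
    using fop_hom[OF Cons, of X h i] by (metis add.commute fword.simps(2) wdeg_simps(2))
qed (simp add: vac_hom)

lemma component_Lmod: "g \<in> Lmod X h \<Longrightarrow> component \<beta> g \<in> Lmod X h"
  by (induction rule: Lmod_induct)
    (auto simp: component_lin component_eq[OF fword_hom] fnv.subspace_0[OF Lmod_subspace]
      intro!: fnv.subspace_add[OF Lmod_subspace] fnv.subspace_scale[OF Lmod_subspace] fword_in_Lmod)

lemma Kop_Lmod: "g \<in> Lmod X h \<Longrightarrow> app (Kop X' \<alpha>) g \<in> Lmod X h"
  by (erule Lmod_closedI[rotated])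
    (simp only: app_Kop_hom[OF fword_hom] fnv.subspace_scale[OF Lmod_subspace] fword_in_Lmod)

lemma Lop_Lmod: "g \<in> Lmod X h \<Longrightarrow> app (Lop X' \<alpha>) g \<in> Lmod X h"
  by (erule Lmod_closedI[rotated])
    (simp only: app_Lop_hom[OF fword_hom] fnv.subspace_scale[OF Lmod_subspace] fword_in_Lmod)

lemma fun_eq_0I:
  assumes "g [] = 0" "\<And>i. app (eop i) g = 0"
  shows "g = 0"
proof
  fix w show "g w = 0 w"
    using assms(1) assms(2)[THEN fun_cong] by (cases w) (auto simp: app_eop zero_fun_apply)
qed

text \<open>The value at a word is the vacuum coefficient after its letters have acted through
  \<open>eop\<close>, and \<open>z\<close> lets them pass. This criterion yields the relations among
  lowering operators.\<close>

lemma lop_eq_0I: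
  assumes "\<And>g. app z g [] = 0" "\<And>i. commutator (eop i) z = 0"
  shows "z = 0"
proof (rule lop_eqI)
  fix g
  have "app z g w = 0" for w
  proof (induction w arbitrary: g)
    case (Cons i w)
    have "app z g (i # w) = app (eop i * z) g w"
      by (simp add: app_eop)
    also have "eop i * z = z * eop i"
      using assms(2)[of i] by (simp add: commutator_def)
    finally show ?case
      by (simp add: Cons)
  qed (simp add: assms)
  then show "app z g = app 0 g"
    by (simp add: pointwise)
qed

section \<open>The quantum group relations on functions on words\<close>

locale hw =
  fixes X :: "('i::finite, 'k::field) bichar" and h :: "'i \<Rightarrow> 'k"
  assumes X: "bihom X"

sublocale hw \<subseteq> qg lsc X "\<lambda>_. 1" h "Kop X" "Lop X" eop "fop X h"
proof
  note bh = bihom_simps[OF X]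
  show "commutator (eop i) (fop X h j) = (if i = j then lsc 1 * Lop X (sroot i) - lsc (h i) * Kop X (sroot i) else 0)"
    for i j
    by (rule lop_eqI) (auto simp: commutator_def pointwise app_eop app_fop)
  show "Kop X \<alpha> * fop X h i = lsc (X \<alpha> (- sroot i)) * (fop X h i * Kop X \<alpha>)" for \<alpha> i
  proof (rule lop_eqI)
    have "app (Kop X \<alpha>) (app (fop X h i) g) w = X \<alpha> (- sroot i) * app (fop X h i) (app (Kop X \<alpha>) g) w" for g w
    proof (induction w arbitrary: g)
      case (Cons j w)
      have e: "app (eop j) (app (Kop X \<alpha>) g) = fnscale (X \<alpha> (- sroot j)) (app (Kop X \<alpha>) (app (eop j) g))"
        by (simp add: pointwise app_eop app_Kop bh)
      have 1: "app (Kop X \<alpha>) (app (fop X h i) g) (j # w) = (X \<alpha> (- sroot j)) * app (Kop X \<alpha>) (app (fop X h i) (app (eop j) g)) w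
        + (if j = i then (X \<alpha> (- sroot j)) * (X \<alpha> (- wdeg w) * (app (Lop X (sroot j)) g w - h j * app (Kop X (sroot j)) g w)) else 0)"
        by (simp add: app_Kop app_fop bh algebra_simps)
      have "app (Lop X (sroot k)) (app (Kop X \<alpha>) g) w = X \<alpha> (- wdeg w) * app (Lop X (sroot k)) g w"
        "app (Kop X (sroot k)) (app (Kop X \<alpha>) g) w = X \<alpha> (- wdeg w) * app (Kop X (sroot k)) g w" for k
        by (simp_all add: app_Kop app_Lop)
      then show ?case
        unfolding 1 Cons[of "app (eop j) g"] app_fop(2)[of _ _ _ "app (Kop X \<alpha>) g"] e app_lin fnscale_apply
        by (simp add: algebra_simps)
    qed (simp add: app_fop app_Kop)
    then show "app (Kop X \<alpha> * fop X h i) g = app (lsc (X \<alpha> (- sroot i)) * (fop X h i * Kop X \<alpha>)) g" for g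
      by (simp add: pointwise)
  qed
  show "Lop X \<alpha> * fop X h i = lsc (X (sroot i) \<alpha>) * (fop X h i * Lop X \<alpha>)" for \<alpha> i
  proof (rule lop_eqI)
    have "app (Lop X \<alpha>) (app (fop X h i) g) w = X (sroot i) \<alpha> * app (fop X h i) (app (Lop X \<alpha>) g) w" for g w
    proof (induction w arbitrary: g)
      case (Cons j w)
      have e: "app (eop j) (app (Lop X \<alpha>) g) = fnscale (X (sroot j) \<alpha>) (app (Lop X \<alpha>) (app (eop j) g))"
        by (simp add: pointwise app_eop app_Lop bh)
      have 1: "app (Lop X \<alpha>) (app (fop X h i) g) (j # w) = (X (sroot j) \<alpha>) * app (Lop X \<alpha>) (app (fop X h i) (app (eop j) g)) w
        + (if j = i then (X (sroot j) \<alpha>) * (X (wdeg w) \<alpha> * (app (Lop X (sroot j)) g w - h j * app (Kop X (sroot j)) g w)) else 0)"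
        by (simp add: app_Lop app_fop bh algebra_simps)
      have "app (Lop X (sroot k)) (app (Lop X \<alpha>) g) w = X (wdeg w) \<alpha> * app (Lop X (sroot k)) g w"
        "app (Kop X (sroot k)) (app (Lop X \<alpha>) g) w = X (wdeg w) \<alpha> * app (Kop X (sroot k)) g w" for k
        by (simp_all add: app_Kop app_Lop)
      then show ?case
        unfolding 1 Cons[of "app (eop j) g"] app_fop(2)[of _ _ _ "app (Lop X \<alpha>) g"] e app_lin fnscale_apply
        by (simp add: algebra_simps)
    qed (simp add: app_fop app_Lop)
    then show "app (Lop X \<alpha> * fop X h i) g = app (lsc (X (sroot i) \<alpha>) * (fop X h i * Lop X \<alpha>)) g" for g
      by (simp add: pointwise)
  qed
  show "Kop X \<alpha> * eop i = lsc (X \<alpha> (sroot i)) * (eop i * Kop X \<alpha>)"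
    "Lop X \<alpha> * eop i = lsc (X (- sroot i) \<alpha>) * (eop i * Lop X \<alpha>)" for \<alpha> i
    by (rule lop_eqI; simp add: pointwise app_Kop app_Lop app_eop bh)+
  show "Kop X 0 = 1" "Lop X 0 = 1" "Kop X (\<alpha> + \<beta>) = Kop X \<alpha> * Kop X \<beta>" "Lop X (\<alpha> + \<beta>) = Lop X \<alpha> * Lop X \<beta>"
    "Kop X \<alpha> * Lop X \<beta> = Lop X \<beta> * Kop X \<alpha>" for \<alpha> \<beta>
    by (rule lop_eqI; simp add: pointwise app_Kop app_Lop bh)+
  show "lsc c * T = T * lsc c" for c and T :: "('i list, 'k) lop"
    by (rule lsc_simps)
qed (rule X lsc_simps)+

context hw
begin

notation sm (infixr "\<odot>" 75)

lemma sm_lsc: "c \<odot> T = lsc c * T"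
  by (simp add: sm_def)

lemma app_sm [simp]: "app (c \<odot> T) g = fnscale c (app T g)"
  by (simp add: sm_lsc)

lemma eop_fword_Cons:
  "app (eop i) (fword X h (j # y)) = app (fop X h j) (app (eop i) (fword X h y)) +
     (if i = j then app (Lop X (sroot i)) (fword X h y) - fnscale (h i) (app (Kop X (sroot i)) (fword X h y)) else 0)"
proof -
  have "eop i * fop X h j = fop X h j * eop i + (if i = j then 1 \<odot> Lop X (sroot i) - h i \<odot> Kop X (sroot i) else 0)"
    using ef[of i j] by (simp add: commutator_def sm_def algebra_simps split: if_splits)
  from arg_cong[OF this, of "\<lambda>T. app T (fword X h y)"] show ?thesis
    by (simp split: if_splits)
qed

lemma eop_Lmod: "g \<in> Lmod X h \<Longrightarrow> app (eop i) g \<in> Lmod X h"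
proof (rule Lmod_closedI)
  show "app (eop i) (fword X h y) \<in> Lmod X h" for y
  proof (induction y)
    case (Cons j y)
    have "app (Lop X (sroot i)) (fword X h y) - fnscale (h i) (app (Kop X (sroot i)) (fword X h y)) \<in> Lmod X h"
      by (intro fnv.subspace_diff fnv.subspace_scale Lmod_subspace Kop_Lmod Lop_Lmod fword_in_Lmod)
    then show ?case
      unfolding eop_fword_Cons using Cons fop_Lmod fnv.subspace_0[OF Lmod_subspace]
      by (intro fnv.subspace_add[OF Lmod_subspace]) auto
  qed (simp add: fnv.subspace_0[OF Lmod_subspace])
qed

end

section \<open>Reflections of irreducible modules\<close>

lemma Sup_enat_eqD:
  assumes "Sup (enat ` {m. P m}) = enat m" "P 0" "\<And>k. P (Suc k) \<Longrightarrow> P k"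
  shows "P m" "\<not> P (Suc m)"
proof -
  have le: "k \<le> m" if "P k" for k
    using Sup_upper[of "enat k" "enat ` {m. P m}"] that assms(1) by auto
  then show "\<not> P (Suc m)"
    by fastforce
  have "finite {m. P m}"
    using le by (auto simp: finite_nat_set_iff_bounded_le)
  then have "Max {m. P m} \<in> {m. P m}"
    using assms(2) by (intro Max_in) auto
  moreover have "Sup (enat ` {m. P m}) \<le> enat (Max {m. P m})"
    using \<open>finite _\<close> by (intro Sup_least) auto
  then have "m \<le> Max {m. P m}"
    using assms(1) by simp
  ultimately have "Max {m. P m} = m"
    using le by (intro antisym) auto
  then show "P m"
    using \<open>Max {m. P m} \<in> {m. P m}\<close> by simp
qed

lemma qfact_qpoch_down:
  "qfact (Suc k) q * qpoch (Suc k) q' p \<noteq> 0 \<Longrightarrow> qfact k q * qpoch k q' p \<noteq> 0"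
  by (auto simp: qfact_Suc qpoch_Suc)

lemma qfact_qpoch_nonzero:
  assumes "qfact m q * qpoch m q' p \<noteq> 0" "k < m"
  shows "qnum (Suc k) q \<noteq> 0" "1 - q' ^ k * p \<noteq> 0"
  using assms by (force simp: qfact_def qpoch_def)+

lemma wdeg_replicate: "wdeg (replicate n i) = (\<lambda>l. int n * sroot i l)"
  by (induction n) (auto simp: fun_eq_iff plus_fun_apply zero_fun_apply algebra_simps)

text \<open>A multiple of a simple root is the degree of a single word, so along this ray every
  weight space has dimension at most one.\<close>

lemma wdeg_eq_replicate: "wdeg y = wdeg (replicate n i) \<Longrightarrow> y = replicate n i"
proof -
  assume eq: "wdeg y = wdeg (replicate n i)"
  have r: "count_list (replicate n i) l = (if l = i then n else 0)" for n l
    by (induction n) auto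
  have "count_list y l = count_list (replicate n i) l" for l
    using fun_cong[OF eq, of l] by (simp add: wdeg_count)
  then have c: "count_list y l = (if l = i then n else 0)" for l
    by (simp add: r)
  have "set y \<subseteq> {i}"
    using c by (metis count_list_0_iff insertI1 subsetI zero_neq_one)
  then have "y = replicate (length y) i"
    by (metis replicate_eqI singletonD subsetD)
  moreover from this have "length y = n"
    using c[of i] r[of "length y" i] by metis
  ultimately show ?thesis by simp
qed

lemma sum_sroot: "(\<Sum>l\<in>UNIV. sroot j l * c l) = (c j :: int)"
  for j :: "'i::finite"
  by (simp add: sroot_def if_distrib[of "\<lambda>x. x * _"] cong: if_cong)

context hw
begin

lemma srefl_simps: "srefl X i (\<alpha> + \<beta>) = srefl X i \<alpha> + srefl X i \<beta>" "srefl X i 0 = 0"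
  "srefl X i (- \<alpha>) = - srefl X i \<alpha>" "srefl X i (sroot i) = - sroot i"
  by (auto simp: srefl_def pointwise sum.distrib algebra_simps sum_negf sum_sroot cartan_def)

end

text \<open>The condition \<open>hi\<close> serves to recover \<open>fs i j k\<close> from
  commutators with \<open>eop i\<close>, whose coefficient contains the factor
  \<open>h i\<close>.\<close>

locale reflectable = hw +
  fixes i :: 'a and m :: "'a \<Rightarrow> nat"
  assumes m: "\<And>j. j \<noteq> i \<Longrightarrow> cartan_max X i j = enat (m j)"
    and hi: "h i \<noteq> 0"
begin

abbreviation "q \<equiv> X (sroot i) (sroot i)"

lemma q: "q \<noteq> 0"
  by (rule bihom_simps[OF X])

lemma cartan_data:
  assumes "j \<noteq> i"
  shows "qfact (m j) q * acoef i j (m j) \<noteq> 0"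
    "qnum (Suc (m j)) q * (1 - q ^ m j * (X (sroot i) (sroot j) * X (sroot j) (sroot i))) = 0"
proof -
  note * = Sup_enat_eqD[OF m[OF assms, unfolded cartan_max_def Let_def]]
  show 1: "qfact (m j) q * acoef i j (m j) \<noteq> 0"
    using qfact_qpoch_down by (intro *(1)) auto
  have "\<not> qfact (Suc (m j)) q * acoef i j (Suc (m j)) \<noteq> 0"
    using qfact_qpoch_down by (intro *(2)) auto
  then show "qnum (Suc (m j)) q * (1 - q ^ m j * (X (sroot i) (sroot j) * X (sroot j) (sroot i))) = 0"
    using 1 by (auto simp: qfact_Suc qpoch_Suc)
qed

lemma srefl_sroot: "j \<noteq> i \<Longrightarrow> srefl X i (sroot j) = sroot j + wdeg (replicate (m j) i)"
proof -
  assume "j \<noteq> i"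
  then have "(\<Sum>l\<in>UNIV. sroot j l * cartan X i l) = - int (m j)"
    by (simp add: sum_sroot cartan_def m)
  then show ?thesis
    by (simp add: srefl_def wdeg_replicate pointwise)
qed

lemma srefl_involution: "srefl X i (srefl X i \<alpha>) = \<alpha>"
proof -
  define c where "c = (\<Sum>j\<in>UNIV. \<alpha> j * cartan X i j)"
  have 1: "srefl X i \<alpha> = \<alpha> - (\<lambda>l. c * sroot i l)"
    by (simp add: srefl_def c_def pointwise)
  have "(\<Sum>j\<in>UNIV. c * sroot i j * cartan X i j) = 2 * c"
    by (simp add: mult.assoc sum_sroot cartan_def flip: sum_distrib_left)
  then have "(\<Sum>j\<in>UNIV. srefl X i \<alpha> j * cartan X i j) = - c"
    by (simp add: 1 minus_apply left_diff_distrib sum_subtractf c_def)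
  then have "srefl X i (srefl X i \<alpha>) = srefl X i \<alpha> + (\<lambda>l. c * sroot i l)"
    by (simp add: srefl_def pointwise)
  then show ?thesis
    by (simp add: 1)
qed

lemma X_replicate: "X (wdeg (replicate n i)) \<beta> = X (sroot i) \<beta> ^ n" "X \<beta> (wdeg (replicate n i)) = X \<beta> (sroot i) ^ n"
  by (induction n) (simp_all add: bihom_simps[OF X])

abbreviation "bcoef' j k \<equiv> qg.bcoef (\<lambda>\<alpha> \<beta>. X \<beta> \<alpha>) i j k"

lemma bcoef_zero_iff: "bcoef i j k = 0 \<longleftrightarrow> qnum (Suc k) q * (1 - q ^ k * (X (sroot i) (sroot j) * X (sroot j) (sroot i))) = 0"
  "bcoef' j k = 0 \<longleftrightarrow> qnum (Suc k) q * (1 - q ^ k * (X (sroot i) (sroot j) * X (sroot j) (sroot i))) = 0"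
  by (simp_all add: bcoef_def qg.bcoef_def[OF qg_swap] Let_def bihom_simps[OF X] mult.commute)

lemma bcoef_nonzero:
  assumes "j \<noteq> i" "k < m j"
  shows "bcoef i j k \<noteq> 0" "bcoef' j k \<noteq> 0"
  using qfact_qpoch_nonzero[OF cartan_data(1)[OF assms(1)] assms(2)]
  unfolding bcoef_zero_iff by simp_all

lemma bcoef_m:
  assumes "j \<noteq> i"
  shows "bcoef i j (m j) = 0" "bcoef' j (m j) = 0"
  using cartan_data(2)[OF assms] unfolding bcoef_zero_iff by simp_all

lemma fs_Nil: "app (fs i j k) g [] = 0"
  by (induction k arbitrary: g) (simp_all add: fs_simps app_fop pointwise)

lemma commutator_pow: "commutator x y = 0 \<Longrightarrow> commutator (x ^ k) y = 0" for x y :: "('a list, 'b) lop"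
  by (induction k) (simp_all only: power_0 power_Suc commutator_mult_left, simp_all add: commutator_def)

lemma commutator_0_flip: "commutator x y = 0 \<longleftrightarrow> commutator y x = 0" for x y :: "('a list, 'b) lop"
  by (auto simp: commutator_def)

lemma qnum_inverse_0: "qnum (Suc k) q = 0 \<Longrightarrow> qnum (Suc k) (inverse q) = 0"
  using q by (simp add: qnum_inverse)

text \<open>Together with the quantum integer at q the one at 1/q vanishes, so this power of F_i
  commutes with every E_l and the vacuum criterion applies.\<close>

lemma fop_pow_eq_0:
  assumes "qnum (Suc k) q = 0"
  shows "fop X h i ^ Suc k = 0"
proof (rule lop_eq_0I)
  show "commutator (eop l) (fop X h i ^ Suc k) = 0" for l
  proof (cases "l = i")
    case True
    then show ?thesis
      using commutator_fpow[of i k] assms qnum_inverse_0[OF assms] by (simp add: commutator_0_flip)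
  next
    case False
    then show ?thesis
      using commutator_pow[of "fop X h i" "eop l" "Suc k"] ef'(2)[of l i] by (simp add: commutator_0_flip)
  qed
qed (simp add: app_fop)

lemma acoef_swap: "qpoch k q (X (sroot j) (sroot i) * X (sroot i) (sroot j)) = acoef i j k"
  by (simp add: mult.commute)

text \<open>The quantum Serre relation. The Cartan entry stops either at a zero of the shifted
  factorial or at a zero of the quantum integer of m+1. In both cases all commutators with E_l
  vanish, in the second one because F_i^(m+1) = 0.\<close>

lemma fs_top_eq_0:
  assumes "j \<noteq> i"
  shows "fs i j (Suc (m j)) = 0"
proof (rule lop_eq_0I)
  show "app (fs i j (Suc (m j))) g [] = 0" for g
    by (rule fs_Nil)
  show "commutator (eop l) (fs i j (Suc (m j))) = 0" for l
  proof (cases "l = i")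
    case True
    then show ?thesis
      using commutator_fs_ei(2)[of i j "m j"] assms bcoef_m[OF assms] by (simp add: commutator_0_flip)
  next
    case False
    show ?thesis
    proof (cases "l = j")
      case True
      have "acoef i j (Suc (m j)) = 0 \<or> fop X h i ^ Suc (m j) = 0"
        using cartan_data(2)[OF assms] fop_pow_eq_0[of "m j"] by (auto simp: qpoch_Suc)
      then show ?thesis
        using True assms qg.commutator_es_fj(2)[OF qg_swap, folded fs_swap, of i j "m j"]
        by (subst commutator_0_flip) (auto simp: acoef_swap simp del: power_Suc)
    next
      case False
      then show ?thesis
        using \<open>l \<noteq> i\<close> commutator_fs_ek[of l i j "Suc (m j)"] by (simp add: commutator_0_flip)
    qed
  qed
qed

text \<open>The counterpart of \<open>lop_eq_0I\<close> for raising operators. Their relations need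
  not hold on all functions, only on what the highest weight vector generates.\<close>

lemma Lmod_annihilate:
  assumes "app z vac = 0" "\<And>l g. g \<in> Lmod X h \<Longrightarrow> app (commutator z (fop X h l)) g = 0" "g \<in> Lmod X h"
  shows "app z g = 0"
proof -
  have "app z (fword X h y) = 0" for y
  proof (induction y)
    case (Cons l y)
    then show ?case
      using assms(2)[OF fword_in_Lmod, of l y] by (simp add: commutator_def)
  qed (simp add: assms)
  with assms(3) show ?thesis
    by (induction rule: Lmod_induct) simp_all
qed

lemma eop_pow_eq_0:
  assumes "qnum (Suc k) q = 0" "g \<in> Lmod X h"
  shows "app (eop i ^ Suc k) g = 0"
proof (rule Lmod_annihilate[OF _ _ assms(2)])
  show "app (eop i ^ Suc k) vac = 0"
    by (simp only: power_Suc2 app_simps eop_vac app_zero)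
  have "commutator (eop i ^ Suc k) (fop X h l) = 0" for l
  proof (cases "l = i")
    case True
    then show ?thesis
      using commutator_epow[of i k] assms qnum_inverse_0[OF assms(1)] by simp
  next
    case False
    then have "commutator (eop i) (fop X h l) = 0"
      using ef'(2)[of i l] by simp
    then show ?thesis
      by (rule commutator_pow)
  qed
  then show "app (commutator (eop i ^ Suc k) (fop X h l)) g = 0" for l g
    by simp
qed

lemma es_vac: "app (es i j k) vac = 0"
  by (induction k) (simp_all add: es_simps)

lemma es_top_eq_0:
  assumes "j \<noteq> i" "g \<in> Lmod X h"
  shows "app (es i j (Suc (m j))) g = 0"
proof (rule Lmod_annihilate[OF es_vac _ assms(2)])
  show "app (commutator (es i j (Suc (m j))) (fop X h l)) g = 0" if g: "g \<in> Lmod X h" for l g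
  proof (cases "l = i")
    case True
    then show ?thesis
      using assms commutator_es_fi(2)[of i j "m j"] bcoef_m[OF assms(1)] by simp
  next
    case False
    show ?thesis
    proof (cases "l = j")
      case True
      have "acoef i j (Suc (m j)) = 0 \<or> qnum (Suc (m j)) q = 0"
        using cartan_data(2)[OF assms(1)] by (auto simp: qpoch_Suc)
      then show ?thesis
        using True assms commutator_es_fj(2)[of i j "m j"] eop_pow_eq_0[of "m j", OF _ Kop_Lmod[OF g]]
        by (auto simp del: power_Suc)
    next
      case False
      then show ?thesis
        using \<open>l \<noteq> i\<close> commutator_es_fk[of l i j "Suc (m j)"] by simp
    qed
  qed
qed

text \<open>The coefficient of the highest weight vector in E_i^k F_i^k applied to it. The last k
  before its first zero is the height in the definition of the reflected weight.\<close>

definition ncoef :: "nat \<Rightarrow> 'b" where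
  "ncoef k = qfact k q * qpoch k (inverse q) (h i)"

abbreviation "frow k \<equiv> fword X h (replicate k i)"

lemma Kop_vac: "app (Kop X \<alpha>) vac = vac" and Lop_vac: "app (Lop X \<alpha>) vac = vac"
  by (simp_all add: app_Kop_hom[OF vac_hom] app_Lop_hom[OF vac_hom] bihom_simps[OF X])

lemma frow_pow: "frow k = app (fop X h i ^ k) vac"
  by (induction k) simp_all

lemma eop_frow: "app (eop i) (frow 0) = 0"
  "app (eop i) (frow (Suc k)) = fnscale (qnum (Suc k) q * (1 - inverse q ^ k * h i)) (frow k)"
  "l \<noteq> i \<Longrightarrow> app (eop l) (frow k) = 0"
proof -
  show "app (eop i) (frow 0) = 0" by simp
  have c: "qnum (Suc k) q - h i * qnum (Suc k) (inverse q) = qnum (Suc k) q * (1 - inverse q ^ k * h i)"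
    by (simp only: qnum_inverse[OF q] power_inverse) (simp add: field_simps)
  have "eop i * fop X h i ^ Suc k = fop X h i ^ Suc k * eop i - commutator (fop X h i ^ Suc k) (eop i)"
    by (simp add: commutator_def)
  also have "commutator (fop X h i ^ Suc k) (eop i) =
      (h i * qnum (Suc k) (inverse q)) \<odot> (fop X h i ^ k * Kop X (sroot i)) - qnum (Suc k) q \<odot> (fop X h i ^ k * Lop X (sroot i))"
    using commutator_fpow[of i k] by simp
  finally have "app (eop i * fop X h i ^ Suc k) vac =
     fnscale (qnum (Suc k) q) (frow k) - fnscale (h i * qnum (Suc k) (inverse q)) (frow k)"
    by (simp add: Kop_vac Lop_vac frow_pow del: power_Suc)
  also have "\<dots> = fnscale (qnum (Suc k) q * (1 - inverse q ^ k * h i)) (frow k)"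
    by (simp only: c[symmetric] fnv.scale_left_diff_distrib)
  finally show "app (eop i) (frow (Suc k)) = fnscale (qnum (Suc k) q * (1 - inverse q ^ k * h i)) (frow k)"
    by (simp only: frow_pow app_simps)
  have "commutator (fop X h i) (eop l) = 0" if "l \<noteq> i"
    using that ef'(2)[of l i] by (simp add: commutator_0_flip)
  then have "eop l * fop X h i ^ k = fop X h i ^ k * eop l" if "l \<noteq> i"
    using commutator_pow[of "fop X h i" "eop l" k] that by (simp add: commutator_def)
  then show "l \<noteq> i \<Longrightarrow> app (eop l) (frow k) = 0"
    by (metis app_simps(6) eop_vac app_zero frow_pow)
qed

lemma frow_replicate: "frow k (replicate k i) = ncoef k"
proof (induction k)
  case (Suc k)
  have "frow (Suc k) (replicate (Suc k) i) = app (eop i) (frow (Suc k)) (replicate k i)"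
    by (simp add: app_eop)
  then show ?case
    by (simp only: eop_frow fnscale_apply Suc) (simp add: ncoef_def qfact_Suc qpoch_Suc)
qed (simp add: ncoef_def)

lemma frow_eq_0: "ncoef k \<noteq> 0 \<Longrightarrow> ncoef (Suc k) = 0 \<Longrightarrow> frow (Suc k) = 0"
proof (rule fun_eq_0I)
  assume "ncoef k \<noteq> 0" "ncoef (Suc k) = 0"
  then have "qnum (Suc k) q * (1 - inverse q ^ k * h i) = 0"
    by (auto simp: ncoef_def qfact_Suc qpoch_Suc)
  then show "app (eop l) (frow (Suc k)) = 0" for l
    using eop_frow(2)[of k] eop_frow(3)[of l "Suc k"] by (cases "l = i") auto
qed (simp add: app_fop)

end

text \<open>
  \<open>rE\<close> and \<open>rF\<close> are, up to scalars, the images of $E_j$ and $F_j$ under the Lusztig isomorphism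
  $U(\tau_i\chi)\to U(\chi)$.
\<close>

locale reflection = reflectable +
  fixes n :: nat
  assumes n: "ncoef n \<noteq> 0" "ncoef (Suc n) = 0"
begin

abbreviation "s \<equiv> srefl X i"

abbreviation "X' \<equiv> bichar_refl i X"

definition rE :: "'a \<Rightarrow> ('a list, 'b) lop" where
  "rE j = (if j = i then fop X h i * Lop X (- sroot i) else es i j (m j))"

definition rF :: "'a \<Rightarrow> ('a list, 'b) lop" where
  "rF j = (if j = i then Kop X (- sroot i) * eop i else fs i j (m j))"

text \<open>The ratio of the K and L values of the reflected weight. The first factor is the ratio
  of the old weight at s_i(\<alpha>_j); the second comes from the new highest weight vector lying n
  \<alpha>_i below the old one.\<close>

definition h' :: "'a \<Rightarrow> 'b" where
  "h' j = (if j = i then inverse (h i) else h j * h i ^ m j)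
     * inverse (X (s (sroot j)) (sroot i) * X (sroot i) (s (sroot j))) ^ n"

text \<open>The operators \<open>rE\<close> and \<open>rF\<close> are not rescaled; this is the
  scalar left over in their commutator.\<close>

definition rC :: "'a \<Rightarrow> 'b" where
  "rC j = (if j = i then h i else acoef i j (m j) * qfact (m j) q)"

lemma rC_nonzero: "rC j \<noteq> 0"
  using hi cartan_data(1)[of j] by (auto simp: rC_def)

lemma X'_bihom: "bihom X'"
  using X by (simp add: bihom_def bichar_refl_def srefl_simps)

lemma Kop_pow: "Kop X (wdeg (replicate k l)) = Kop X (sroot l) ^ k"
  and Lop_pow: "Lop X (wdeg (replicate k l)) = Lop X (sroot l) ^ k"
  by (induction k) (simp_all add: K_L)

lemma Kop_inverse: "Kop X (sroot i) * Kop X (- sroot i) = 1" "Kop X (- sroot i) * Kop X (sroot i) = 1"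
  and Lop_inverse: "Lop X (sroot i) * Lop X (- sroot i) = 1" "Lop X (- sroot i) * Lop X (sroot i) = 1"
  by (simp_all add: K_L(1,2) flip: K_L(3,4))

lemma rE_rF_same:
  "commutator (rE j) (rF j) = rC j \<odot> (Lop X (s (sroot j))
     - (if j = i then inverse (h i) else h j * h i ^ m j) \<odot> Kop X (s (sroot j)))"
proof (cases "j = i")
  case True
  let ?K = "Kop X (- sroot i)" and ?L = "Lop X (- sroot i)"
  have "fop X h i * ?L * (?K * eop i) = (fop X h i * ?K) * (?L * eop i)"
    by (simp add: mult.assoc) (simp add: K_L(5) flip: mult.assoc)
  also have "\<dots> = (q \<odot> (fop X h i * ?K)) * eop i * ?L"
    by (simp add: Le' bihom_simps[OF X] mult.assoc)
  also have "q \<odot> (fop X h i * ?K) = ?K * fop X h i"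
    by (simp add: Kf' bihom_simps[OF X])
  finally have "commutator (rE i) (rF i) = - (?K * commutator (eop i) (fop X h i) * ?L)"
    by (simp add: rE_def rF_def commutator_def algebra_simps)
  also have "\<dots> = - (?K * (Lop X (sroot i) * ?L)) + h i \<odot> ((?K * Kop X (sroot i)) * ?L)"
    by (simp add: ef' algebra_simps)
  also have "\<dots> = h i \<odot> (?L - inverse (h i) \<odot> ?K)"
    using hi by (simp add: Kop_inverse Lop_inverse)
  finally show ?thesis
    using True by (simp add: rC_def srefl_simps)
next
  case False
  have "commutator (rE j) (rF j) = (acoef i j (m j) * qfact (m j) q) \<odot>
      (Lop X (s (sroot j)) - (h j * h i ^ m j) \<odot> Kop X (s (sroot j)))"
    using commutator_es_fs_diag[of i j "m j"] False
    by (simp add: rE_def rF_def srefl_sroot K_L(3,4) Kop_pow Lop_pow)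
  then show ?thesis
    using False by (simp add: rC_def)
qed

text \<open>If one index is i, the commutator is a Serre relation one step above the Cartan entry,
  in disguise. The raising version holds only on \<open>Lmod\<close>, whence the restriction on
  g.\<close>

lemma rE_rF_distinct:
  assumes "j \<noteq> l" "g \<in> Lmod X h"
  shows "app (commutator (rE j) (rF l)) g = 0"
proof -
  consider "j = i" "l \<noteq> i" | "j \<noteq> i" "l = i" | "j \<noteq> i" "l \<noteq> i"
    using assms by blast
  then show ?thesis
  proof cases
    case 1
    define c where "c = X (sroot l) (sroot i) * q ^ m l"
    have c: "c \<noteq> 0"
      by (simp add: c_def bihom_simps[OF X])
    have "Lop X (- sroot i) * fs i l (m l) = inverse c \<odot> (fs i l (m l) * Lop X (- sroot i))"
      by (simp add: L_fs c_def bihom_simps[OF X] power_inverse)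
    moreover have "fop X h i * fs i l (m l) = c \<odot> (fs i l (m l) * fop X h i)"
      using fs_top_eq_0[OF 1(2)] by (simp add: fs_simps c_def mult.commute)
    ultimately have "commutator (rE j) (rF l) = 0"
      using c 1 by (simp add: rE_def rF_def commutator_def mult.assoc) (simp flip: mult.assoc)
    then show ?thesis by simp
  next
    case 2
    define c where "c = X (sroot i) (sroot j) * q ^ m j"
    have c: "c \<noteq> 0"
      by (simp add: c_def bihom_simps[OF X])
    have "Kop X (- sroot i) * es i j (m j) = inverse c \<odot> (es i j (m j) * Kop X (- sroot i))"
      by (simp add: K_es c_def bihom_simps[OF X] power_inverse)
    then have *: "es i j (m j) * Kop X (- sroot i) = c \<odot> (Kop X (- sroot i) * es i j (m j))"
      using c by simp
    have "es i j (m j) * (Kop X (- sroot i) * eop i) = c \<odot> (Kop X (- sroot i) * (es i j (m j) * eop i))"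
      unfolding mult.assoc[symmetric] * by simp
    then have "commutator (rE j) (rF l) = - (Kop X (- sroot i) * es i j (Suc (m j)))"
      using 2 by (simp add: rE_def rF_def commutator_def es_simps right_diff_distrib c_def mult_ac)
    then show ?thesis
      using es_top_eq_0[OF 2(1) assms(2)] by (simp del: es_simps)
  next
    case 3
    then show ?thesis
      using commutator_es_fs_distinct[of i j l] assms(1) by (simp add: rE_def rF_def)
  qed
qed

lemma hom_op_es: "hom_op (- (sroot j + wdeg (replicate k i))) (es i j k)"
proof (induction k)
  case (Suc k)
  have "hom_op (- (sroot j + wdeg (replicate (Suc k) i))) (eop i * es i j k)"
    "hom_op (- (sroot j + wdeg (replicate (Suc k) i))) (es i j k * eop i)"
    using hom_op_mult[OF hom_op_eop Suc, of i] hom_op_mult[OF Suc hom_op_eop, of i] by (simp_all add: algebra_simps)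
  then show ?case
    unfolding es_simps sm_lsc by (intro hom_op_diff hom_op_scale)
qed (simp add: es_simps hom_op_eop)

lemma hom_op_rE: "hom_op (- s (sroot j)) (rE j)"
proof (cases "j = i")
  case True
  then show ?thesis
    using hom_op_mult[OF hom_op_fop hom_op_Lop, of i X h X "- sroot i"] by (simp add: rE_def srefl_simps)
next
  case False
  then show ?thesis
    using hom_op_es[of j "m j"] by (simp only: rE_def srefl_sroot[OF False] if_False)
qed

lemma fs_Lmod: "g \<in> Lmod X h \<Longrightarrow> app (fs i j k) g \<in> Lmod X h"
  by (induction k arbitrary: g)
    (auto simp: fs_simps intro!: fop_Lmod fnv.subspace_diff fnv.subspace_scale Lmod_subspace)

lemma es_Lmod: "g \<in> Lmod X h \<Longrightarrow> app (es i j k) g \<in> Lmod X h"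
  by (induction k arbitrary: g)
    (auto simp: es_simps intro!: eop_Lmod fnv.subspace_diff fnv.subspace_scale Lmod_subspace)

lemma rE_Lmod: "g \<in> Lmod X h \<Longrightarrow> app (rE j) g \<in> Lmod X h"
  by (simp add: rE_def es_Lmod fop_Lmod Lop_Lmod)

lemma rF_Lmod: "g \<in> Lmod X h \<Longrightarrow> app (rF j) g \<in> Lmod X h"
  by (simp add: rF_def fs_Lmod eop_Lmod Kop_Lmod)

text \<open>This is the surjectivity of the Lusztig isomorphism: the $E_j$ and $F_j$ are recovered from
  \<open>rE\<close>, \<open>rF\<close> and the diagonal operators.\<close>

lemma closed_under_generators:
  assumes S: "fnv.subspace S" "S \<subseteq> Lmod X h"
    and E: "\<And>j g. g \<in> S \<Longrightarrow> app (rE j) g \<in> S" and F: "\<And>j g. g \<in> S \<Longrightarrow> app (rF j) g \<in> S"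
    and K: "\<And>\<alpha> g. g \<in> S \<Longrightarrow> app (Kop X \<alpha>) g \<in> S" and L: "\<And>\<alpha> g. g \<in> S \<Longrightarrow> app (Lop X \<alpha>) g \<in> S"
    and g: "g \<in> S"
  shows "app (eop j) g \<in> S" "app (fop X h j) g \<in> S"
proof -
  have ei: "app (eop i) g \<in> S" if "g \<in> S" for g
  proof -
    have "eop i = Kop X (sroot i) * rF i"
      by (simp add: rF_def Kop_inverse flip: mult.assoc)
    then show ?thesis
      using K F that by simp
  qed
  have fi: "app (fop X h i) g \<in> S" if "g \<in> S" for g
  proof -
    have "fop X h i = rE i * Lop X (sroot i)"
      by (simp add: rE_def Lop_inverse mult.assoc)
    then show ?thesis
      using E L that by simp
  qed
  have es: "app (es i j (m j - k)) g \<in> S" and fs: "app (fs i j (m j - k)) g \<in> S" if j: "j \<noteq> i" and "g \<in> S" "k \<le> m j" for j k g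
    using that(2,3)
  proof (induction k arbitrary: g)
    case 0
    {
      case 1 then show ?case using E[of g j] j by (simp add: rE_def)
    next
      case 2 then show ?case using F[of g j] j by (simp add: rF_def)
    }
  next
    case (Suc k)
    define k' where "k' = m j - Suc k"
    have k': "m j - k = Suc k'" "k' < m j"
      if "Suc k \<le> m j" using that by (auto simp: k'_def)
    {
      case 1
      have "Lop X (- sroot i) * fop X h i = Lop X (- sroot i) * fop X h i" ..
      \<comment> \<open>Below the Cartan entry \<open>bcoef\<close> is nonzero, so the rule for the
        commutator with F_i can be solved for the lower adjoint. Descending to index 0 recovers
        E_j.\<close>
      have eq: "es i j k' = inverse (bcoef i j k') \<odot> (commutator (es i j (Suc k')) (fop X h i) * Lop X (- sroot i))"
        using commutator_es_fi(2)[of i j k'] bcoef_nonzero(1)[OF j, of k'] k' 1 j by (simp add: mult.assoc Lop_inverse)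
      have "app (es i j (Suc k')) g \<in> S" if "g \<in> S" for g
        using Suc.IH(1)[OF that] 1 k' by simp
      then show ?case
        unfolding k'_def[symmetric] eq commutator_def app_sm app_simps using 1 fi L
        by (intro fnv.subspace_scale[OF S(1)] fnv.subspace_diff[OF S(1)]) blast+
    next
      case 2
      \<comment> \<open>On the lowering side the coefficient contains \<open>h i\<close> besides
        \<open>bcoef'\<close>.\<close>
      define c where "c = h i * bcoef' j k'"
      have "c \<noteq> 0"
        using hi bcoef_nonzero(2)[OF j, of k'] k' 2 by (simp add: c_def)
      moreover have "commutator (fs i j (Suc k')) (eop i) = c \<odot> (fs i j k' * Kop X (sroot i))"
        unfolding c_def using j by (intro commutator_fs_ei(2)) simp
      ultimately have eq: "fs i j k' = inverse c \<odot> (commutator (fs i j (Suc k')) (eop i) * Kop X (- sroot i))"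
        by (simp add: mult.assoc Kop_inverse)
      have "app (fs i j (Suc k')) g \<in> S" if "g \<in> S" for g
        using Suc.IH(2)[OF that] 2 k' by simp
      then show ?case
        unfolding k'_def[symmetric] eq commutator_def app_sm app_simps using 2 ei K
        by (intro fnv.subspace_scale[OF S(1)] fnv.subspace_diff[OF S(1)]) blast+
    }
  qed
  show "app (eop j) g \<in> S" "app (fop X h j) g \<in> S"
    using ei fi g es[of j g "m j"] fs[of j g "m j"] by (cases "j = i"; simp add: es_simps fs_simps)+
qed

text \<open>A vector of a dual Verma module is the collection of its highest weight coefficients
  after raising. Here raising is done by \<open>rE\<close>, and the new highest weight vector is
  F_i^n v; its coefficient is read at the word i^n and normalized by \<open>ncoef n\<close>.\<close>

primrec Phi :: "'a list \<Rightarrow> ('a list \<Rightarrow> 'b) \<Rightarrow> 'b" where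
  "Phi [] g = inverse (ncoef n) * g (replicate n i)"
| "Phi (j # w) g = Phi w (app (rE j) g)"

lemma Phi_lin: "Phi w (x + y) = Phi w x + Phi w y" "Phi w (fnscale c x) = c * Phi w x"
  by (induction w arbitrary: x y) (simp_all add: pointwise algebra_simps)

lemma Phi_minus: "Phi w (x - y) = Phi w x - Phi w y" and Phi_0: "Phi w 0 = 0"
proof -
  show "Phi w (x - y) = Phi w x - Phi w y"
    using Phi_lin(1)[of w "x - y" y] by simp
  show "Phi w 0 = 0"
    using Phi_lin(2)[of w 0 0] by simp
qed

definition Phi_op :: "('a list, 'b) lop" where
  "Phi_op = Abs_lop (\<lambda>g w. Phi w g)"

lemma app_Phi: "app Phi_op g w = Phi w g"
  unfolding Phi_op_def by (subst Abs_lop_inverse) (auto simp: pointwise Phi_lin)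

lemma app_eop_Phi: "app (eop j) (app Phi_op g) = app Phi_op (app (rE j) g)"
  by (simp add: fun_eq_iff app_eop app_Phi)

abbreviation "\<sigma> \<beta> \<equiv> s (\<beta> - wdeg (replicate n i))"

lemma Phi_hom:
  assumes "g \<in> hom_space \<beta>"
  shows "app Phi_op g \<in> hom_space (\<sigma> \<beta>)"
proof -
  have "Phi w g \<noteq> 0 \<Longrightarrow> s (wdeg w) + wdeg (replicate n i) = \<beta>" if "g \<in> hom_space \<beta>" for w g \<beta>
    using that
  proof (induction w arbitrary: g \<beta>)
    case Nil
    then show ?case by (auto simp: hom_space_def srefl_simps)
  next
    case (Cons j w)
    from Cons.IH[OF _ hom_op_hom[OF hom_op_rE Cons.prems(2)]] Cons.prems(1) show ?case
      by (simp add: srefl_simps algebra_simps)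
  qed
  then have "Phi w g \<noteq> 0 \<Longrightarrow> s (wdeg w) = \<beta> - wdeg (replicate n i)" for w
    using assms by (simp add: eq_diff_eq)
  then have "Phi w g \<noteq> 0 \<Longrightarrow> wdeg w = \<sigma> \<beta>" for w
    using srefl_involution[of "wdeg w"] by simp
  then show ?thesis
    unfolding hom_space_def app_Phi by blast
qed

lemma Kop_rE: "rE j * Kop X \<alpha> = X \<alpha> (- s (sroot j)) \<odot> (Kop X \<alpha> * rE j)"
  and Lop_rE: "rE j * Lop X \<alpha> = X (s (sroot j)) \<alpha> \<odot> (Lop X \<alpha> * rE j)"
proof -
  have KL: "app (Kop X \<alpha>) g w = X \<alpha> (- wdeg w) * g w" "app (Lop X \<alpha>) g w = X (wdeg w) \<alpha> * g w" for g w
    by (rule app_Kop app_Lop)+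
  show "rE j * Kop X \<alpha> = X \<alpha> (- s (sroot j)) \<odot> (Kop X \<alpha> * rE j)"
  proof (cases "j = i")
    case True
    have "Kop X \<alpha> * (fop X h i * Lop X (- sroot i)) = inverse (X \<alpha> (sroot i)) \<odot> (fop X h i * Lop X (- sroot i) * Kop X \<alpha>)"
      by (simp add: left_commute[OF Kf'] K_L(5) mult.assoc)
    then show ?thesis
      using True by (simp add: rE_def srefl_simps bihom_simps[OF X])
  next
    case False
    define c where "c = X \<alpha> (sroot j) * X \<alpha> (sroot i) ^ m j"
    have "c \<noteq> 0"
      by (simp add: c_def bihom_simps[OF X])
    moreover have "X \<alpha> (- s (sroot j)) = inverse c"
      using False by (simp add: c_def srefl_sroot X_replicate bihom_simps[OF X])
    ultimately show ?thesis
      using False by (simp add: rE_def K_es flip: c_def)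
  qed
  show "rE j * Lop X \<alpha> = X (s (sroot j)) \<alpha> \<odot> (Lop X \<alpha> * rE j)"
  proof (cases "j = i")
    case True
    have "Lop X \<alpha> * (fop X h i * Lop X (- sroot i)) = X (sroot i) \<alpha> \<odot> (fop X h i * Lop X (- sroot i) * Lop X \<alpha>)"
      by (simp add: left_commute[OF Lf'] mult.assoc add.commute flip: K_L(4))
    then show ?thesis
      using True by (simp add: rE_def srefl_simps bihom_simps[OF X])
  next
    case False
    define c where "c = inverse (X (sroot j) \<alpha> * X (sroot i) \<alpha> ^ m j)"
    have "c \<noteq> 0"
      by (simp add: c_def bihom_simps[OF X])
    moreover have "X (s (sroot j)) \<alpha> = inverse c"
      using False by (simp add: c_def srefl_sroot X_replicate bihom_simps[OF X])
    ultimately show ?thesis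
      using False L_es[of \<alpha> i j "m j", folded c_def] by (simp add: rE_def)
  qed
qed

lemma Phi_Kop: "Phi w (app (Kop X \<beta>) g) = X \<beta> (- s (wdeg w)) * inverse (X \<beta> (sroot i) ^ n) * Phi w g"
  and Phi_Lop: "Phi w (app (Lop X \<beta>) g) = X (s (wdeg w)) \<beta> * X (sroot i) \<beta> ^ n * Phi w g"
proof -
  show "Phi w (app (Kop X \<beta>) g) = X \<beta> (- s (wdeg w)) * inverse (X \<beta> (sroot i) ^ n) * Phi w g"
  proof (induction w arbitrary: g)
    case Nil
    then show ?case
      by (simp add: app_Kop bihom_simps[OF X] X_replicate srefl_simps)
  next
    case (Cons j w)
    have "app (rE j) (app (Kop X \<beta>) g) = fnscale (X \<beta> (- s (sroot j))) (app (Kop X \<beta>) (app (rE j) g))"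
      using arg_cong[OF Kop_rE, of "\<lambda>T. app T g"] by simp
    then show ?case
      by (simp add: Phi_lin Cons srefl_simps bihom_simps[OF X])
  qed
  show "Phi w (app (Lop X \<beta>) g) = X (s (wdeg w)) \<beta> * X (sroot i) \<beta> ^ n * Phi w g"
  proof (induction w arbitrary: g)
    case Nil
    then show ?case
      by (simp add: app_Lop bihom_simps[OF X] X_replicate srefl_simps)
  next
    case (Cons j w)
    have "app (rE j) (app (Lop X \<beta>) g) = fnscale (X (s (sroot j)) \<beta>) (app (Lop X \<beta>) (app (rE j) g))"
      using arg_cong[OF Lop_rE, of "\<lambda>T. app T g"] by simp
    then show ?case
      by (simp add: Phi_lin Cons srefl_simps bihom_simps[OF X])
  qed
qed

text \<open>The power of \<chi> is the value of \<open>Lop X (s (sroot j))\<close> on F_i^n v.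
  Splitting it off normalizes L to 1 on the new highest weight vector, as the convention of
  \<open>fop\<close> demands.\<close>

definition rD :: "'a \<Rightarrow> 'b" where
  "rD j = rC j * X (sroot i) (s (sroot j)) ^ n"

lemma rD_nonzero: "rD j \<noteq> 0"
  using rC_nonzero bihom_simps(1)[OF X] by (simp add: rD_def)

lemma Phi_commutator:
  "Phi w (app (commutator (rE j) (rF j)) g) =
    rD j * (X' (wdeg w) (sroot j) - h' j * X' (sroot j) (- wdeg w)) * Phi w g"
proof -
  have "X (sroot i) (s (sroot j)) ^ n * (h' j * X' (sroot j) (- wdeg w)) =
     (if j = i then inverse (h i) else h j * h i ^ m j) * (X (s (sroot j)) (- s (wdeg w)) * inverse (X (s (sroot j)) (sroot i) ^ n))"
    by (simp add: h'_def bichar_refl_def power_mult_distrib power_inverse bihom_simps[OF X] srefl_simps)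
  then show ?thesis
    unfolding rE_rF_same app_sm app_simps Phi_lin Phi_minus Phi_Kop Phi_Lop rD_def
    by (simp add: bichar_refl_def algebra_simps)
qed

lemma fop_row_0: "j \<noteq> i \<Longrightarrow> app (fop X h j) g (replicate k i) = 0"
  by (induction k arbitrary: g) (simp_all add: app_fop)

lemma fop_row_closed: "(\<And>k. g (replicate k i) = 0) \<Longrightarrow> app (fop X h i) g (replicate k i) = 0"
proof (induction k arbitrary: g)
  case (Suc k)
  have "app (eop i) g (replicate k i) = 0" for k
    using Suc.prems[of "Suc k"] by (simp add: app_eop)
  then show ?case
    using Suc by (simp add: app_fop app_Kop app_Lop)
qed (simp add: app_fop)

lemma fs_row_0: "j \<noteq> i \<Longrightarrow> app (fs i j l) g (replicate k i) = 0"
proof (induction l arbitrary: g k)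
  case (Suc l)
  then show ?case
    using fop_row_closed[of "app (fs i j l) g" k] by (simp add: fs_simps pointwise)
qed (simp add: fs_simps fop_row_0)

text \<open>Only F_i^(n+1) v could contribute at this word, and it vanishes by the choice of
  n.\<close>

lemma Lmod_row_0: "g \<in> Lmod X h \<Longrightarrow> g (replicate (Suc n) i) = 0"
proof (induction rule: Lmod_induct)
  case (add c y g)
  have "fword X h y (replicate (Suc n) i) = 0"
  proof (rule ccontr)
    assume "fword X h y (replicate (Suc n) i) \<noteq> 0"
    then have "wdeg y = wdeg (replicate (Suc n) i)"
      using fword_hom[of X h y] unfolding hom_space_def by (simp del: replicate_Suc)
    then have "y = replicate (Suc n) i"
      by (rule wdeg_eq_replicate)
    then show False
      using \<open>fword X h y _ \<noteq> 0\<close> frow_eq_0[OF n] by (simp add: zero_fun_apply)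
  qed
  then show ?case
    using add by (simp add: pointwise)
qed (simp add: zero_fun_apply)

text \<open>Lowered vectors have no part along the new highest weight vector: for j = i because
  elements of \<open>Lmod\<close> vanish at i^(n+1), and otherwise because every term of
  \<open>fs\<close> contains F_j.\<close>

lemma Phi_Nil_rF: "g \<in> Lmod X h \<Longrightarrow> Phi [] (app (rF j) g) = 0"
  using Lmod_row_0[of g] by (cases "j = i") (simp_all add: rF_def app_Kop app_eop fs_row_0)

text \<open>Both sides obey the recursion on words that defines \<open>fop\<close>: its start is
  \<open>Phi_Nil_rF\<close>, its step is \<open>Phi_commutator\<close> together with the vanishing
  of commutators for distinct indices.\<close>

lemma Phi_rF: "g \<in> Lmod X h \<Longrightarrow> app Phi_op (app (rF j) g) = fnscale (rD j) (app (fop X' h' j) (app Phi_op g))"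
proof
  fix w
  show "g \<in> Lmod X h \<Longrightarrow> app Phi_op (app (rF j) g) w = fnscale (rD j) (app (fop X' h' j) (app Phi_op g)) w"
  proof (induction w arbitrary: g)
    case Nil
    then show ?case
      using Phi_Nil_rF[of g j] by (simp add: app_Phi fnscale_apply app_fop)
  next
    case (Cons l w)
    have "app (rE l) (app (rF j) g) = app (rF j) (app (rE l) g) + app (commutator (rE l) (rF j)) g"
      by (simp add: commutator_def)
    then have "app Phi_op (app (rF j) g) (l # w) = app Phi_op (app (rF j) (app (rE l) g)) w
        + Phi w (app (commutator (rE l) (rF j)) g)"
      by (simp add: app_Phi Phi_lin)
    also have "app Phi_op (app (rF j) (app (rE l) g)) w = rD j * app (fop X' h' j) (app (eop l) (app Phi_op g)) w"
      using Cons.IH[OF rE_Lmod[OF Cons.prems]] by (simp add: fnscale_apply app_eop_Phi)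
    also have "Phi w (app (commutator (rE l) (rF j)) g) = (if l = j then
        rD j * (app (Lop X' (sroot l)) (app Phi_op g) w - h' l * app (Kop X' (sroot l)) (app Phi_op g) w) else 0)"
      using rE_rF_distinct[of l j g] Cons.prems
      by (auto simp: Phi_commutator Phi_0 app_Kop app_Lop app_Phi algebra_simps)
    finally show ?case
      by (auto simp: app_fop fnscale_apply algebra_simps)
  qed
qed

lemma es_frow: "j \<noteq> i \<Longrightarrow> app (es i j l) (frow k) = 0"
proof (induction l arbitrary: k)
  case (Suc l)
  have "app (es i j l) (app (eop i) (frow k)) = 0"
    using Suc.IH[OF Suc.prems] by (cases k) (simp_all only: eop_frow app_lin app_zero fnv.scale_zero_right)
  then show ?case
    using Suc by (simp add: es_simps)
qed (simp add: es_simps eop_frow)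

lemma Phi_frow: "app Phi_op (frow n) = vac"
proof
  fix w
  show "app Phi_op (frow n) w = vac w"
  proof (cases w)
    case Nil
    then show ?thesis
      using n by (simp add: app_Phi frow_replicate)
  next
    case (Cons j u)
    have "app (rE j) (frow n) = 0"
    proof (cases "j = i")
      case True
      then show ?thesis
        using frow_eq_0[OF n] by (simp add: rE_def app_Lop_hom[OF fword_hom])
    qed (simp add: rE_def es_frow)
    then show ?thesis
      using Cons by (simp add: app_Phi Phi_0 vac_def)
  qed
qed

lemma Lmod'_facts:
  "g \<in> Lmod X' h' \<Longrightarrow> app (fop X' h' j) g \<in> Lmod X' h'"
  "g \<in> Lmod X' h' \<Longrightarrow> app (eop j) g \<in> Lmod X' h'"
  using hw.eop_Lmod[OF hw.intro[OF X'_bihom], of g h' j] by (simp_all add: fop_Lmod)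

lemma Phi_diagonal:
  "app Phi_op (app (Kop X \<beta>) g) = fnscale (inverse (X \<beta> (sroot i) ^ n)) (app (Kop X' (s \<beta>)) (app Phi_op g))"
  "app Phi_op (app (Lop X \<beta>) g) = fnscale (X (sroot i) \<beta> ^ n) (app (Lop X' (s \<beta>)) (app Phi_op g))"
  by (auto simp: fun_eq_iff fnscale_apply app_Phi Phi_Kop Phi_Lop app_Kop app_Lop bichar_refl_def
      srefl_involution srefl_simps bihom_simps[OF X])

lemma vac_from_frow: "\<exists>c. c \<noteq> 0 \<and> app (eop i ^ k) (frow k) = fnscale c vac" if "ncoef k \<noteq> 0"
  using that
proof (induction k)
  case 0
  then show ?case
    by (intro exI[of _ 1]) (simp add: fnscale_def)
next
  case (Suc k)
  define d where "d = qnum (Suc k) q * (1 - inverse q ^ k * h i)"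
  have d: "d \<noteq> 0" "ncoef k \<noteq> 0"
    using Suc.prems by (auto simp: d_def ncoef_def qfact_Suc qpoch_Suc)
  obtain c where c: "c \<noteq> 0" "app (eop i ^ k) (frow k) = fnscale c vac"
    using Suc.IH d by blast
  have "app (eop i ^ Suc k) (frow (Suc k)) = fnscale d (app (eop i ^ k) (frow k))"
    by (simp only: power_Suc2 app_simps eop_frow app_lin d_def)
  then show ?case
    using c d by (intro exI[of _ "d * c"]) simp
qed

text \<open>As \<open>ncoef n\<close> is nonzero, E_i^n takes F_i^n v back to a nonzero multiple of
  v. The original generators are available by \<open>closed_under_generators\<close>.\<close>

lemma subspace_generated_by_frow:
  assumes S: "fnv.subspace S" "S \<subseteq> Lmod X h" "frow n \<in> S"
    and E: "\<And>j g. g \<in> S \<Longrightarrow> app (rE j) g \<in> S" and F: "\<And>j g. g \<in> S \<Longrightarrow> app (rF j) g \<in> S"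
    and K: "\<And>\<alpha> g. g \<in> S \<Longrightarrow> app (Kop X \<alpha>) g \<in> S" and L: "\<And>\<alpha> g. g \<in> S \<Longrightarrow> app (Lop X \<alpha>) g \<in> S"
  shows "S = Lmod X h"
proof
  note closed = closed_under_generators[OF S(1,2) E F K L]
  have "app (eop i ^ k) g \<in> S" if "g \<in> S" for k g
    using that by (induction k) (simp_all add: closed)
  then obtain c where "c \<noteq> 0" "fnscale c vac \<in> S"
    using vac_from_frow[OF n(1)] S(3) by metis
  then have "vac \<in> S"
    using fnv.subspace_scale[OF S(1), of "fnscale c vac" "inverse c"] by simp
  then show "Lmod X h \<subseteq> S"
    using closed by (intro Lmod_minimal S(1))
qed (rule S)

section \<open>Bijectivity of the reflection map\<close>

lemma Phi_into: "app Phi_op ` Lmod X h \<subseteq> Lmod X' h'"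
proof -
  let ?S = "{g \<in> Lmod X h. app Phi_op g \<in> Lmod X' h'}"
  have "?S = Lmod X h"
  proof (rule subspace_generated_by_frow)
    show "fnv.subspace ?S"
      by (rule fnv.subspaceI)
        (auto intro!: fnv.subspace_0 fnv.subspace_add fnv.subspace_scale Lmod_subspace)
    show "frow n \<in> ?S"
      by (simp add: Phi_frow fword_in_Lmod vac_in_Lmod)
  qed (auto simp: rE_Lmod rF_Lmod Kop_Lmod Lop_Lmod Phi_diagonal Phi_rF Lmod'_facts
      intro!: fnv.subspace_scale Lmod_subspace simp flip: app_eop_Phi)
  then show ?thesis by blast
qed

lemma Phi_onto: "Lmod X' h' \<subseteq> app Phi_op ` Lmod X h"
proof (rule Lmod_minimal)
  show "fnv.subspace (app Phi_op ` Lmod X h)"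
  proof (rule fnv.subspaceI)
    show "0 \<in> app Phi_op ` Lmod X h"
      using fnv.subspace_0[OF Lmod_subspace, of X h] by (metis app_zero imageI)
    show "x + y \<in> app Phi_op ` Lmod X h" if "x \<in> app Phi_op ` Lmod X h" "y \<in> app Phi_op ` Lmod X h" for x y
      using that fnv.subspace_add[OF Lmod_subspace, of _ X h] by (auto simp flip: app_lin)
    show "fnscale c x \<in> app Phi_op ` Lmod X h" if "x \<in> app Phi_op ` Lmod X h" for c x
      using that fnv.subspace_scale[OF Lmod_subspace, of _ X h] by (auto simp flip: app_lin)
  qed
  show "vac \<in> app Phi_op ` Lmod X h"
    using Phi_frow fword_in_Lmod by (metis imageI)
  show "app (fop X' h' j) x \<in> app Phi_op ` Lmod X h" if x: "x \<in> app Phi_op ` Lmod X h" for j x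
  proof -
    obtain g where g: "g \<in> Lmod X h" "x = app Phi_op g"
      using x by blast
    have "app Phi_op (fnscale (inverse (rD j)) (app (rF j) g)) = app (fop X' h' j) x"
      using rD_nonzero[of j] by (simp add: Phi_rF g)
    moreover have "fnscale (inverse (rD j)) (app (rF j) g) \<in> Lmod X h"
      by (intro fnv.subspace_scale Lmod_subspace rF_Lmod g)
    ultimately show ?thesis
      by (metis imageI)
  qed
qed

lemma Phi_component: "Phi w (component \<beta> g) = (if s (wdeg w) + wdeg (replicate n i) = \<beta> then Phi w g else 0)"
proof (induction w arbitrary: g \<beta>)
  case Nil
  then show ?case by (simp add: component_def srefl_simps)
next
  case (Cons j w)
  have "s (sroot j) + s (wdeg w) + wdeg (replicate n i) = \<beta> \<longleftrightarrow>
      s (wdeg w) + wdeg (replicate n i) = \<beta> - s (sroot j)"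
    by (simp add: algebra_simps)
  then show ?case
    by (simp add: hom_opD[OF hom_op_rE] Cons srefl_simps)
qed

text \<open>The kernel is stable under the twisted and hence under the original generators. A
  nonzero element could be raised inside it to one with nonzero vacuum coefficient, whose degree 0
  component is a multiple of v. Then F_i^n v would lie in the kernel, although its image is
  \<open>vac\<close>.\<close>

lemma Phi_inj:
  assumes "g \<in> Lmod X h" "app Phi_op g = 0"
  shows "g = 0"
proof (rule ccontr)
  define S where "S = {g \<in> Lmod X h. app Phi_op g = 0}"
  have S: "g \<in> S \<longleftrightarrow> g \<in> Lmod X h \<and> app Phi_op g = 0" for g
    by (simp add: S_def)
  have sub: "fnv.subspace S"
    unfolding S_def by (rule fnv.subspaceI) (auto intro!: fnv.subspace_0 fnv.subspace_add fnv.subspace_scale Lmod_subspace)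
  have ops: "app (rE j) g \<in> S" "app (rF j) g \<in> S" "app (Kop X \<alpha>) g \<in> S" "app (Lop X \<alpha>) g \<in> S"
    if "g \<in> S" for j g \<alpha>
    using app_eop_Phi[of j g] Phi_diagonal[of \<alpha> g] that
    by (simp_all add: S rE_Lmod rF_Lmod Phi_rF Kop_Lmod Lop_Lmod)
  have sub': "S \<subseteq> Lmod X h"
    by (auto simp: S)
  have closed: "app (eop j) g \<in> S" "app (fop X h j) g \<in> S" if "g \<in> S" for j g
    by (rule closed_under_generators[OF sub sub' _ _ _ _ that]; rule ops; assumption)+
  assume "g \<noteq> 0"
  then obtain w where "g w \<noteq> 0"
    by (auto simp: fun_eq_iff zero_fun_apply)
  then have "\<exists>x\<in>S. x [] \<noteq> 0"
    using assms
  proof (induction w arbitrary: g)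
    case (Cons j w)
    show ?case
    proof (rule Cons.IH[of "app (eop j) g"])
      show "app (eop j) g w \<noteq> 0"
        using Cons.prems by (simp add: app_eop)
      have "app (eop j) g \<in> S"
        by (rule closed(1)) (simp add: S Cons.prems)
      then show "app (eop j) g \<in> Lmod X h" "app Phi_op (app (eop j) g) = 0"
        by (simp_all add: S)
    qed
  qed (auto simp: S)
  then obtain x where x: "x \<in> Lmod X h" "app Phi_op x = 0" "x [] \<noteq> 0"
    by (auto simp: S)
  have "component 0 x = fnscale (x []) vac"
  proof
    fix w :: "'a list"
    have "wdeg w = 0 \<longleftrightarrow> w = []"
      using height_wdeg[of w] by auto
    then show "component 0 x w = fnscale (x []) vac w"
      by (simp add: component_def fnscale_apply vac_def)
  qed
  moreover have "app Phi_op (component 0 x) = 0"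
  proof -
    have "Phi w x = 0" for w
      using x(2) by (metis app_Phi zero_fun_apply)
    then show ?thesis
      by (simp add: pointwise app_Phi Phi_component)
  qed
  ultimately have "fnscale (x []) vac \<in> S"
    using component_Lmod[OF x(1), of 0] by (simp add: S)
  then have "vac \<in> S"
    using fnv.subspace_scale[OF sub, of "fnscale (x []) vac" "inverse (x [])"] x(3) by simp
  then have "frow k \<in> S" for k
    by (induction k) (simp_all only: replicate.simps fword.simps closed)
  then show False
    using Phi_frow vac_neq_0 by (auto simp: S)
qed

lemma Phi_bij: "bij_betw (app Phi_op) (Lmod X h) (Lmod X' h')"
proof -
  have "inj_on (app Phi_op) (Lmod X h)"
  proof (rule inj_onI)
    fix x y assume "x \<in> Lmod X h" "y \<in> Lmod X h" "app Phi_op x = app Phi_op y"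
    then have "x - y = 0"
      using Phi_inj[of "x - y"] fnv.subspace_diff[OF Lmod_subspace, of x X h y] by simp
    then show "x = y" by simp
  qed
  then show ?thesis
    using Phi_into Phi_onto by (auto simp: bij_betw_def)
qed

end

section \<open>Growth of $U^-(\chi)$\<close>

definition dimle :: "('w \<Rightarrow> 'k::field) set \<Rightarrow> nat \<Rightarrow> bool" where
  "dimle V N \<longleftrightarrow> (\<exists>S. finite S \<and> card S \<le> N \<and> V \<subseteq> fnv.span S)"

lemma dimle_mono: "dimle W N \<Longrightarrow> V \<subseteq> W \<Longrightarrow> N \<le> M \<Longrightarrow> dimle V M"
  unfolding dimle_def by (meson order_trans)

lemma app_span: "app T ` fnv.span S = fnv.span (app T ` S)"
proof -
  interpret vector_space_pair "fnscale :: 'k::field \<Rightarrow> ('w \<Rightarrow> 'k) \<Rightarrow> _" "fnscale :: 'k \<Rightarrow> ('w \<Rightarrow> 'k) \<Rightarrow> _" ..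
  show "app T ` fnv.span S = fnv.span (app T ` S)" for T :: "('w, 'k) lop" and S
    using linear_span_image[OF app_linear[of T]] by simp
qed

lemma dimle_image: "dimle V N \<Longrightarrow> dimle (app T ` V) N"
proof -
  assume "dimle V N"
  then obtain S where S: "finite S" "card S \<le> N" "V \<subseteq> fnv.span S"
    by (auto simp: dimle_def)
  then have "app T ` V \<subseteq> fnv.span (app T ` S)"
    by (auto simp flip: app_span)
  moreover have "card (app T ` S) \<le> N"
    using S card_image_le le_trans by blast
  ultimately show ?thesis
    unfolding dimle_def using S by blast
qed

lemma dimle_independent:
  assumes "dimle V N" "fnv.independent B" "B \<subseteq> V"
  shows "finite B" "card B \<le> N"
proof -
  obtain S where S: "finite S" "card S \<le> N" "V \<subseteq> fnv.span S"
    using assms by (auto simp: dimle_def)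
  have "B \<subseteq> fnv.span S"
    using assms(3) S(3) by (rule order_trans)
  then show "finite B" "card B \<le> N"
    using fnv.independent_span_bound[OF S(1) assms(2)] S(2) by auto
qed

lemma dimle_basis:
  assumes "dimle V N"
  obtains B where "B \<subseteq> V" "finite B" "card B \<le> N" "V \<subseteq> fnv.span B"
  using fnv.maximal_independent_subset[of V] dimle_independent[OF assms] by metis

lemma dimle_rank_nullity:
  assumes V: "fnv.subspace V" and image: "dimle (app T ` V) a" and kernel: "dimle {x \<in> V. app T x = 0} b"
  shows "dimle V (a + b)"
proof -
  obtain B where B: "B \<subseteq> app T ` V" "finite B" "card B \<le> a" "app T ` V \<subseteq> fnv.span B"
    using dimle_basis[OF image] by blast
  obtain B' where B': "B' \<subseteq> V" "finite B'" "card B' = card B" "B = app T ` B'"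
    using finite_subset_image[OF B(2,1)] B(1) by (metis subset_image_inj B(2) card_image finite_imageD)
  obtain S where S: "finite S" "card S \<le> b" "{x \<in> V. app T x = 0} \<subseteq> fnv.span S"
    using kernel by (auto simp: dimle_def)
  have "V \<subseteq> fnv.span (B' \<union> S)"
  proof
    fix x assume x: "x \<in> V"
    then have "app T x \<in> app T ` fnv.span B'"
      using B B' by (auto simp: app_span)
    then obtain y where y: "y \<in> fnv.span B'" "app T x = app T y"
      by blast
    then have "y \<in> V"
      using fnv.span_minimal[OF B'(1) V] by blast
    then have "x - y \<in> fnv.span S"
      using S x y fnv.subspace_diff[OF V] by auto
    then have "(x - y) + y \<in> fnv.span (B' \<union> S)"
      using y fnv.span_mono[of S "B' \<union> S"] fnv.span_mono[of B' "B' \<union> S"] by (intro fnv.span_add) auto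
    then show "x \<in> fnv.span (B' \<union> S)"
      by simp
  qed
  moreover have "card (B' \<union> S) \<le> a + b"
    using card_Un_le[of B' S] B B' S by linarith
  ultimately show ?thesis
    unfolding dimle_def using B' S by blast
qed

text \<open>Independence is assumed for the indexed family, so that a repeated vector would already
  violate it; injectivity is a consequence.\<close>

lemma dimle_family:
  assumes "dimle W N" "x ` A \<subseteq> W" "finite A"
    and indep: "\<And>c. (\<Sum>a\<in>A. fnscale (c a) (x a)) = 0 \<Longrightarrow> \<forall>a\<in>A. c a = 0"
  shows "card A \<le> N"
proof -
  have "inj_on x A"
  proof (rule inj_onI)
    fix a b assume ab: "a \<in> A" "b \<in> A" "x a = x b"
    show "a = b"
    proof (rule ccontr)
      assume "a \<noteq> b"
      define c where "c = (\<lambda>u. if u = a then 1 else if u = b then - 1 else (0::'b))"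
      have "(\<Sum>u\<in>A. fnscale (c u) (x u)) = (\<Sum>u\<in>{a, b}. fnscale (c u) (x u))"
        using ab assms(3) by (intro sum.mono_neutral_right) (auto simp: c_def)
      also have "\<dots> = 0"
        using \<open>a \<noteq> b\<close> ab by (simp add: c_def)
      finally have "c a = 0"
        using indep[of c] ab(1) by blast
      then show False
        by (simp add: c_def)
    qed
  qed
  moreover have "fnv.independent (x ` A)"
  proof (rule fnv.independent_if_scalars_zero)
    fix c y assume c: "(\<Sum>y\<in>x ` A. fnscale (c y) y) = 0" and y: "y \<in> x ` A"
    then have "(\<Sum>a\<in>A. fnscale (c (x a)) (x a)) = 0"
      by (simp add: sum.reindex[OF \<open>inj_on x A\<close>])
    then show "c y = 0"
      using indep[of "\<lambda>a. c (x a)"] y by blast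
  qed (use assms in simp)
  ultimately show ?thesis
    using dimle_independent(2)[OF assms(1) _ assms(2)] by (simp add: card_image)
qed

section \<open>Truncation by height and polynomial growth\<close>

definition Ltrunc :: "('i::finite, 'k::field) bichar \<Rightarrow> ('i \<Rightarrow> 'k) \<Rightarrow> nat \<Rightarrow> ('i list \<Rightarrow> 'k) set" where
  "Ltrunc X h M = fnv.span (fword X h ` {y. length y \<le> M})"

lemma Ltrunc_subspace: "fnv.subspace (Ltrunc X h M)"
  by (simp add: Ltrunc_def)

lemma Ltrunc_Lmod: "Ltrunc X h M \<subseteq> Lmod X h"
  unfolding Ltrunc_def Lmod_def by (intro fnv.span_mono) auto

lemma hom_space_length:
  fixes w y :: "'i::finite list"
  shows "g \<in> hom_space (wdeg y) \<Longrightarrow> g w \<noteq> 0 \<Longrightarrow> length w = length y"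
  using height_wdeg[of w] height_wdeg[of y] by (simp add: hom_space_def)

lemma Ltrunc_support: "g \<in> Ltrunc X h M \<Longrightarrow> length w > M \<Longrightarrow> g w = 0"
proof -
  assume g: "g \<in> Ltrunc X h M" and w: "length w > M"
  have "Ltrunc X h M \<subseteq> {g. g w = 0}"
    unfolding Ltrunc_def
  proof (rule fnv.span_minimal)
    show "fword X h ` {y. length y \<le> M} \<subseteq> {g. g w = 0}"
      using hom_space_length[OF fword_hom] w by fastforce
    show "fnv.subspace {g. g w = 0}"
      by (rule fnv.subspaceI) (auto simp: pointwise)
  qed
  with g show ?thesis by blast
qed

text \<open>Each \<open>fword\<close> is homogeneous, so cutting functions off at length M maps
  \<open>Lmod\<close> into the truncation, and a function supported there is not changed.\<close>

lemma LtruncI: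
  assumes "g \<in> Lmod X h" "\<And>w. length w > M \<Longrightarrow> g w = 0"
  shows "g \<in> Ltrunc X h M"
proof -
  define t where "t = (\<lambda>(g :: 'a list \<Rightarrow> 'b) w. if length w \<le> M then g w else 0)"
  have "fword X h y w = 0" if "length w \<noteq> length y" for y w
    using hom_space_length[OF fword_hom, of X h y w] that by blast
  then have tw: "t (fword X h y) = (if length y \<le> M then fword X h y else 0)" for y
    by (auto simp: t_def fun_eq_iff zero_fun_apply)
  have tf: "t (fword X h y) \<in> Ltrunc X h M" for y
  proof (cases "length y \<le> M")
    case True
    then show ?thesis
      using tw by (simp add: Ltrunc_def fnv.span_base)
  next
    case False
    then show ?thesis
      using tw fnv.subspace_0[OF Ltrunc_subspace, of X h M] by simp
  qed
  have t: "t (fnscale c x + y) = fnscale c (t x) + t y" "t 0 = 0" for c x y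
    by (auto simp: t_def pointwise)
  from assms(1) have "t g \<in> Ltrunc X h M"
  proof (induction rule: Lmod_induct)
    case zero
    show ?case
      unfolding t(2) by (intro fnv.subspace_0 Ltrunc_subspace)
  next
    case (add c y g)
    then show ?case
      unfolding t(1) by (intro fnv.subspace_add fnv.subspace_scale Ltrunc_subspace tf)
  qed
  also have "t g = g"
    using assms(2) by (auto simp: t_def fun_eq_iff not_le)
  finally show ?thesis .
qed

definition growth :: "('i::finite, 'k::field) bichar \<Rightarrow> bool" where
  "growth X \<longleftrightarrow> (\<exists>C d. \<forall>M. dimle (Ltrunc X (\<lambda>_. 0) M) (C * (M + 1) ^ d))"


subsection \<open>The surjection $U^-(\chi)\to\mathcal L_\chi(\Lambda)$\<close>

text \<open>Deleting the last letter instead of the first gives, for h = 0, a second family of skew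
  derivations, commuting with those given by \<open>eop\<close>.\<close>

lift_definition Rop :: "'i \<Rightarrow> ('i list, 'k::field) lop" is "\<lambda>i g w. g (w @ [i])"
  by (simp add: pointwise)

lemma app_Rop: "app (Rop i) g w = g (w @ [i])"
  by transfer simp

lemma Rop_eop: "Rop j * eop i = eop i * Rop j"
  by (rule lop_eqI) (simp add: fun_eq_iff app_Rop app_eop)

lemma Rop_vac [simp]: "app (Rop i) vac = 0"
  by (simp add: pointwise app_Rop vac_def)

text \<open>In terms of the two skew derivations at h = 0, the raising operator for general h is E_j
  - h_j K_j R_j. The vacuum coefficients of its iterates describe the image of g in the dual Verma
  module for h.\<close>

primrec pifun :: "('i::finite, 'k::field) bichar \<Rightarrow> ('i \<Rightarrow> 'k) \<Rightarrow> 'i list \<Rightarrow> ('i list \<Rightarrow> 'k) \<Rightarrow> 'k" where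
  "pifun X h [] g = g []"
| "pifun X h (j # w) g = pifun X h w (app (eop j) g) - h j * pifun X h w (app (Kop X (sroot j)) (app (Rop j) g))"

lemma pifun_lin: "pifun X h w (x + y) = pifun X h w x + pifun X h w y"
  "pifun X h w (fnscale c x) = c * pifun X h w x"
  by (induction w arbitrary: x y) (simp_all add: pointwise algebra_simps)

lemma pifun_0: "pifun X h w 0 = 0"
  using pifun_lin(2)[of X h w 0 0] by simp

definition pi_op :: "('i::finite, 'k::field) bichar \<Rightarrow> ('i \<Rightarrow> 'k) \<Rightarrow> ('i list, 'k) lop" where
  "pi_op X h = Abs_lop (\<lambda>g w. pifun X h w g)"

lemma app_pi: "app (pi_op X h) g w = pifun X h w g"
  unfolding pi_op_def by (subst Abs_lop_inverse) (auto simp: pointwise pifun_lin)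

lemma pi_vac: "app (pi_op X h) vac = vac"
proof
  fix w show "app (pi_op X h) vac w = vac w"
    by (cases w) (simp_all add: app_pi pifun_0)
qed

text \<open>For this weight the correction term involves only \<open>Rop i\<close>. It commutes with
  every \<open>eop\<close>, so the correction vanishes on all raised vectors.\<close>

lemma pi_fixes:
  assumes "app (Rop i) g = 0"
  shows "app (pi_op X (\<lambda>j. if j = i then 1 else 0)) g = g"
proof
  fix w
  show "app (pi_op X (\<lambda>j. if j = i then 1 else 0)) g w = g w"
    using assms
  proof (induction w arbitrary: g)
    case (Cons j w)
    have "app (Rop i) (app (eop j) g) = 0"
      using arg_cong[OF Rop_eop[of i j], of "\<lambda>T. app T g"] Cons.prems by simp
    then have "app (pi_op X (\<lambda>j. if j = i then 1 else 0)) (app (eop j) g) w = app (eop j) g w"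
      by (rule Cons.IH)
    then show ?case
      using Cons.prems by (auto simp: app_pi app_eop[of j g w] pifun_0)
  qed (simp add: app_pi)
qed

context
  fixes X :: "('i::finite, 'k::field) bichar"
  assumes X: "bihom X"
begin

interpretation zero: hw X "\<lambda>_. 0"
  by (rule hw.intro[OF X])

abbreviation "f0 \<equiv> fop X (\<lambda>_. 0)"

lemma Rop_fop0: "app (Rop i) (app (f0 j) g) =
    fnscale (X (sroot i) (sroot j)) (app (f0 j) (app (Rop i) g)) + (if i = j then g else 0)"
proof
  fix w
  show "app (Rop i) (app (f0 j) g) w =
      (fnscale (X (sroot i) (sroot j)) (app (f0 j) (app (Rop i) g)) + (if i = j then g else 0)) w"
  proof (induction w arbitrary: g)
    case Nil
    then show ?case
      by (auto simp: app_Rop pointwise app_fop app_Lop bihom_simps[OF X])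
  next
    case (Cons l w)
    have c: "app (Rop i) (app (eop l) g) = app (eop l) (app (Rop i) g)"
      using arg_cong[OF Rop_eop[of i l], of "\<lambda>T. app T g"] by simp
    have "app (f0 j) (app (eop l) g) (w @ [i]) = app (Rop i) (app (f0 j) (app (eop l) g)) w"
      by (simp add: app_Rop)
    also have "\<dots> = (fnscale (X (sroot i) (sroot j)) (app (f0 j) (app (Rop i) (app (eop l) g))) + (if i = j then app (eop l) g else 0)) w"
      by (rule Cons.IH)
    finally have "app (Rop i) (app (f0 j) g) (l # w) =
       X (sroot i) (sroot j) * app (f0 j) (app (eop l) (app (Rop i) g)) w + (if i = j then g (l # w) else 0)
       + (if l = j then X (wdeg w + sroot i) (sroot l) * app (Rop i) g w else 0)"
      by (simp add: c app_Rop[of i "app (f0 j) g" "l # w"] app_Rop[of i g w] app_fop app_Lop app_eop[of l g w] pointwise)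
    then show ?case
      by (auto simp: plus_fun_apply fnscale_apply zero_fun_apply app_fop app_Lop bihom_simps[OF X] algebra_simps)
  qed
qed

lemma pifun_Kop: "pifun X h w (app (Kop X \<alpha>) g) = X \<alpha> (- wdeg w) * pifun X h w g"
  and pifun_Lop: "pifun X h w (app (Lop X \<alpha>) g) = X (wdeg w) \<alpha> * pifun X h w g"
proof -
  have 1: "app (eop j) (app (Kop X \<alpha>) g) = fnscale (X \<alpha> (- sroot j)) (app (Kop X \<alpha>) (app (eop j) g))"
    "app (eop j) (app (Lop X \<alpha>) g) = fnscale (X (sroot j) \<alpha>) (app (Lop X \<alpha>) (app (eop j) g))"
    "app (Kop X (sroot j)) (app (Rop j) (app (Kop X \<alpha>) g)) =
       fnscale (X \<alpha> (- sroot j)) (app (Kop X \<alpha>) (app (Kop X (sroot j)) (app (Rop j) g)))"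
    "app (Kop X (sroot j)) (app (Rop j) (app (Lop X \<alpha>) g)) =
       fnscale (X (sroot j) \<alpha>) (app (Lop X \<alpha>) (app (Kop X (sroot j)) (app (Rop j) g)))" for j g
    by (simp_all add: pointwise app_Rop app_eop app_Kop app_Lop bihom_simps[OF X])
  show "pifun X h w (app (Kop X \<alpha>) g) = X \<alpha> (- wdeg w) * pifun X h w g"
  proof (induction w arbitrary: g)
    case (Cons j w)
    show ?case
      by (simp add: 1 pifun_lin Cons) (simp add: bihom_simps[OF X] algebra_simps)
  qed (simp add: app_Kop bihom_simps[OF X])
  show "pifun X h w (app (Lop X \<alpha>) g) = X (wdeg w) \<alpha> * pifun X h w g"
  proof (induction w arbitrary: g)
    case (Cons j w)
    show ?case
      by (simp add: 1 pifun_lin Cons) (simp add: bihom_simps[OF X] algebra_simps)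
  qed (simp add: app_Lop bihom_simps[OF X])
qed

lemma pi_fop0: "app (pi_op X h) (app (f0 l) g) = app (fop X h l) (app (pi_op X h) g)"
proof
  fix w
  show "app (pi_op X h) (app (f0 l) g) w = app (fop X h l) (app (pi_op X h) g) w"
  proof (induction w arbitrary: g)
    case Nil
    then show ?case by (simp add: app_pi app_fop)
  next
    case (Cons j w)
    let ?K = "Kop X (sroot j)"
    have e: "app (eop j) (app (f0 l) g) = app (f0 l) (app (eop j) g) + (if j = l then app (Lop X (sroot j)) g else 0)"
      by (auto simp: pointwise app_eop app_fop)
    have K: "app ?K (app (f0 l) y) = fnscale (inverse (X (sroot j) (sroot l))) (app (f0 l) (app ?K y))" for y
      using arg_cong[OF zero.Kf'[of "sroot j" l], of "\<lambda>T. app T y"] by simp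
    have R: "app ?K (app (Rop j) (app (f0 l) g)) =
       app (f0 l) (app ?K (app (Rop j) g)) + (if j = l then app ?K g else 0)"
      by (auto simp: Rop_fop0 K bihom_simps[OF X])
    have eq: "app (eop j) (app (pi_op X h) g) = app (pi_op X h) (app (eop j) g)
        - fnscale (h j) (app (pi_op X h) (app ?K (app (Rop j) g)))"
      by (simp add: pointwise app_eop app_pi)
    have "app (pi_op X h) (app (f0 l) g) (j # w) =
       app (fop X h l) (app (pi_op X h) (app (eop j) g)) w
       - h j * app (fop X h l) (app (pi_op X h) (app ?K (app (Rop j) g))) w
       + (if j = l then pifun X h w (app (Lop X (sroot j)) g) - h j * pifun X h w (app ?K g) else 0)"
      unfolding Cons[symmetric] by (auto simp: app_pi e R pifun_lin pifun_0 algebra_simps)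
    also have "\<dots> = app (fop X h l) (app (pi_op X h) g) (j # w)"
      by (simp add: app_fop eq pifun_Kop pifun_Lop app_Kop app_Lop app_pi)
        (simp add: minus_apply fnscale_apply)
    finally show ?case .
  qed
qed

lemma pi_fword: "app (pi_op X h) (fword X (\<lambda>_. 0) y) = fword X h y"
  by (induction y) (simp_all add: pi_vac pi_fop0)

lemma pi_Ltrunc: "app (pi_op X h) ` Ltrunc X (\<lambda>_. 0) M = Ltrunc X h M"
  by (simp add: Ltrunc_def app_span image_image pi_fword)

lemma Rop_Lmod0: "g \<in> Lmod X (\<lambda>_. 0) \<Longrightarrow> app (Rop i) g \<in> Lmod X (\<lambda>_. 0)"
proof (erule Lmod_closedI[rotated])
  fix y show "app (Rop i) (fword X (\<lambda>_. 0) y) \<in> Lmod X (\<lambda>_. 0)"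
  proof (induction y)
    case (Cons j y)
    then show ?case
      by (auto simp: Rop_fop0 intro!: fnv.subspace_add fnv.subspace_scale Lmod_subspace fop_Lmod fword_in_Lmod)
  qed (simp add: fnv.subspace_0 Lmod_subspace)
qed

text \<open>Each application of \<open>Rop i\<close> shortens words, so its (M+1)-st power vanishes
  on the truncation. Each layer of the filtration by kernels of its powers embeds into the kernel of
  \<open>Rop i\<close>, which by \<open>pi_fixes\<close> lies in the module bounded by N.\<close>

lemma dimle_Ltrunc_filtration:
  assumes "dimle (Ltrunc X (\<lambda>j. if j = i then 1 else 0) M) N"
  shows "dimle (Ltrunc X (\<lambda>_. 0) M) ((M + 1) * N)"
proof -
  let ?B = "Ltrunc X (\<lambda>_. 0) M"
  have RB: "app (Rop i) g \<in> ?B" if "g \<in> ?B" for g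
    using that Ltrunc_Lmod
    by (intro LtruncI Rop_Lmod0) (auto simp: app_Rop Ltrunc_support)
  have RB': "app (Rop i ^ b) g \<in> ?B" if "g \<in> ?B" for b g
    using that by (induction b) (simp_all add: RB)
  have sub: "fnv.subspace {g \<in> ?B. app T g = 0}" for T
    by (rule fnv.subspaceI) (auto intro!: fnv.subspace_0 fnv.subspace_add fnv.subspace_scale Ltrunc_subspace)
  have "{g \<in> ?B. app (Rop i) g = 0} \<subseteq> Ltrunc X (\<lambda>j. if j = i then 1 else 0) M"
  proof clarify
    fix g assume g: "g \<in> ?B" "app (Rop i) g = 0"
    have "app (pi_op X (\<lambda>j. if j = i then 1 else 0)) g \<in> Ltrunc X (\<lambda>j. if j = i then 1 else 0) M"
      using imageI[OF g(1), of "app (pi_op X (\<lambda>j. if j = i then 1 else 0))"] by (simp only: pi_Ltrunc)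
    then show "g \<in> Ltrunc X (\<lambda>j. if j = i then 1 else 0) M"
      by (simp only: pi_fixes[OF g(2)])
  qed
  then have K: "dimle {g \<in> ?B. app (Rop i) g = 0} N"
    using assms dimle_mono by blast
  have "dimle {g \<in> ?B. app (Rop i ^ b) g = 0} (b * N)" for b
  proof (induction b)
    case 0
    have "dimle {0} 0"
      unfolding dimle_def by (intro exI[of _ "{}"]) simp
    then show ?case
      by (rule dimle_mono) auto
  next
    case (Suc b)
    have "app (Rop i ^ b) ` {g \<in> ?B. app (Rop i ^ Suc b) g = 0} \<subseteq> {g \<in> ?B. app (Rop i) g = 0}"
      using RB' by auto
    then have "dimle (app (Rop i ^ b) ` {g \<in> ?B. app (Rop i ^ Suc b) g = 0}) N"
      using K dimle_mono by blast
    moreover have "dimle {x \<in> {g \<in> ?B. app (Rop i ^ Suc b) g = 0}. app (Rop i ^ b) x = 0} (b * N)"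
      using Suc by (rule dimle_mono) auto
    ultimately have "dimle {g \<in> ?B. app (Rop i ^ Suc b) g = 0} (N + b * N)"
      by (rule dimle_rank_nullity[OF sub])
    then show ?case by simp
  qed
  moreover have "app (Rop i ^ (M + 1)) g = 0" if "g \<in> ?B" for g
  proof -
    have "app (Rop i ^ b) g w = g (w @ replicate b i)" for b w
      by (induction b arbitrary: w) (simp_all add: app_Rop replicate_append_same)
    then show ?thesis
      using that by (simp add: fun_eq_iff zero_fun_apply Ltrunc_support del: power_Suc)
  qed
  then have "?B \<subseteq> {g \<in> ?B. app (Rop i ^ (M + 1)) g = 0}"
    by blast
  ultimately show ?thesis
    by (rule dimle_mono) simp
qed

end

section \<open>Polynomial growth passes to the reflected bi-homomorphism\<close>

lemma growth_reflection:
  fixes X :: "('i::finite, 'k::field) bichar"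
  assumes X: "bihom X" and growth: "growth X" and m: "\<And>j. j \<noteq> i \<Longrightarrow> cartan_max X i j = enat (m j)"
  shows "growth (bichar_refl i X)"
proof -
  let ?\<delta> = "\<lambda>j. if j = i then 1 else (0 :: 'k)"
  let ?X = "bichar_refl i X"
  interpret reflectable X ?\<delta> i m
    by unfold_locales (use X m in auto)
  \<comment> \<open>The first factor 1 - h i is already 0, so the height is 0. No power of \<chi>
    enters \<open>h'\<close>, which therefore equals the original weight.\<close>
  interpret reflection X ?\<delta> i m 0
    by unfold_locales (simp_all add: ncoef_def qfact_Suc qpoch_Suc)
  have h': "h' = ?\<delta>"
    by (auto simp: h'_def fun_eq_iff)
  obtain C d where Cd: "dimle (Ltrunc X (\<lambda>_. 0) M) (C * (M + 1) ^ d)" for M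
    using growth by (auto simp: growth_def)
  \<comment> \<open>The height of s_i(\<alpha>_j) is 1 + m j for j other than i and -1 for i. Hence
    c bounds the factor by which the reflection stretches heights.\<close>
  define c where "c = 1 + (\<Sum>j\<in>UNIV. m j)"
  have height_s: "height (s (wdeg w)) \<le> int c * int (length w)" for w
  proof (induction w)
    case (Cons j w)
    have "height (s (sroot j)) \<le> int c"
    proof (cases "j = i")
      case True
      have "height (- sroot i) = - 1"
        using height_simps(3)[of 0 "sroot i"] by simp
      then show ?thesis
        using True by (simp add: srefl_simps c_def sum_nonneg add_nonneg_nonneg)
    next
      case False
      have "m j \<le> (\<Sum>j\<in>UNIV. m j)"
        by (intro member_le_sum) auto
      then show ?thesis
        using False by (simp add: srefl_sroot height_wdeg c_def flip: of_nat_sum)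
    qed
    then show ?case
      using Cons by (simp add: srefl_simps algebra_simps)
  qed (simp add: srefl_simps)
  have sub: "Ltrunc ?X ?\<delta> M \<subseteq> app Phi_op ` Ltrunc X ?\<delta> (c * M)" for M
  proof
    fix x assume x: "x \<in> Ltrunc ?X ?\<delta> M"
    then obtain g where g: "g \<in> Lmod X ?\<delta>" "x = app Phi_op g"
      using Phi_bij Ltrunc_Lmod unfolding h' bij_betw_def by blast
    have "g \<in> Ltrunc X ?\<delta> (c * M)"
    proof (rule LtruncI[OF g(1)], rule ccontr)
      fix w assume w: "c * M < length w" "g w \<noteq> 0"
      have "component (wdeg w) g \<noteq> 0"
        using w(2) by (auto simp: component_def fun_eq_iff zero_fun_apply)
      then have "app Phi_op (component (wdeg w) g) \<noteq> 0"
        using Phi_inj[OF component_Lmod[OF g(1)]] by blast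
      then obtain u where u: "s (wdeg u) = wdeg w" "x u \<noteq> 0"
        by (auto simp: fun_eq_iff app_Phi Phi_component zero_fun_apply g(2) split: if_splits)
      then have "length u \<le> M"
        using Ltrunc_support[OF x, of u] by (meson not_le)
      then have "int (length w) \<le> int c * int M"
        using height_s[of u] u(1) height_wdeg[of w] mult_left_mono[of "int (length u)" "int M" "int c"] by simp
      then show False
        using w(1) by (simp flip: of_nat_mult)
    qed
    then show "x \<in> app Phi_op ` Ltrunc X ?\<delta> (c * M)"
      using g(2) by blast
  qed
  have "dimle (Ltrunc ?X (\<lambda>_. 0) M) ((M + 1) * (C * (c * M + 1) ^ d))" for M
  proof (rule dimle_Ltrunc_filtration[OF X'_bihom])
    have "dimle (app Phi_op ` app (pi_op X ?\<delta>) ` Ltrunc X (\<lambda>_. 0) (c * M)) (C * (c * M + 1) ^ d)"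
      by (intro dimle_image Cd)
    then show "dimle (Ltrunc ?X ?\<delta> M) (C * (c * M + 1) ^ d)"
      unfolding pi_Ltrunc[OF X] using sub order_refl by (rule dimle_mono)
  qed
  moreover have "(M + 1) * (C * (c * M + 1) ^ d) \<le> (C * c ^ d) * (M + 1) ^ Suc d" for M
  proof -
    have "(c * M + 1) ^ d \<le> (c * (M + 1)) ^ d"
      by (intro power_mono) (auto simp: c_def)
    then have "(M + 1) * (C * (c * M + 1) ^ d) \<le> (M + 1) * (C * (c * (M + 1)) ^ d)"
      by (intro mult_le_mono) auto
    also have "\<dots> = (C * c ^ d) * (M + 1) ^ Suc d"
      by (simp only: power_mult_distrib power_Suc mult_ac)
    finally show ?thesis .
  qed
  ultimately have "\<forall>M. dimle (Ltrunc ?X (\<lambda>_. 0) M) ((C * c ^ d) * (M + 1) ^ Suc d)"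
    using dimle_mono by blast
  then show ?thesis
    unfolding growth_def by blast
qed


subsection \<open>Finiteness of the Cartan entries\<close>

locale infinite_cartan = hw X "\<lambda>_. 0" for X :: "('i::finite, 'k::field) bichar" +
  fixes i j :: 'i
  assumes ij: "i \<noteq> j"
    and nz: "\<And>m. qfact m (X (sroot i) (sroot i)) \<noteq> 0"
      "\<And>m. qpoch m (X (sroot i) (sroot i)) (X (sroot i) (sroot j) * X (sroot j) (sroot i)) \<noteq> 0"
begin

primrec xw :: "nat list \<Rightarrow> 'i list \<Rightarrow> 'k" where
  "xw [] = vac"
| "xw (m # ms) = app (fs i j m) (xw ms)"

abbreviation "f \<equiv> fop X (\<lambda>_. 0)"

text \<open>The commutator with E_i carries the factor h i, which is 0 here, so E_i passes through
  all iterated adjoints.\<close>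

lemma eop_i_fs: "eop i * fs i j m = fs i j m * eop i"
  using commutator_fs_ei[OF ij] by (cases m) (simp_all add: commutator_def)

lemma eop_j_fs: "eop j * fs i j m = fs i j m * eop j + acoef i j m \<odot> (f i ^ m * Lop X (sroot j))"
proof (cases m)
  case 0
  then show ?thesis
    using ef'(1)[of j] by (simp add: fs_simps commutator_def algebra_simps)
next
  case (Suc k)
  then show ?thesis
    using qg.commutator_es_fj(2)[OF qg_swap, folded fs_swap, of i j k] ij
    by (simp add: commutator_def algebra_simps)
qed

lemma eop_i_fpow: "eop i * f i ^ Suc r = f i ^ Suc r * eop i + qnum (Suc r) (X (sroot i) (sroot i)) \<odot> (f i ^ r * Lop X (sroot i))"
  using commutator_fpow[of i r] by (simp add: commutator_def algebra_simps)

lemma eop_i_pow_fs: "eop i ^ k * fs i j m = fs i j m * eop i ^ k"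
  by (induction k) (simp_all add: mult.assoc eop_i_fs, simp add: eop_i_fs flip: mult.assoc)

lemma eop_pow_fpow:
  assumes "g \<in> hom_space \<beta>" "app (eop i) g = 0"
  shows "app (eop i ^ r) (app (f i ^ r) g) = fnscale (qfact r (X (sroot i) (sroot i)) * X \<beta> (sroot i) ^ r) g"
    "r < k \<Longrightarrow> app (eop i ^ k) (app (f i ^ r) g) = 0"
proof -
  have step: "app (eop i) (app (f i ^ Suc r) g) = fnscale (qnum (Suc r) (X (sroot i) (sroot i)) * X \<beta> (sroot i)) (app (f i ^ r) g)" for r
    using arg_cong[OF eop_i_fpow[of r], of "\<lambda>T. app T g"] assms by (simp add: app_Lop_hom del: power_Suc)
  show 1: "app (eop i ^ r) (app (f i ^ r) g) = fnscale (qfact r (X (sroot i) (sroot i)) * X \<beta> (sroot i) ^ r) g" for r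
  proof (induction r)
    case 0
    show ?case by simp
  next
    case (Suc r)
    have "app (eop i ^ Suc r) (app (f i ^ Suc r) g) = app (eop i ^ r) (app (eop i) (app (f i ^ Suc r) g))"
      by (simp only: power_Suc2 app_simps)
    then show ?case
      by (simp add: step Suc qfact_Suc mult_ac del: power_Suc) (simp add: mult_ac)
  qed
  assume "r < k"
  then obtain l where "k = l + Suc r"
    by (metis add.commute add_Suc_right less_imp_Suc_add)
  moreover have "app (eop i ^ (l + Suc r)) (app (f i ^ r) g) = app (eop i ^ l) (app (eop i) (app (eop i ^ r) (app (f i ^ r) g)))"
    by (simp only: power_add power_Suc app_simps)
  ultimately show "app (eop i ^ k) (app (f i ^ r) g) = 0"
    by (simp only: 1 app_lin assms(2) fnv.scale_zero_right app_zero)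
qed

lemma eop_i_xw: "app (eop i) (xw ms) = 0"
proof (induction ms)
  case (Cons m ms)
  then show ?case
    using arg_cong[OF eop_i_fs[of m], of "\<lambda>T. app T (xw ms)"] by simp
qed simp

definition xdeg :: "nat list \<Rightarrow> 'i lattice" where
  "xdeg ms = sum_list (map (\<lambda>m. sroot j + wdeg (replicate m i)) ms)"

lemma hom_op_fs: "hom_op (sroot j + wdeg (replicate k i)) (fs i j k)"
proof (induction k)
  case (Suc k)
  have "hom_op (sroot j + wdeg (replicate (Suc k) i)) (f i * fs i j k)"
    "hom_op (sroot j + wdeg (replicate (Suc k) i)) (fs i j k * f i)"
    using hom_op_mult[OF hom_op_fop Suc, of i X "\<lambda>_. 0"] hom_op_mult[OF Suc hom_op_fop, of i X "\<lambda>_. 0"] by (simp_all add: algebra_simps)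
  then show ?case
    unfolding fs_simps sm_lsc by (intro hom_op_diff hom_op_scale)
qed (simp add: fs_simps hom_op_fop)

lemma xw_hom: "xw ms \<in> hom_space (xdeg ms)"
proof (induction ms)
  case (Cons m ms)
  then show ?case
    using hom_op_hom[OF hom_op_fs Cons, of m] by (simp add: xdeg_def add.commute)
qed (simp add: xdeg_def vac_hom)

lemma xw_Lmod: "xw ms \<in> Lmod X (\<lambda>_. 0)"
proof (induction ms)
  case (Cons m ms)
  have "g \<in> Lmod X (\<lambda>_. 0) \<Longrightarrow> app (fs i j k) g \<in> Lmod X (\<lambda>_. 0)" for k g
    by (induction k arbitrary: g)
      (auto simp: fs_simps intro!: fop_Lmod fnv.subspace_diff fnv.subspace_scale Lmod_subspace)
  then show ?case
    using Cons by simp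
qed (simp add: vac_in_Lmod)

text \<open>The operator \<open>eop i ^ M * eop j\<close> extracts the coefficient of $x_M$ from the products of
  the $x_m$ with $m \le M$.\<close>

lemma lower_terms: "\<forall>m\<in>set ms. m < M \<Longrightarrow> app (eop i ^ M) (app (eop j) (xw ms)) = 0"
proof (induction ms)
  case (Cons m ms)
  have "app (eop j) (xw (m # ms)) = app (fs i j m) (app (eop j) (xw ms))
     + fnscale (acoef i j m) (app (f i ^ m) (app (Lop X (sroot j)) (xw ms)))"
    using arg_cong[OF eop_j_fs[of m], of "\<lambda>T. app T (xw ms)"] by simp
  moreover have "app (eop i ^ M) (app (fs i j m) (app (eop j) (xw ms))) = app (fs i j m) (app (eop i ^ M) (app (eop j) (xw ms)))"
    using arg_cong[OF eop_i_pow_fs[of M m], of "\<lambda>T. app T (app (eop j) (xw ms))"] by simp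
  ultimately show ?case
    using Cons eop_pow_fpow(2)[OF xw_hom eop_i_xw, of m M] by (simp add: app_Lop_hom[OF xw_hom])
qed simp

lemma leading_term:
  assumes "\<forall>m\<in>set ms. m < M"
  shows "\<exists>c. c \<noteq> 0 \<and> app (eop i ^ M) (app (eop j) (xw (M # ms))) = fnscale c (xw ms)"
proof -
  have 1: "app (eop j) (xw (M # ms)) = app (fs i j M) (app (eop j) (xw ms))
     + fnscale (acoef i j M) (app (f i ^ M) (app (Lop X (sroot j)) (xw ms)))"
    using arg_cong[OF eop_j_fs[of M], of "\<lambda>T. app T (xw ms)"] by simp
  have 2: "app (eop i ^ M) (app (fs i j M) (app (eop j) (xw ms))) = app (fs i j M) (app (eop i ^ M) (app (eop j) (xw ms)))"
    using arg_cong[OF eop_i_pow_fs[of M M], of "\<lambda>T. app T (app (eop j) (xw ms))"] by simp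
  show ?thesis
    unfolding 1 app_lin 2 lower_terms[OF assms] app_Lop_hom[OF xw_hom] eop_pow_fpow(1)[OF xw_hom eop_i_xw]
    by (intro exI[of _ "acoef i j M * (X (xdeg ms) (sroot j) * (qfact M (X (sroot i) (sroot i)) * X (xdeg ms) (sroot i) ^ M))"] conjI)
      (simp_all add: nz bihom_simps(1)[OF X])
qed

text \<open>Let M be the largest head among the lists with nonzero coefficient. The operator
  \<open>eop i ^ M * eop j\<close> kills the products with smaller head and strips M from the others
  up to a nonzero factor; strict decrease ensures that the tails have smaller entries. This leaves a
  shorter relation.\<close>

lemma xw_independent:
  assumes "finite T" "\<And>ms. ms \<in> T \<Longrightarrow> length ms = p \<and> sorted_wrt (>) ms"
    and "(\<Sum>ms\<in>T. fnscale (c ms) (xw ms)) = 0" "ms \<in> T"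
  shows "c ms = 0"
  using assms
proof (induction p arbitrary: T c ms)
  case 0
  then have "T = {[]}"
    by auto
  then have "fnscale (c []) (xw []) = 0" "ms = []"
    using 0 by auto
  then show ?case
    using fnv.scale_eq_0_iff[of "c []" "xw []"] by (simp add: vac_neq_0)
next
  case (Suc p)
  show ?case
  proof (rule ccontr)
    assume "c ms \<noteq> 0"
    define T0 where "T0 = {ms \<in> T. c ms \<noteq> 0}"
    define M where "M = Max (hd ` T0)"
    define T1 where "T1 = {ms \<in> T0. hd ms = M}"
    have T0: "finite T0" "T0 \<noteq> {}"
      using Suc.prems(1,4) \<open>c ms \<noteq> 0\<close> by (auto simp: T0_def)
    have Cons: "length (tl ms) = p" "sorted_wrt (>) (tl ms)" "ms = hd ms # tl ms" "\<forall>m\<in>set (tl ms). m < hd ms" "hd ms \<le> M"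
      if "ms \<in> T0" for ms
    proof -
      have "length ms = Suc p" "sorted_wrt (>) ms"
        using Suc.prems(2)[of ms] that by (auto simp: T0_def)
      then show "length (tl ms) = p" "sorted_wrt (>) (tl ms)" "ms = hd ms # tl ms" "\<forall>m\<in>set (tl ms). m < hd ms"
        by (cases ms; simp)+
      show "hd ms \<le> M"
        unfolding M_def using that T0(1) by (intro Max_ge) auto
    qed
    have "M \<in> hd ` T0"
      unfolding M_def using T0 by (intro Max_in) auto
    then have "T1 \<noteq> {}"
      by (auto simp: T1_def)
    define E :: "('i list, 'k) lop" where "E = eop i ^ M * eop j"
    have small: "app E (xw ms) = 0" if "ms \<in> T0 - T1" for ms
    proof -
      have "hd ms < M"
        using that Cons(5)[of ms] by (auto simp: T1_def)
      then have "\<forall>m\<in>set (hd ms # tl ms). m < M"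
        using Cons(4)[of ms] that by auto
      then have "\<forall>m\<in>set ms. m < M"
        using Cons(3)[of ms] that by (metis DiffD1)
      then show ?thesis
        by (simp add: E_def lower_terms)
    qed
    have "\<forall>ms\<in>T1. \<exists>k. k \<noteq> 0 \<and> app E (xw ms) = fnscale k (xw (tl ms))"
    proof
      fix ms assume "ms \<in> T1"
      then have ms: "ms \<in> T0" "hd ms = M"
        by (simp_all add: T1_def)
      then obtain k where "k \<noteq> 0" "app E (xw (M # tl ms)) = fnscale k (xw (tl ms))"
        using leading_term[of "tl ms" M] Cons(4)[of ms] unfolding E_def app_simps by blast
      then show "\<exists>k. k \<noteq> 0 \<and> app E (xw ms) = fnscale k (xw (tl ms))"
        using Cons(3)[OF ms(1)] ms(2) by metis
    qed
    then obtain k where k: "k ms \<noteq> 0" "app E (xw ms) = fnscale (k ms) (xw (tl ms))" if "ms \<in> T1" for ms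
      by metis
    have T1: "T1 \<subseteq> T0" "finite T1"
      using T0 by (auto simp: T1_def)
    have tl: "inj_on tl T1"
      by (rule inj_onI) (metis (mono_tags, lifting) Cons(3) T1_def mem_Collect_eq)
    have "0 = app E (\<Sum>ms\<in>T. fnscale (c ms) (xw ms))"
      using Suc.prems(3) by simp
    also have "(\<Sum>ms\<in>T. fnscale (c ms) (xw ms)) = (\<Sum>ms\<in>T0. fnscale (c ms) (xw ms))"
      using Suc.prems(1) by (intro sum.mono_neutral_right) (auto simp: T0_def)
    also have "app E \<dots> = (\<Sum>ms\<in>T0. fnscale (c ms) (app E (xw ms)))"
      by (simp only: app_sum app_lin)
    also have "\<dots> = (\<Sum>ms\<in>T1. fnscale (c ms) (app E (xw ms)))"
      using T0 T1 small by (intro sum.mono_neutral_right) auto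
    also have "\<dots> = (\<Sum>ms\<in>T1. fnscale (c (M # tl ms) * k (M # tl ms)) (xw (tl ms)))"
    proof (rule sum.cong[OF refl])
      fix ms assume ms: "ms \<in> T1"
      then have "M # tl ms = ms"
        using Cons(3)[of ms] T1 by (auto simp: T1_def)
      then show "fnscale (c ms) (app E (xw ms)) = fnscale (c (M # tl ms) * k (M # tl ms)) (xw (tl ms))"
        using k[OF ms] by simp
    qed
    also have "\<dots> = (\<Sum>us\<in>tl ` T1. fnscale (c (M # us) * k (M # us)) (xw us))"
      by (simp add: sum.reindex[OF tl])
    finally have sum0: "(\<Sum>us\<in>tl ` T1. fnscale (c (M # us) * k (M # us)) (xw us)) = 0"
      by simp
    obtain ms where ms: "ms \<in> T1"
      using \<open>T1 \<noteq> {}\<close> by blast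
    have "c (M # tl ms) * k (M # tl ms) = 0"
    proof (rule Suc.IH[OF _ _ sum0])
      show "finite (tl ` T1)" "tl ms \<in> tl ` T1"
        using T1 ms by auto
      show "length us = p \<and> sorted_wrt (>) us" if "us \<in> tl ` T1" for us
        using that Cons T1 by blast
    qed
    moreover have "M # tl ms = ms"
      using Cons(3)[of ms] T1 ms by (auto simp: T1_def)
    ultimately show False
      using k(1)[OF ms] ms T1 by (auto simp: T0_def)
  qed
qed

text \<open>Each position gets its own block of K values, so arbitrary lists with entries below K
  become strictly decreasing. For fixed length p this produces K^p independent products whose height
  grows only linearly in K.\<close>

primrec enc :: "nat \<Rightarrow> nat list \<Rightarrow> nat list" where
  "enc K [] = []"
| "enc K (x # xs) = (length xs * K + x) # enc K xs"

lemma enc_props: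
  assumes "set xs \<subseteq> {..<K}"
  shows "length (enc K xs) = length xs" "\<forall>m\<in>set (enc K xs). m < length xs * K" "sorted_wrt (>) (enc K xs)"
proof -
  show len: "length (enc K xs) = length xs" for xs
    by (induction xs) auto
  have *: "(\<forall>m\<in>set (enc K xs). m < length xs * K) \<and> sorted_wrt (>) (enc K xs)"
    using assms
  proof (induction xs)
    case (Cons x xs)
    then have IH: "\<forall>m\<in>set (enc K xs). m < length xs * K" "sorted_wrt (>) (enc K xs)" and "x < K"
      by auto
    then show ?case
      by (auto intro: trans_less_add1 trans_less_add2 less_le_trans)
  qed simp
  then show "\<forall>m\<in>set (enc K xs). m < length xs * K" "sorted_wrt (>) (enc K xs)"
    by blast+
qed

lemma enc_inj: "length xs = length ys \<Longrightarrow> enc K xs = enc K ys \<Longrightarrow> xs = ys"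
  by (induction xs ys rule: list_induct2) auto

lemma not_growth: "\<not> growth X"
proof
  assume "growth X"
  then obtain C d where Cd: "dimle (Ltrunc X (\<lambda>_. 0) M) (C * (M + 1) ^ d)" for M
    by (auto simp: growth_def)
  \<comment> \<open>One factor more than the degree of the bound: K^(d+1) independent elements of
    height at most p * (p * K) would force K to stay below a constant. The number D absorbs N + 1
    into D * K.\<close>
  define p where "p = Suc d"
  define D where "D = p * p + 1"
  have bound: "K \<le> C * D ^ d" if "K > 0" for K
  proof -
    define A where "A = {xs. set xs \<subseteq> {..<K} \<and> length xs = p}"
    define N where "N = p * (p * K)"
    have A: "finite A" "card A = K ^ p"
      by (simp_all add: A_def finite_lists_length_eq card_lists_length_eq)
    have inj: "inj_on (enc K) A"
      by (rule inj_onI) (auto simp: A_def intro: enc_inj)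
    have "card (enc K ` A) \<le> C * (N + 1) ^ d"
    proof (rule dimle_family[OF Cd])
      show "xw ` enc K ` A \<subseteq> Ltrunc X (\<lambda>_. 0) N"
      proof clarify
        fix xs assume "xs \<in> A"
        then have xs: "set xs \<subseteq> {..<K}" "length xs = p"
          by (auto simp: A_def)
        show "xw (enc K xs) \<in> Ltrunc X (\<lambda>_. 0) N"
        proof (rule LtruncI[OF xw_Lmod], rule ccontr)
          fix w assume w: "N < length w" "xw (enc K xs) w \<noteq> 0"
          have "height (xdeg ms) \<le> int (length ms * B)" if "\<forall>m\<in>set ms. m < B" for ms B
            using that
          proof (induction ms)
            case (Cons m ms)
            then show ?case
              by (auto simp: xdeg_def height_wdeg algebra_simps)
          qed (simp add: xdeg_def)
          from this[of "enc K xs" "p * K"] have "height (xdeg (enc K xs)) \<le> int N"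
            using enc_props[OF xs(1)] xs(2) by (simp add: N_def)
          moreover have "wdeg w = xdeg (enc K xs)"
            using xw_hom[of "enc K xs"] w(2) unfolding hom_space_def by blast
          ultimately show False
            using w(1) height_wdeg[of w] by simp
        qed
      qed
      show "\<forall>a\<in>enc K ` A. c a = 0" if "(\<Sum>a\<in>enc K ` A. fnscale (c a) (xw a)) = 0" for c
      proof
        fix a assume a: "a \<in> enc K ` A"
        show "c a = 0"
        proof (rule xw_independent[OF _ _ that a])
          show "finite (enc K ` A)"
            using A by simp
          show "length ms = p \<and> sorted_wrt (>) ms" if "ms \<in> enc K ` A" for ms
            using that enc_props unfolding A_def by blast
        qed
      qed
    qed (use A in auto)
    then have "K ^ p \<le> C * (N + 1) ^ d"
      using A by (simp add: card_image[OF inj])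
    also have "\<dots> \<le> C * (D * K) ^ d"
      using that by (intro mult_le_mono power_mono) (auto simp: N_def D_def algebra_simps)
    finally have "K * K ^ d \<le> (C * D ^ d) * K ^ d"
      by (simp add: p_def power_mult_distrib mult_ac)
    then show ?thesis
      using that by simp
  qed
  from bound[of "Suc (C * D ^ d)"] show False
    by simp
qed

end

lemma cartan_max_finite:
  assumes X: "bihom X" and "growth X" and ij: "i \<noteq> j"
  shows "\<exists>m. cartan_max X i j = enat m"
proof (rule ccontr)
  assume "\<nexists>m. cartan_max X i j = enat m"
  then have inf: "cartan_max X i j = \<infinity>"
    by (cases "cartan_max X i j") auto
  let ?q = "X (sroot i) (sroot i)" and ?p = "X (sroot i) (sroot j) * X (sroot j) (sroot i)"
  have "qfact m ?q * qpoch m ?q ?p \<noteq> 0" for m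
  proof (rule ccontr)
    assume 0: "\<not> qfact m ?q * qpoch m ?q ?p \<noteq> 0"
    have "k \<le> m" if "qfact k ?q * qpoch k ?q ?p \<noteq> 0" for k
    proof (rule ccontr)
      assume "\<not> k \<le> m"
      then have "m \<le> k" by simp
      then have "qfact m ?q * qpoch m ?q ?p \<noteq> 0"
        using that by (induction k rule: dec_induct) (blast dest: qfact_qpoch_down)+
      with 0 show False by blast
    qed
    then have "cartan_max X i j \<le> enat m"
      unfolding cartan_max_def Let_def by (intro Sup_least) auto
    with inf show False by simp
  qed
  then interpret infinite_cartan X i j
    by unfold_locales (use X ij in auto)
  show False
    using not_growth assms by blast
qed

section \<open>Graded subspaces of the free algebra\<close>

definition gdeg :: "'i gen fword \<Rightarrow> 'i lattice" where
  "gdeg w = sum_list (map gen_deg (letters w))"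

lemma gdeg_simps [simp]: "gdeg 0 = 0" "gdeg (u + v) = gdeg u + gdeg v" "gdeg (Fword [g]) = gen_deg g"
  by (simp_all add: gdeg_def)

definition prj :: "'i lattice \<Rightarrow> ('i, 'k::field) qalg \<Rightarrow> ('i, 'k) qalg" where
  "prj \<beta> x = (\<Sum>w\<in>Poly_Mapping.keys x. if gdeg w = \<beta> then Poly_Mapping.single w (Poly_Mapping.lookup x w) else 0)"

lemma lookup_prj: "Poly_Mapping.lookup (prj \<beta> x) w = (if gdeg w = \<beta> then Poly_Mapping.lookup x w else 0)"
proof -
  have "Poly_Mapping.lookup (prj \<beta> x) w =
      (\<Sum>v\<in>Poly_Mapping.keys x. if v = w then if gdeg w = \<beta> then Poly_Mapping.lookup x w else 0 else 0)"
    unfolding prj_def lookup_sum by (rule sum.cong) (auto simp: lookup_single when_def)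
  then show ?thesis
    by (simp add: in_keys_iff)
qed

lemma lookup_fscale: "Poly_Mapping.lookup (fscale c x) w = c * Poly_Mapping.lookup x w"
proof -
  have *: "Poly_Mapping.lookup (fscale c (Poly_Mapping.single v d)) w = c * Poly_Mapping.lookup (Poly_Mapping.single v d) w" for v d
    by (simp add: fscale_def fconst_def mult_single lookup_single when_def)
  have "fscale c x = (\<Sum>v\<in>Poly_Mapping.keys x. fscale c (Poly_Mapping.single v (Poly_Mapping.lookup x v)))"
    by (subst poly_mapping_expand[of x]) (rule falg.scale_sum_right)
  also have "Poly_Mapping.lookup \<dots> w = c * Poly_Mapping.lookup (\<Sum>v\<in>Poly_Mapping.keys x. Poly_Mapping.single v (Poly_Mapping.lookup x v)) w"
    by (simp add: lookup_sum * sum_distrib_left)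
  finally show ?thesis
    by (simp flip: poly_mapping_expand)
qed

lemma prj_lin: "prj \<beta> (x + y) = prj \<beta> x + prj \<beta> y" "prj \<beta> (x - y) = prj \<beta> x - prj \<beta> y"
  "prj \<beta> (fscale c x) = fscale c (prj \<beta> x)" "prj \<beta> 0 = 0"
  by (rule poly_mapping_eqI; simp add: lookup_prj lookup_add lookup_minus lookup_fscale)+

lemma prj_sum: "prj \<beta> (sum x S) = (\<Sum>s\<in>S. prj \<beta> (x s))"
  by (induction S rule: infinite_finite_induct) (simp_all add: prj_lin)

lemma homog_iff: "x \<in> homog \<beta> \<longleftrightarrow> (\<forall>w. Poly_Mapping.lookup x w \<noteq> 0 \<longrightarrow> gdeg w = \<beta>)"
  by (simp add: homog_def gdeg_def in_keys_iff Ball_def)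

lemma prj_homog: "prj \<beta> x \<in> homog \<beta>"
  by (simp add: homog_iff lookup_prj)

lemma prj_eq: "x \<in> homog \<beta> \<Longrightarrow> prj \<gamma> x = (if \<gamma> = \<beta> then x else 0)"
  by (rule poly_mapping_eqI) (auto simp: lookup_prj homog_iff)

lemma homog_subspace: "falg.subspace (homog \<beta>)"
  by (rule falg.subspaceI) (auto simp: homog_iff lookup_add lookup_fscale, metis add_0)

lemma homog_mult: "x \<in> homog \<alpha> \<Longrightarrow> y \<in> homog \<beta> \<Longrightarrow> x * y \<in> homog (\<alpha> + \<beta>)"
  unfolding homog_iff using keys_mult[of x y] gdeg_simps(2) by (force simp: in_keys_iff)

lemma sum_prj: "x = (\<Sum>\<beta>\<in>gdeg ` Poly_Mapping.keys x. prj \<beta> x)"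
proof (rule poly_mapping_eqI)
  fix w
  show "Poly_Mapping.lookup x w = Poly_Mapping.lookup (\<Sum>\<beta>\<in>gdeg ` Poly_Mapping.keys x. prj \<beta> x) w"
  proof (cases "w \<in> Poly_Mapping.keys x")
    case True
    have "Poly_Mapping.lookup (\<Sum>\<beta>\<in>gdeg ` Poly_Mapping.keys x. prj \<beta> x) w =
        (\<Sum>\<beta>\<in>gdeg ` Poly_Mapping.keys x. if gdeg w = \<beta> then Poly_Mapping.lookup x w else 0)"
      by (simp add: lookup_sum lookup_prj)
    then show ?thesis
      using True by (simp add: sum.delta')
  qed (simp add: lookup_sum lookup_prj in_keys_iff)
qed

definition graded :: "('i, 'k::field) qalg set \<Rightarrow> bool" where
  "graded S \<longleftrightarrow> (\<forall>x\<in>S. \<forall>\<beta>. prj \<beta> x \<in> S)"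

lemma graded_span:
  assumes "\<And>s \<beta>. s \<in> S \<Longrightarrow> prj \<beta> s \<in> falg.span S"
  shows "graded (falg.span S)"
  unfolding graded_def
proof (intro ballI allI)
  fix x \<beta> assume "x \<in> falg.span S"
  then show "prj \<beta> x \<in> falg.span S"
    by (induction rule: falg.span_induct_alt)
      (auto simp: prj_lin falg.span_zero intro: falg.span_add falg.span_scale assms)
qed

lemma graded_plus: "graded S \<Longrightarrow> graded T \<Longrightarrow> graded (S + T)"
  unfolding graded_def by (auto simp: prj_lin elim!: set_plus_elim intro!: set_plus_intro)

lemma subspace_plus: "falg.subspace S \<Longrightarrow> falg.subspace T \<Longrightarrow> falg.subspace (S + T)"
proof -
  assume *: "falg.subspace S" "falg.subspace T"
  have "S + T = {x + y |x y. x \<in> S \<and> y \<in> T}"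
    by (auto simp: set_plus_def)
  then show ?thesis
    using falg.subspace_sums[OF *] by simp
qed

lemma prj_mult_homog:
  assumes "a \<in> homog \<alpha>"
  shows "prj \<beta> (a * x) = a * prj (\<beta> - \<alpha>) x"
proof -
  let ?D = "gdeg ` Poly_Mapping.keys x"
  have "prj \<beta> (a * x) = prj \<beta> (\<Sum>\<gamma>\<in>?D. a * prj \<gamma> x)"
    by (subst sum_prj) (simp add: sum_distrib_left)
  also have "\<dots> = (\<Sum>\<gamma>\<in>?D. if \<gamma> = \<beta> - \<alpha> then a * prj (\<beta> - \<alpha>) x else 0)"
    unfolding prj_sum by (intro sum.cong refl) (auto simp: prj_eq[OF homog_mult[OF assms prj_homog]] algebra_simps)
  also have "\<dots> = a * prj (\<beta> - \<alpha>) x"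
  proof (cases "\<beta> - \<alpha> \<in> ?D")
    case False
    then have "prj (\<beta> - \<alpha>) x = 0"
      by (intro poly_mapping_eqI) (simp add: lookup_prj, metis image_eqI in_keys_iff)
    then show ?thesis by simp
  qed simp
  finally show ?thesis .
qed

lemma ideal_gen_graded:
  assumes "\<And>s. s \<in> S \<Longrightarrow> \<exists>\<alpha>. s \<in> homog \<alpha>"
  shows "graded (ideal_gen S)"
  unfolding ideal_gen_def
proof (rule graded_span)
  fix x \<beta> assume "x \<in> {a * s * b | a s b. s \<in> S}"
  then obtain a s b where x: "x = a * s * b" "s \<in> S" by blast
  then obtain \<alpha> where \<alpha>: "s \<in> homog \<alpha>"
    using assms by blast
  have "x = (\<Sum>\<gamma>\<in>gdeg ` Poly_Mapping.keys a. prj \<gamma> a * s * b)"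
    unfolding x(1) by (subst sum_prj[of a]) (simp add: sum_distrib_right)
  then have "prj \<beta> x = (\<Sum>\<gamma>\<in>gdeg ` Poly_Mapping.keys a. prj \<gamma> a * s * prj (\<beta> - (\<gamma> + \<alpha>)) b)"
    by (simp add: prj_sum prj_mult_homog[OF homog_mult[OF prj_homog \<alpha>]])
  also have "\<dots> \<in> falg.span {a * s * b | a s b. s \<in> S}"
    using x(2) by (intro falg.span_sum falg.span_base) blast
  finally show "prj \<beta> x \<in> falg.span {a * s * b | a s b. s \<in> S}" .
qed

lemma ideal_gen_subspace: "falg.subspace (ideal_gen S)"
  by (simp add: ideal_gen_def)

lemma fscale_mult: "fscale c x * y = fscale c (x * y)" "x * fscale c y = fscale c (x * y)"
  by (simp_all add: fscale_def mult.assoc) (metis fconst_central mult.assoc)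

lemma ideal_gen_mult:
  assumes "x \<in> ideal_gen S"
  shows "a * x \<in> ideal_gen S" "x * a \<in> ideal_gen S"
proof -
  have "a * x \<in> ideal_gen S \<and> x * a \<in> ideal_gen S"
    using assms unfolding ideal_gen_def
  proof (induction rule: falg.span_induct_alt)
    case base
    then show ?case by (simp add: falg.span_zero)
  next
    case (step c x y)
    then obtain u s v where x: "x = u * s * v" "s \<in> S" by blast
    have "a * x = (a * u) * s * v" "x * a = u * s * (v * a)"
      by (simp_all add: x mult.assoc)
    then have "a * x \<in> falg.span {a * s * b | a s b. s \<in> S}" "x * a \<in> falg.span {a * s * b | a s b. s \<in> S}"
      using x(2) by (auto intro!: falg.span_base)
    then show ?case
      using step by (simp add: distrib_left distrib_right fscale_mult falg.span_add falg.span_scale)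
  qed
  then show "a * x \<in> ideal_gen S" "x * a \<in> ideal_gen S" by auto
qed

lemma ideal_gen_base: "s \<in> S \<Longrightarrow> s \<in> ideal_gen S"
  unfolding ideal_gen_def by (rule falg.span_base) (metis (mono_tags, lifting) mem_Collect_eq mult_1_left mult_1_right)

lemma generators_homog:
  "Kg \<alpha> \<in> homog 0" "Lg \<alpha> \<in> homog 0" "Eg i \<in> homog (sroot i)" "Fg i \<in> homog (- sroot i)" "1 \<in> homog 0"
  by (auto simp: homog_iff Kg_def Lg_def Eg_def Fg_def fvar_def lookup_single when_def lookup_one)

section \<open>Homogeneity of the defining relations\<close>

lemma Ut_relators_homog: "r \<in> Ut_relators X \<Longrightarrow> \<exists>\<alpha>. r \<in> homog \<alpha>"
proof (induction rule: Ut_relators.induct)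
  case (10 i j)
  have "Eg i * Fg j \<in> homog (sroot i - sroot j)" "Fg j * Eg i \<in> homog (sroot i - sroot j)"
    using homog_mult[OF generators_homog(3,4), of i j] homog_mult[OF generators_homog(4,3), of j i] by (simp_all add: algebra_simps)
  then show ?case
    using generators_homog(1,2) falg.subspace_0[OF homog_subspace]
    by (intro exI[of _ "sroot i - sroot j"])
      (auto intro!: falg.subspace_diff[OF homog_subspace] falg.subspace_add[OF homog_subspace] falg.subspace_neg[OF homog_subspace])
next
  case (6 \<alpha> i)
  show ?case
    using homog_mult[OF generators_homog(1,3), of \<alpha> i] homog_mult[OF generators_homog(3,1), of i \<alpha>]
    by (intro exI[of _ "sroot i"]) (auto intro!: falg.subspace_diff[OF homog_subspace] falg.subspace_scale[OF homog_subspace])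
next
  case (7 \<alpha> i)
  show ?case
    using homog_mult[OF generators_homog(2,3), of \<alpha> i] homog_mult[OF generators_homog(3,2), of i \<alpha>]
    by (intro exI[of _ "sroot i"]) (auto intro!: falg.subspace_diff[OF homog_subspace] falg.subspace_scale[OF homog_subspace])
next
  case (8 \<alpha> i)
  show ?case
    using homog_mult[OF generators_homog(1,4), of \<alpha> i] homog_mult[OF generators_homog(4,1), of i \<alpha>]
    by (intro exI[of _ "- sroot i"]) (auto intro!: falg.subspace_diff[OF homog_subspace] falg.subspace_scale[OF homog_subspace])
next
  case (9 \<alpha> i)
  show ?case
    using homog_mult[OF generators_homog(2,4), of \<alpha> i] homog_mult[OF generators_homog(4,2), of i \<alpha>]
    by (intro exI[of _ "- sroot i"]) (auto intro!: falg.subspace_diff[OF homog_subspace] falg.subspace_scale[OF homog_subspace])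
qed (use homog_mult[of _ 0 _ 0] in \<open>auto intro!: exI[of _ 0] falg.subspace_diff[OF homog_subspace] generators_homog\<close>)

lemma Ut_ideal_graded: "graded (Ut_ideal X)"
  unfolding Ut_ideal_def by (rule ideal_gen_graded) (rule Ut_relators_homog)

lemma Ut_ideal_subspace: "falg.subspace (Ut_ideal X)"
  unfolding Ut_ideal_def by (rule ideal_gen_subspace)

lemma Ut_ideal_mult: "x \<in> Ut_ideal X \<Longrightarrow> a * x \<in> Ut_ideal X" "x \<in> Ut_ideal X \<Longrightarrow> x * a \<in> Ut_ideal X"
  unfolding Ut_ideal_def by (rule ideal_gen_mult; assumption)+

lemma Ut_ideal_relator: "r \<in> Ut_relators X \<Longrightarrow> r \<in> Ut_ideal X"
  unfolding Ut_ideal_def by (rule ideal_gen_base)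

text \<open>This is the subalgebra generated by the letters in G, described by supports. In this
  form it is visibly stable under projection to a degree.\<close>

definition words_in :: "'g set \<Rightarrow> ('g, 'k::field) free_alg set" where
  "words_in G = {x. \<forall>w. Poly_Mapping.lookup x w \<noteq> 0 \<longrightarrow> set (letters w) \<subseteq> G}"

lemma words_in_subalgebra: "subalgebra (words_in G)"
  unfolding subalgebra_def
proof (intro conjI ballI)
  show "falg.subspace (words_in G)"
    by (rule falg.subspaceI) (auto simp: words_in_def lookup_add lookup_fscale, metis add_0 subsetD)
  show "1 \<in> words_in G"
    by (auto simp: words_in_def lookup_one when_def)
  show "x * y \<in> words_in G" if "x \<in> words_in G" "y \<in> words_in G" for x y
  proof -
    have "set (letters w) \<subseteq> G" if "Poly_Mapping.lookup (x * y) w \<noteq> 0" for w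
    proof -
      have "w \<in> Poly_Mapping.keys (x * y)"
        using that by (simp add: in_keys_iff)
      then obtain u v where "w = u + v" "u \<in> Poly_Mapping.keys x" "v \<in> Poly_Mapping.keys y"
        using keys_mult[of x y] by blast
      then show ?thesis
        using \<open>x \<in> _\<close> \<open>y \<in> _\<close> by (auto simp: words_in_def in_keys_iff)
    qed
    then show ?thesis by (simp add: words_in_def)
  qed
qed

lemma single_Fword: "Poly_Mapping.single (Fword gs) 1 = prod_list (map fvar gs)"
proof (induction gs)
  case Nil
  then show ?case by (simp flip: single_one zero_fword_def)
next
  case (Cons g gs)
  have "Fword (g # gs) = Fword [g] + Fword gs"
    by (simp add: plus_fword_def)
  then have "Poly_Mapping.single (Fword (g # gs)) (1::'b) = fvar g * Poly_Mapping.single (Fword gs) 1"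
    by (simp add: fvar_def mult_single)
  then show ?case
    using Cons by simp
qed

lemma hull_words_in: "subalgebra hull (fvar ` G) = words_in G"
proof (rule hull_unique)
  show "fvar ` G \<subseteq> words_in G"
    by (auto simp: words_in_def fvar_def lookup_single when_def split: if_splits)
  show "subalgebra (words_in G)"
    by (rule words_in_subalgebra)
  fix T :: "('a, 'b) free_alg set"
  assume T: "fvar ` G \<subseteq> T" "subalgebra T"
  show "words_in G \<subseteq> T"
  proof
    fix x :: "('a, 'b) free_alg" assume x: "x \<in> words_in G"
    have prod: "set gs \<subseteq> G \<Longrightarrow> prod_list (map fvar gs) \<in> T" for gs
      using T by (induction gs) (auto simp: subalgebra_def)
    have "Poly_Mapping.single w c \<in> T" if "set (letters w) \<subseteq> G" for w c
    proof -
      have "Poly_Mapping.single w c = fscale c (prod_list (map fvar (letters w)))"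
        by (simp add: fscale_def fconst_def mult_single flip: single_Fword)
      then show ?thesis
        using prod[OF that] T(2) by (simp add: subalgebra_def falg.subspace_scale)
    qed
    then have "(\<Sum>w\<in>Poly_Mapping.keys x. Poly_Mapping.single w (Poly_Mapping.lookup x w)) \<in> T"
      using x T(2) by (intro falg.subspace_sum) (auto simp: subalgebra_def words_in_def in_keys_iff)
    then show "x \<in> T"
      by (simp flip: poly_mapping_expand)
  qed
qed

lemma alg_minus_eq: "alg_minus = (words_in (range GenF) :: ('i, 'k::field) qalg set)"
  and alg_plus_eq: "alg_plus = (words_in (range GenE) :: ('i, 'k) qalg set)"
  and alg_zero_eq: "alg_zero = (words_in (range GenK \<union> range GenL) :: ('i, 'k) qalg set)"
proof -
  have "range Fg = (fvar ` range GenF :: ('i, 'k::field) qalg set)" "range Eg = (fvar ` range GenE :: ('i, 'k) qalg set)"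
    "range Kg \<union> range Lg = (fvar ` (range GenK \<union> range GenL) :: ('i, 'k) qalg set)"
    by (auto simp: Fg_def Eg_def Kg_def Lg_def)
  then show "alg_minus = (words_in (range GenF) :: ('i, 'k) qalg set)" "alg_plus = (words_in (range GenE) :: ('i, 'k) qalg set)"
    "alg_zero = (words_in (range GenK \<union> range GenL) :: ('i, 'k) qalg set)"
    by (simp_all only: alg_minus_def alg_plus_def alg_zero_def hull_words_in)
qed

lemma prj_words_in: "x \<in> words_in G \<Longrightarrow> prj \<beta> x \<in> words_in G"
  by (auto simp: words_in_def lookup_prj)

lemma alg_zero_homog: "alg_zero \<subseteq> homog 0"
proof
  fix x :: "('i, 'k::field) qalg" assume x: "x \<in> alg_zero"
  have "set gs \<subseteq> range GenK \<union> range GenL \<Longrightarrow> sum_list (map gen_deg gs) = 0" for gs :: "'i gen list"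
    by (induction gs) auto
  then show "x \<in> homog 0"
    using x by (auto simp: alg_zero_eq words_in_def homog_iff gdeg_def)
qed

text \<open>Let a be a representative in words of G and z a homogeneous one. The degree \<beta> part
  of a differs from z by a projection of a - z, which stays in the graded J, and it has both
  properties.\<close>

lemma homog_representative:
  assumes J: "falg.subspace J" "graded J" and Y: "Y \<in> (words_in G + J) \<inter> (homog \<beta> + J)"
  obtains y where "y \<in> words_in G" "y \<in> homog \<beta>" "Y - y \<in> J"
proof -
  obtain a t where "Y = a + t" "a \<in> words_in G" "t \<in> J"
    using Y by (meson IntD1 set_plus_elim)
  moreover obtain z t' where "Y = z + t'" "z \<in> homog \<beta>" "t' \<in> J"
    using Y by (meson IntD2 set_plus_elim)
  ultimately have *: "Y = a + t" "Y = z + t'" "a \<in> words_in G" "z \<in> homog \<beta>" "t \<in> J" "t' \<in> J"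
    by simp_all
  have "a - z = t' - t"
    using *(1,2) by (simp add: algebra_simps)
  then have "a - z \<in> J"
    using falg.subspace_diff[OF J(1) *(6,5)] by simp
  then have "prj \<beta> (a - z) \<in> J"
    using J(2) by (simp add: graded_def)
  then have "prj \<beta> a - z \<in> J"
    by (simp add: prj_lin prj_eq[OF *(4)])
  then have "t' - (prj \<beta> a - z) \<in> J"
    by (rule falg.subspace_diff[OF J(1) *(6)])
  then have "Y - prj \<beta> a \<in> J"
    by (simp add: *(2) algebra_simps)
  then show ?thesis
    using that prj_words_in[OF *(3)] prj_homog by blast
qed

section \<open>The action of $U(\chi)$ on irreducible modules\<close>

text \<open>The values \<kappa> and \<mu> of the character on K and L undo the normalization of the
  operators. The factor \<mu> at F_i turns L_i - h_i K_i into the defining commutator, because \<mu>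
  h = \<kappa>.\<close>

fun gop :: "('i::finite, 'k::field) bichar \<Rightarrow> ('i \<Rightarrow> 'k) \<Rightarrow> ('i lattice \<Rightarrow> 'k) \<Rightarrow> ('i lattice \<Rightarrow> 'k) \<Rightarrow>
    'i gen \<Rightarrow> ('i list, 'k) lop" where
  "gop X h \<kappa> \<mu> (GenK \<alpha>) = lsc (\<kappa> \<alpha>) * Kop X \<alpha>"
| "gop X h \<kappa> \<mu> (GenL \<alpha>) = lsc (\<mu> \<alpha>) * Lop X \<alpha>"
| "gop X h \<kappa> \<mu> (GenE i) = eop i"
| "gop X h \<kappa> \<mu> (GenF i) = lsc (\<mu> (sroot i)) * fop X h i"

definition rho :: "('i::finite, 'k::field) bichar \<Rightarrow> ('i \<Rightarrow> 'k) \<Rightarrow> ('i lattice \<Rightarrow> 'k) \<Rightarrow> ('i lattice \<Rightarrow> 'k) \<Rightarrow>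
    ('i, 'k) qalg \<Rightarrow> ('i list, 'k) lop" where
  "rho X h \<kappa> \<mu> = feval lsc (gop X h \<kappa> \<mu>)"

lemma rho_simps:
  "rho X h \<kappa> \<mu> (x + y) = rho X h \<kappa> \<mu> x + rho X h \<kappa> \<mu> y"
  "rho X h \<kappa> \<mu> (x * y) = rho X h \<kappa> \<mu> x * rho X h \<kappa> \<mu> y"
  "rho X h \<kappa> \<mu> 0 = 0" "rho X h \<kappa> \<mu> 1 = 1" "rho X h \<kappa> \<mu> (fvar g) = gop X h \<kappa> \<mu> g"
  "rho X h \<kappa> \<mu> (fconst c) = lsc c" "rho X h \<kappa> \<mu> (fscale c x) = lsc c * rho X h \<kappa> \<mu> x"
  "rho X h \<kappa> \<mu> (Kg \<alpha>) = lsc (\<kappa> \<alpha>) * Kop X \<alpha>" "rho X h \<kappa> \<mu> (Lg \<alpha>) = lsc (\<mu> \<alpha>) * Lop X \<alpha>"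
  "rho X h \<kappa> \<mu> (Eg i) = eop i" "rho X h \<kappa> \<mu> (Fg i) = lsc (\<mu> (sroot i)) * fop X h i"
proof -
  note l = lsc_simps
  show m: "rho X h \<kappa> \<mu> (x * y) = rho X h \<kappa> \<mu> x * rho X h \<kappa> \<mu> y" for x y
    unfolding rho_def by (rule feval_mult) (rule l)+
  show "rho X h \<kappa> \<mu> (x + y) = rho X h \<kappa> \<mu> x + rho X h \<kappa> \<mu> y"
    unfolding rho_def by (rule feval_add) (rule l)+
  show "rho X h \<kappa> \<mu> 0 = 0" "rho X h \<kappa> \<mu> 1 = 1"
    by (simp_all add: rho_def feval_zero feval_one l(1,2))
  have f: "rho X h \<kappa> \<mu> (fvar g) = gop X h \<kappa> \<mu> g" for g
    by (simp add: rho_def feval_fvar l(1,2))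
  show c: "rho X h \<kappa> \<mu> (fconst c) = lsc c"
    by (simp add: rho_def feval_fconst l(1))
  show "rho X h \<kappa> \<mu> (fscale c x) = lsc c * rho X h \<kappa> \<mu> x"
    by (simp add: fscale_def m c)
  show "rho X h \<kappa> \<mu> (fvar g) = gop X h \<kappa> \<mu> g"
    "rho X h \<kappa> \<mu> (Kg \<alpha>) = lsc (\<kappa> \<alpha>) * Kop X \<alpha>" "rho X h \<kappa> \<mu> (Lg \<alpha>) = lsc (\<mu> \<alpha>) * Lop X \<alpha>"
    "rho X h \<kappa> \<mu> (Eg i) = eop i" "rho X h \<kappa> \<mu> (Fg i) = lsc (\<mu> (sroot i)) * fop X h i"
    by (simp_all add: Kg_def Lg_def Eg_def Fg_def f)
qed

lemma rho_diff: "rho X h \<kappa> \<mu> (x - y) = rho X h \<kappa> \<mu> x - rho X h \<kappa> \<mu> y"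
  using rho_simps(1)[of X h \<kappa> \<mu> "x - y" y] by (simp add: algebra_simps)

lemma rho_sum: "rho X h \<kappa> \<mu> (sum x S) = (\<Sum>s\<in>S. rho X h \<kappa> \<mu> (x s))"
  by (induction S rule: infinite_finite_induct) (simp_all add: rho_simps)

lemma rho_expand: "rho X h \<kappa> \<mu> x =
    (\<Sum>w\<in>Poly_Mapping.keys x. lsc (Poly_Mapping.lookup x w) * prod_list (map (gop X h \<kappa> \<mu>) (letters w)))"
  by (simp add: rho_def feval_def)

lemma hom_op_1: "hom_op 0 1"
  by (simp add: hom_op_def component_lin)

lemma hom_op_sum: "(\<And>s. s \<in> S \<Longrightarrow> hom_op \<beta> (T s)) \<Longrightarrow> hom_op \<beta> (sum T S)"
  by (induction S rule: infinite_finite_induct) (simp_all add: hom_op_def component_lin)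

text \<open>Functions are graded by the distance below the highest weight, hence the sign.\<close>

lemma hom_op_gop: "hom_op (- gen_deg g) (gop X h \<kappa> \<mu> g)"
  by (cases g) (simp_all add: hom_op_scale hom_op_Kop hom_op_Lop hom_op_eop hom_op_fop)

lemma hom_op_rho:
  assumes "x \<in> homog \<beta>"
  shows "hom_op (- \<beta>) (rho X h \<kappa> \<mu> x)"
proof -
  have *: "hom_op (- sum_list (map gen_deg gs)) (prod_list (map (gop X h \<kappa> \<mu>) gs))" for gs
  proof (induction gs)
    case (Cons g gs)
    then show ?case
      using hom_op_mult[OF hom_op_gop Cons, of g X h \<kappa> \<mu>] by (simp add: add.commute)
  qed (simp add: hom_op_1)
  show ?thesis
    unfolding rho_expand
  proof (intro hom_op_sum hom_op_scale)
    fix w assume "w \<in> Poly_Mapping.keys x"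
    then have "sum_list (map gen_deg (letters w)) = \<beta>"
      using assms by (simp add: homog_def)
    then show "hom_op (- \<beta>) (prod_list (map (gop X h \<kappa> \<mu>) (letters w)))"
      using *[of "letters w"] by simp
  qed
qed

section \<open>The endomorphism inducing the automorphism of the algebra\<close>

lemma Omega_mult: "Omega (x * y) = Omega x * Omega y"
  unfolding Omega_def by (rule feval_mult) (rule fconst_simps fconst_central)+

lemma Omega_fvar: "Omega (fvar g) = Omega_gen g"
  by (simp add: Omega_def feval_fvar)

lemma Omega_linear: "Omega (x + y) = Omega x + Omega y" "Omega 0 = 0" "Omega 1 = 1"
  "Omega (fscale c x) = fscale c (Omega x)"
proof -
  show "Omega (x + y) = Omega x + Omega y"
    unfolding Omega_def by (rule feval_add) (rule fconst_simps)+
  show "Omega 0 = 0" "Omega 1 = 1"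
    by (simp_all add: Omega_def feval_zero feval_one)
  show "Omega (fscale c x) = fscale c (Omega x)"
    unfolding fscale_def Omega_mult by (simp add: Omega_def feval_fconst)
qed

lemma Omega_generators: "Omega (Kg \<alpha>) = Kg (- \<alpha>)" "Omega (Lg \<alpha>) = Lg (- \<alpha>)"
  "Omega (Eg i) = Fg i * Lg (- sroot i)" "Omega (Fg i) = Kg (- sroot i) * Eg i"
  unfolding Kg_def[of \<alpha>] Lg_def[of \<alpha>] Eg_def[of i] Fg_def[of i] Omega_fvar
  by (simp_all add: Fg_def Eg_def)

lemmas Omega_simps = Omega_mult Omega_linear Omega_generators

lemma Omega_diff: "Omega (x - y) = Omega x - Omega y"
  using Omega_linear(1)[of "x - y" y] by (simp add: algebra_simps)

lemma Omega_sum: "Omega (sum x S) = (\<Sum>s\<in>S. Omega (x s))"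
  by (induction S rule: infinite_finite_induct) (simp_all add: Omega_simps)

lemma Omega_homog:
  assumes "x \<in> homog \<beta>"
  shows "Omega x \<in> homog (- \<beta>)"
proof -
  have gen: "Omega_gen g \<in> homog (- gen_deg g)" for g :: "'i gen"
    using homog_mult[OF generators_homog(4,2)] homog_mult[OF generators_homog(1,3)]
    by (cases g) (auto simp: generators_homog)
  have *: "prod_list (map Omega_gen gs) \<in> homog (- sum_list (map gen_deg gs))" for gs :: "'i gen list"
  proof (induction gs)
    case (Cons g gs)
    then show ?case
      using homog_mult[OF gen Cons, of g] by simp
  qed (simp add: generators_homog)
  show ?thesis
    unfolding Omega_def feval_def
  proof (rule falg.subspace_sum[OF homog_subspace])
    fix w assume "w \<in> Poly_Mapping.keys x"
    then have "sum_list (map gen_deg (letters w)) = \<beta>"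
      using assms by (simp add: homog_def)
    then show "fconst (Poly_Mapping.lookup x w) * prod_list (map Omega_gen (letters w)) \<in> homog (- \<beta>)"
      using *[of "letters w"] falg.subspace_scale[OF homog_subspace] by (auto simp: fscale_def)
  qed
qed

lemma Omega_prj: "prj \<beta> (Omega x) = Omega (prj (- \<beta>) x)"
proof -
  let ?D = "gdeg ` Poly_Mapping.keys x"
  have "prj \<beta> (Omega x) = (\<Sum>\<gamma>\<in>?D. prj \<beta> (Omega (prj \<gamma> x)))"
    by (subst sum_prj[of x]) (simp only: Omega_sum prj_sum)
  also have "\<dots> = (\<Sum>\<gamma>\<in>?D. Omega (prj (- \<beta>) (prj \<gamma> x)))"
  proof (rule sum.cong[OF refl])
    fix \<gamma>
    show "prj \<beta> (Omega (prj \<gamma> x)) = Omega (prj (- \<beta>) (prj \<gamma> x))"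
      using prj_eq[OF Omega_homog[OF prj_homog[of \<gamma> x]], of \<beta>] prj_eq[OF prj_homog[of \<gamma> x], of "- \<beta>"]
      by (auto simp: Omega_simps)
  qed
  also have "\<dots> = Omega (prj (- \<beta>) x)"
    by (subst (2) sum_prj[of x]) (simp only: Omega_sum prj_sum)
  finally show ?thesis .
qed

section \<open>The ideals dividing the large algebra down to U(\<chi>)\<close>

lemma It_minus_deg_unfold:
  "It_minus_deg X 0 = Ut_ideal X"
  "\<alpha> \<noteq> 0 \<Longrightarrow> 0 \<le> \<alpha> \<Longrightarrow> It_minus_deg X \<alpha> = {Y \<in> Ut_minus_deg X (- \<alpha>). \<forall>i. 0 \<le> \<alpha> - sroot i \<longrightarrow>
     Eg i * Y - Y * Eg i \<in> It_minus_deg X (\<alpha> - sroot i) * {Kg (sroot i)}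
       + It_minus_deg X (\<alpha> - sroot i) * {Lg (sroot i)} + Ut_ideal X}"
  "\<not> 0 \<le> \<alpha> \<Longrightarrow> It_minus_deg X \<alpha> = {}"
  using It_minus_deg.simps[of X 0] It_minus_deg.simps[of X \<alpha>] by auto

lemma It_representative:
  assumes "Y \<in> It_minus_deg X \<alpha>"
  obtains y where "y \<in> words_in (range GenF)" "y \<in> homog (- \<alpha>)" "Y - y \<in> Ut_ideal X"
proof (cases "\<alpha> = 0")
  case True
  have "0 \<in> words_in (range GenF)"
    using words_in_subalgebra falg.subspace_0 unfolding subalgebra_def by blast
  then show ?thesis
    by (rule that[of 0])
      (use assms True falg.subspace_0[OF homog_subspace] in \<open>auto simp: It_minus_deg_unfold\<close>)
next
  case False
  then have "0 \<le> \<alpha>"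
    using assms It_minus_deg_unfold(3) by blast
  then have "Y \<in> (words_in (range GenF) + Ut_ideal X) \<inter> (homog (- \<alpha>) + Ut_ideal X)"
    using assms False by (auto simp: It_minus_deg_unfold Ut_minus_deg_def alg_minus_eq)
  then show ?thesis
    by (rule homog_representative[OF Ut_ideal_subspace Ut_ideal_graded]) (rule that)
qed

lemma commutator_F_word:
  assumes "\<And>g. g \<in> set gs \<Longrightarrow> g \<in> range GenF - {GenF i}"
  shows "Eg i * prod_list (map fvar gs) - prod_list (map fvar gs) * Eg i \<in> Ut_ideal X"
  using assms
proof (induction gs)
  case (Cons g gs)
  let ?P = "prod_list (map fvar gs)"
  obtain j where g: "g = GenF j" "j \<noteq> i"
    using Cons.prems[of g] by auto
  have "(Eg i * Fg j - Fg j * Eg i) * ?P + Fg j * (Eg i * ?P - ?P * Eg i) \<in> Ut_ideal X"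
  proof (rule falg.subspace_add[OF Ut_ideal_subspace Ut_ideal_mult(2) Ut_ideal_mult(1)])
    show "Eg i * Fg j - Fg j * Eg i \<in> Ut_ideal X"
      using Ut_ideal_relator[OF Ut_relators.intros(10)[of i j X]] g by simp
    show "Eg i * ?P - ?P * Eg i \<in> Ut_ideal X"
      using Cons by simp
  qed
  then show ?case
    by (simp add: g Fg_def algebra_simps)
qed (simp add: falg.subspace_0[OF Ut_ideal_subspace])

text \<open>The definition imposes a condition only when \<alpha> - \<alpha>_i is nonnegative. For
  the remaining i the coefficient of \<alpha> at i is 0, so no word of a homogeneous representative
  contains F_i and E_i commutes with it.\<close>

lemma It_commutator:
  assumes Y: "Y \<in> It_minus_deg X \<alpha>" and "\<alpha> \<noteq> 0"
  shows "0 \<le> \<alpha> - sroot i \<and> Eg i * Y - Y * Eg i \<in> It_minus_deg X (\<alpha> - sroot i) * {Kg (sroot i)}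
       + It_minus_deg X (\<alpha> - sroot i) * {Lg (sroot i)} + Ut_ideal X
    \<or> Eg i * Y - Y * Eg i \<in> Ut_ideal X"
proof (cases "0 \<le> \<alpha> - sroot i")
  case True
  moreover have "0 \<le> \<alpha>"
    using Y It_minus_deg_unfold(3) by blast
  ultimately show ?thesis
    using assms by (auto simp: It_minus_deg_unfold)
next
  case False
  have \<alpha>: "0 \<le> \<alpha>"
    using Y It_minus_deg_unfold(3) by blast
  have "\<alpha> i = 0"
  proof (rule ccontr)
    assume "\<alpha> i \<noteq> 0"
    then have "1 \<le> \<alpha> i"
      using \<alpha> by (metis le_fun_def zero_fun_apply int_one_le_iff_zero_less order_less_le)
    then show False
      using False \<alpha> by (auto simp: le_fun_def sroot_def zero_fun_apply minus_apply split: if_splits)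
  qed
  obtain y where y: "y \<in> words_in (range GenF)" "y \<in> homog (- \<alpha>)" "Y - y \<in> Ut_ideal X"
    using It_representative[OF Y] .
  have "Eg i * y - y * Eg i \<in> Ut_ideal X"
  proof -
    have word: "Eg i * Poly_Mapping.single w c - Poly_Mapping.single w c * Eg i \<in> Ut_ideal X"
      if "w \<in> Poly_Mapping.keys y" for w c
    proof -
      have letters: "set (letters w) \<subseteq> range GenF" and deg: "gdeg w = - \<alpha>"
        using that y(1,2) by (auto simp: words_in_def homog_iff in_keys_iff)
      have "set gs \<subseteq> range GenF \<Longrightarrow> GenF i \<in> set gs \<Longrightarrow> sum_list (map gen_deg gs) i < 0" for gs
      proof (induction gs)
        case (Cons g gs)
        have *: "sum_list (map gen_deg gs) i \<le> 0" if "set gs \<subseteq> range GenF" for gs :: "'a gen list"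
          using that by (induction gs) (auto simp: plus_fun_apply uminus_apply zero_fun_apply sroot_def)
        show ?case
          using Cons *[of gs] by (auto simp: plus_fun_apply uminus_apply sroot_def)
      qed simp
      then have "GenF i \<notin> set (letters w)"
        using letters deg \<open>\<alpha> i = 0\<close> by (metis gdeg_def less_irrefl neg_0_equal_iff_equal uminus_apply)
      then have "fscale c (Eg i * prod_list (map fvar (letters w)) - prod_list (map fvar (letters w)) * Eg i) \<in> Ut_ideal X"
        using letters by (intro falg.subspace_scale Ut_ideal_subspace commutator_F_word) auto
      moreover have "Poly_Mapping.single w c = fscale c (prod_list (map fvar (letters w)))"
        by (simp add: fscale_def fconst_def mult_single flip: single_Fword)
      ultimately show ?thesis
        by (simp add: fscale_mult falg.scale_right_diff_distrib)
    qed
    have "(\<Sum>w\<in>Poly_Mapping.keys y. Eg i * Poly_Mapping.single w (Poly_Mapping.lookup y w)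
        - Poly_Mapping.single w (Poly_Mapping.lookup y w) * Eg i) \<in> Ut_ideal X"
      by (intro falg.subspace_sum Ut_ideal_subspace word)
    then show ?thesis
      by (simp add: sum_subtractf flip: sum_distrib_left sum_distrib_right poly_mapping_expand)
  qed
  moreover have "Eg i * (Y - y) - (Y - y) * Eg i \<in> Ut_ideal X"
    by (rule falg.subspace_diff[OF Ut_ideal_subspace Ut_ideal_mult(1)[OF y(3)] Ut_ideal_mult(2)[OF y(3)]])
  ultimately have "(Eg i * y - y * Eg i) + (Eg i * (Y - y) - (Y - y) * Eg i) \<in> Ut_ideal X"
    by (rule falg.subspace_add[OF Ut_ideal_subspace])
  then show ?thesis
    by (simp add: algebra_simps)
qed

lemma Jt_minus_subspace: "falg.subspace (Jt_minus X)"
  unfolding Jt_minus_def by (intro subspace_plus falg.subspace_span Ut_ideal_subspace)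

lemma Ut_ideal_le_Jt_minus: "Ut_ideal X \<subseteq> Jt_minus X"
  unfolding Jt_minus_def by (rule set_zero_plus2[OF falg.span_zero])

lemma Jt_minus_product: "Y \<in> It_minus_deg X \<alpha> \<Longrightarrow> z \<in> alg_zero \<Longrightarrow> p \<in> alg_plus \<Longrightarrow> Y * z * p \<in> Jt_minus X"
proof -
  assume Y: "Y \<in> It_minus_deg X \<alpha>" "z \<in> alg_zero" "p \<in> alg_plus"
  then have "0 \<le> \<alpha>"
    using It_minus_deg_unfold(3) by blast
  then have "Y \<in> It_minus X"
    unfolding It_minus_def using Y by (intro falg.span_base) auto
  then have "Y * z * p \<in> It_minus X * alg_zero * alg_plus"
    using Y by (intro set_times_intro)
  then have "Y * z * p + 0 \<in> Jt_minus X"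
    unfolding Jt_minus_def
    by (intro set_plus_intro falg.span_base falg.subspace_0[OF Ut_ideal_subspace])
  then show ?thesis by simp
qed

lemma Jt_minus_induct:
  assumes x: "x \<in> Jt_minus X" and V: "falg.subspace V"
    and Ut: "\<And>t. t \<in> Ut_ideal X \<Longrightarrow> t \<in> V"
    and prod: "\<And>Y z p \<alpha>. Y \<in> It_minus_deg X \<alpha> \<Longrightarrow> z \<in> alg_zero \<Longrightarrow> p \<in> alg_plus \<Longrightarrow> Y * z * p \<in> V"
  shows "x \<in> V"
proof -
  have prod': "Y * z * p \<in> V" if "Y \<in> It_minus X" "z \<in> alg_zero" "p \<in> alg_plus" for Y z p
    using that(1) unfolding It_minus_def
  proof (induction rule: falg.span_induct_alt)
    case base
    show ?case using falg.subspace_0[OF V] by simp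
  next
    case (step c Y Y')
    then have "fscale c (Y * z * p) + Y' * z * p \<in> V"
      using prod that by (intro falg.subspace_add[OF V] falg.subspace_scale[OF V]) auto
    then show ?case
      by (simp add: distrib_right fscale_mult)
  qed
  then have "It_minus X * alg_zero * alg_plus \<subseteq> V"
    by (auto elim!: set_times_elim)
  then have "falg.span (It_minus X * alg_zero * alg_plus) \<subseteq> V"
    by (rule falg.span_minimal[OF _ V])
  then show ?thesis
    using x Ut unfolding Jt_minus_def by (auto elim!: set_plus_elim intro: falg.subspace_add[OF V])
qed

lemma Jt_minus_graded: "graded (Jt_minus X)"
  unfolding graded_def
proof (intro ballI allI)
  fix x \<beta> assume "x \<in> Jt_minus X"
  then have "x \<in> {x. prj \<beta> x \<in> Jt_minus X}"
  proof (rule Jt_minus_induct)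
    show "falg.subspace {x. prj \<beta> x \<in> Jt_minus X}"
      using Jt_minus_subspace[of X]
      by (intro falg.subspaceI) (auto simp: prj_lin falg.subspace_0 falg.subspace_add falg.subspace_scale)
    show "t \<in> {x. prj \<beta> x \<in> Jt_minus X}" if "t \<in> Ut_ideal X" for t
      using that Ut_ideal_graded[of X] Ut_ideal_le_Jt_minus[of X] by (auto simp: graded_def)
    show "Y * z * p \<in> {x. prj \<beta> x \<in> Jt_minus X}"
      if Y: "Y \<in> It_minus_deg X \<alpha>" and z: "z \<in> alg_zero" and p: "p \<in> alg_plus" for Y z p \<alpha>
    proof -
      obtain y where y: "y \<in> homog (- \<alpha>)" "Y - y \<in> Ut_ideal X"
        using It_representative[OF Y] .
      have z': "z \<in> homog 0"
        using z alg_zero_homog by blast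
      define p' where "p' = prj (\<beta> + \<alpha>) p"
      have p': "p' \<in> alg_plus"
        using p by (simp add: p'_def alg_plus_eq prj_words_in)
      \<comment> \<open>Y is homogeneous only modulo the relations. The projection is computed with
        the representative y, and both correction terms lie in \<open>Ut_ideal X\<close>.\<close>
      have "prj \<beta> (Y * z * p) = prj \<beta> (y * z * p) + prj \<beta> ((Y - y) * z * p)"
        by (simp add: left_diff_distrib prj_lin)
      also have "prj \<beta> (y * z * p) = Y * z * p' - (Y - y) * z * p'"
        using prj_mult_homog[OF homog_mult[OF y(1) z'], of \<beta> p] by (simp add: p'_def left_diff_distrib)
      finally have "prj \<beta> (Y * z * p) = Y * z * p' - (Y - y) * z * p' + prj \<beta> ((Y - y) * z * p)" .
      moreover have "(Y - y) * z * p' \<in> Ut_ideal X" "prj \<beta> ((Y - y) * z * p) \<in> Ut_ideal X"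
        using y(2) Ut_ideal_graded[of X] by (auto simp: graded_def Ut_ideal_mult)
      ultimately show ?thesis
        using Ut_ideal_le_Jt_minus[of X] Jt_minus_product[OF Y z p']
        by (auto intro!: falg.subspace_add[OF Jt_minus_subspace] falg.subspace_diff[OF Jt_minus_subspace])
    qed
  qed
  then show "prj \<beta> x \<in> Jt_minus X" by simp
qed

lemma Omega_image_subspace: "falg.subspace S \<Longrightarrow> falg.subspace (Omega ` S)"
proof (rule falg.subspaceI)
  assume S: "falg.subspace S"
  show "0 \<in> Omega ` S"
    using falg.subspace_0[OF S] by (metis Omega_linear(2) imageI)
  show "x + y \<in> Omega ` S" if "x \<in> Omega ` S" "y \<in> Omega ` S" for x y
    using that falg.subspace_add[OF S] by (auto simp flip: Omega_linear)
  show "fscale c x \<in> Omega ` S" if "x \<in> Omega ` S" for c x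
    using that falg.subspace_scale[OF S] by (auto simp flip: Omega_linear)
qed

lemma U_ideal_subspace: "falg.subspace (U_ideal X)"
  unfolding U_ideal_def
  by (intro subspace_plus Omega_image_subspace Jt_minus_subspace Ut_ideal_subspace)

lemma U_ideal_graded: "graded (U_ideal X)"
proof -
  have "graded (Omega ` Jt_minus X)"
    using Jt_minus_graded[of X] by (auto simp: graded_def Omega_prj)
  then show ?thesis
    unfolding U_ideal_def by (intro graded_plus Jt_minus_graded Ut_ideal_graded)
qed

lemma Ut_ideal_le_U_ideal: "Ut_ideal X \<subseteq> U_ideal X"
proof
  fix x assume "x \<in> Ut_ideal X"
  moreover have "0 \<in> Jt_minus X" "0 \<in> Omega ` Jt_minus X"
    using falg.subspace_0[OF Jt_minus_subspace] falg.subspace_0[OF Omega_image_subspace[OF Jt_minus_subspace]] by auto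
  ultimately have "0 + 0 + x \<in> U_ideal X"
    unfolding U_ideal_def by (intro set_plus_intro)
  then show "x \<in> U_ideal X" by simp
qed

lemma app_sum_left: "app (sum T W) g = (\<Sum>w\<in>W. app (T w) g)"
  by (induction W rule: infinite_finite_induct) simp_all

lemma sum_apply: "sum x W w = (\<Sum>v\<in>W. x v w)" for x :: "'v \<Rightarrow> 'w \<Rightarrow> 'k::field"
  by (induction W rule: infinite_finite_induct) (simp_all add: pointwise)

locale character = hw X h for X :: "('i::finite, 'k::field) bichar" and h :: "'i \<Rightarrow> 'k" +
  fixes \<kappa> \<mu> :: "'i lattice \<Rightarrow> 'k"
  assumes \<kappa>: "\<And>\<alpha> \<beta>. \<kappa> (\<alpha> + \<beta>) = \<kappa> \<alpha> * \<kappa> \<beta>" "\<And>\<alpha>. \<kappa> \<alpha> \<noteq> 0"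
    and \<mu>: "\<And>\<alpha> \<beta>. \<mu> (\<alpha> + \<beta>) = \<mu> \<alpha> * \<mu> \<beta>" "\<And>\<alpha>. \<mu> \<alpha> \<noteq> 0"
    and ratio: "\<And>i. h i = \<kappa> (sroot i) / \<mu> (sroot i)"
begin

abbreviation "\<rho> \<equiv> rho X h \<kappa> \<mu>"

abbreviation "L \<equiv> Lmod X h"

lemma character_0: "\<kappa> 0 = 1" "\<mu> 0 = 1"
  using \<kappa>(1)[of 0 0] \<mu>(1)[of 0 0] \<kappa>(2)[of 0] \<mu>(2)[of 0] by simp_all

lemma rho_generators: "\<rho> (fscale c x) = c \<odot> \<rho> x" "\<rho> (Kg \<alpha>) = \<kappa> \<alpha> \<odot> Kop X \<alpha>" "\<rho> (Lg \<alpha>) = \<mu> \<alpha> \<odot> Lop X \<alpha>"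
  "\<rho> (Eg i) = eop i" "\<rho> (Fg i) = \<mu> (sroot i) \<odot> fop X h i"
  by (simp_all add: rho_simps sm_lsc)

lemmas rho_sm = rho_diff rho_simps(1-4) rho_generators

lemma ef_sm: "eop i * fop X h i = fop X h i * eop i + (Lop X (sroot i) - h i \<odot> Kop X (sroot i))"
  "i \<noteq> j \<Longrightarrow> eop i * fop X h j = fop X h j * eop i"
  using ef'(1)[of i] ef'(2)[of i j] by (simp_all add: commutator_def algebra_simps)

lemma ratio': "\<mu> (sroot i) * h i = \<kappa> (sroot i)"
  using \<mu>(2) by (simp add: ratio)

lemma rho_Ut_relators: "r \<in> Ut_relators X \<Longrightarrow> \<rho> r = 0"
proof (induction rule: Ut_relators.induct)
  case (10 i j)
  show ?case
    by (cases "i = j") (simp_all add: rho_sm ef_sm distrib_left right_diff_distrib ratio')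
qed (simp_all add: rho_sm K_L character_0 \<kappa> \<mu> Ke' Le' Kf' Lf' bihom_simps[OF X] mult.assoc mult_ac)

lemma lop_Ut_zero:
  assumes "x \<in> Ut_ideal X"
  shows "\<rho> x = 0"
proof -
  have "falg.subspace {x. \<rho> x = 0}"
    by (rule falg.subspaceI) (auto simp: rho_simps)
  then have "Ut_ideal X \<subseteq> {x. \<rho> x = 0}"
    unfolding Ut_ideal_def ideal_gen_def
    by (intro falg.span_minimal) (auto simp: rho_simps rho_Ut_relators)
  with assms show ?thesis by blast
qed

lemma gop_Lmod: "g \<in> L \<Longrightarrow> app (gop X h \<kappa> \<mu> a) g \<in> L"
  by (cases a) (auto intro!: fnv.subspace_scale[OF Lmod_subspace] Kop_Lmod Lop_Lmod eop_Lmod fop_Lmod)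

lemma rho_Lmod: "g \<in> L \<Longrightarrow> app (\<rho> x) g \<in> L"
proof -
  assume g: "g \<in> L"
  have *: "app (prod_list (map (gop X h \<kappa> \<mu>) gs)) g \<in> L" for gs
    by (induction gs) (simp_all add: g gop_Lmod)
  have "(\<Sum>w\<in>W. app (lsc (c w) * prod_list (map (gop X h \<kappa> \<mu>) (letters w))) g) \<in> L" for W c
    by (intro fnv.subspace_sum[OF Lmod_subspace]) (simp add: fnv.subspace_scale[OF Lmod_subspace] *)
  then show ?thesis
    unfolding rho_expand app_sum_left .
qed

lemma F_words_Nil:
  assumes "y \<in> words_in (range GenF)" "y \<in> homog (- \<alpha>)" "\<alpha> \<noteq> 0"
  shows "app (\<rho> y) g [] = 0"
proof -
  have word: "app (prod_list (map (gop X h \<kappa> \<mu>) (letters w))) g [] = 0" if w: "w \<in> Poly_Mapping.keys y" for w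
  proof (cases "letters w")
    case Nil
    have "gdeg w = - \<alpha>"
      using assms(2) w by (simp add: homog_iff in_keys_iff)
    then show ?thesis
      using Nil assms(3) by (simp add: gdeg_def)
  next
    case (Cons a gs)
    then have "a \<in> range GenF"
      using assms(1) w by (auto simp: words_in_def in_keys_iff)
    then show ?thesis
      using Cons by (auto simp: app_fop fnscale_apply)
  qed
  then show ?thesis
    unfolding rho_expand app_sum_left by (simp add: sum_apply fnscale_apply)
qed

text \<open>For nonzero degree, a representative consists of words starting with some F_i, so there
  is no vacuum coefficient. The commutators with E_i are built from elements of smaller height, zero
  by induction, and \<open>lop_eq_0I\<close> applies on all functions.\<close>

lemma rho_It: "Y \<in> It_minus_deg X \<alpha> \<Longrightarrow> \<rho> Y = 0"
proof (induction "nat (height \<alpha>)" arbitrary: Y \<alpha> rule: less_induct)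
  case less
  obtain y where y: "y \<in> words_in (range GenF)" "y \<in> homog (- \<alpha>)" "Y - y \<in> Ut_ideal X"
    using It_representative[OF less.prems] .
  have Yy: "\<rho> Y = \<rho> y"
    using lop_Ut_zero[OF y(3)] by (simp add: rho_diff)
  show ?case
  proof (cases "\<alpha> = 0")
    case True
    then show ?thesis
      using less.prems by (simp add: It_minus_deg_unfold lop_Ut_zero)
  next
    case False
    show ?thesis
    proof (rule lop_eq_0I)
      show "app (\<rho> Y) g [] = 0" for g
        unfolding Yy by (rule F_words_Nil[OF y(1,2) False])
      fix i
      have "commutator (eop i) (\<rho> Y) = \<rho> (Eg i * Y - Y * Eg i)"
        by (simp add: commutator_def rho_diff rho_simps)
      also have "\<dots> = 0"
        using It_commutator[OF less.prems False, of i]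
      proof
        assume *: "0 \<le> \<alpha> - sroot i \<and> Eg i * Y - Y * Eg i \<in> It_minus_deg X (\<alpha> - sroot i) * {Kg (sroot i)}
          + It_minus_deg X (\<alpha> - sroot i) * {Lg (sroot i)} + Ut_ideal X"
        then have "0 \<le> height (\<alpha> - sroot i)"
          unfolding height_def by (intro sum_nonneg) (simp add: le_fun_def zero_fun_apply)
        then have "nat (height (\<alpha> - sroot i)) < nat (height \<alpha>)"
          by simp
        then have "\<rho> Y' = 0" if "Y' \<in> It_minus_deg X (\<alpha> - sroot i)" for Y'
          using less.hyps that by blast
        then show "\<rho> (Eg i * Y - Y * Eg i) = 0"
          using conjunct2[OF *] by (auto elim!: set_plus_elim set_times_elim simp: rho_simps lop_Ut_zero)
      qed (rule lop_Ut_zero)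
      finally show "commutator (eop i) (\<rho> Y) = 0" .
    qed
  qed
qed

lemma Kop_inverse: "Kop X \<alpha> * Kop X (- \<alpha>) = 1" "Kop X (- \<alpha>) * Kop X \<alpha> = 1"
  and Lop_inverse: "Lop X \<alpha> * Lop X (- \<alpha>) = 1" "Lop X (- \<alpha>) * Lop X \<alpha> = 1"
  by (simp_all add: K_L(1,2) flip: K_L(3,4))

lemma character_inverse: "\<kappa> (- \<alpha>) * \<kappa> \<alpha> = 1" "\<mu> (- \<alpha>) * \<mu> \<alpha> = 1"
  using character_0 \<kappa>(1)[of "- \<alpha>" \<alpha>] \<mu>(1)[of "- \<alpha>" \<alpha>] by simp_all

lemma KL_commute: "Kop X \<alpha> * Kop X \<beta> = Kop X \<beta> * Kop X \<alpha>" "Lop X \<alpha> * Lop X \<beta> = Lop X \<beta> * Lop X \<alpha>"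
  by (simp_all add: add.commute flip: K_L(3,4))

lemma KL_neg: "Kop X (- \<alpha> - \<beta>) = Kop X (- \<alpha>) * Kop X (- \<beta>)" "Lop X (- \<alpha> - \<beta>) = Lop X (- \<alpha>) * Lop X (- \<beta>)"
  "\<kappa> (- \<alpha> - \<beta>) = \<kappa> (- \<alpha>) * \<kappa> (- \<beta>)" "\<mu> (- \<alpha> - \<beta>) = \<mu> (- \<alpha>) * \<mu> (- \<beta>)"
  using K_L(3,4)[of "- \<alpha>" "- \<beta>"] \<kappa>(1)[of "- \<alpha>" "- \<beta>"] \<mu>(1)[of "- \<alpha>" "- \<beta>"] by simp_all

text \<open>For the annihilation of the ideal it suffices that images of relations under
  \<open>Omega\<close> act by zero, so the check takes place among operators instead of in the free
  algebra.\<close>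

lemma rho_Omega_relators: "r \<in> Ut_relators X \<Longrightarrow> \<rho> (Omega r) = 0"
proof (induction rule: Ut_relators.induct)
  case (10 i j)
  let ?L = "Lop X (- sroot i)" and ?K = "Kop X (- sroot j)" and ?c = "\<mu> (sroot i) * (\<mu> (- sroot i) * \<kappa> (- sroot j))"
  have "\<rho> (Omega (Eg i * Fg j - Fg j * Eg i)) =
      ?c \<odot> (fop X h i * ?L * (?K * eop j) - ?K * eop j * (fop X h i * ?L))"
    by (simp add: Omega_simps Omega_diff rho_sm mult_ac mult.assoc)
  also have "fop X h i * ?L * (?K * eop j) = (fop X h i * ?K) * (?L * eop j)"
    by (simp add: mult.assoc) (simp add: K_L(5) flip: mult.assoc)
  also have "\<dots> = (X (sroot j) (sroot i) \<odot> (fop X h i * ?K)) * eop j * ?L"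
    by (simp add: Le' bihom_simps[OF X] mult.assoc)
  also have "X (sroot j) (sroot i) \<odot> (fop X h i * ?K) = ?K * fop X h i"
    by (simp add: Kf' bihom_simps[OF X])
  also have "?K * fop X h i * eop j * ?L - ?K * eop j * (fop X h i * ?L) = - (?K * commutator (eop j) (fop X h i) * ?L)"
    by (simp add: commutator_def algebra_simps)
  finally have eq: "\<rho> (Omega (Eg i * Fg j - Fg j * Eg i)) = ?c \<odot> (- (?K * commutator (eop j) (fop X h i) * ?L))" .
  show ?case
  proof (cases "i = j")
    case True
    have "?K * commutator (eop j) (fop X h i) * ?L = ?K - h i \<odot> ?L"
      unfolding True ef'(1) by (simp add: right_diff_distrib left_diff_distrib Kop_inverse Lop_inverse mult.assoc)
    moreover have c: "?c = \<kappa> (- sroot i)"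
      using True character_inverse(2)[of "sroot i"] by (simp add: mult_ac)
    moreover have "\<kappa> (- sroot i) * h i = \<mu> (- sroot i)"
      using character_inverse(1)[of "sroot i"] character_inverse(2)[of "sroot i"] ratio'[of i]
      by (metis mult.assoc mult.commute mult.right_neutral)
    ultimately have f1: "\<rho> (Omega (Eg i * Fg j - Fg j * Eg i)) = \<mu> (- sroot i) \<odot> ?L - \<kappa> (- sroot i) \<odot> ?K"
      using eq by (simp only: sm_simps) simp
    have f2: "\<rho> (Omega (- Kg (sroot i) + Lg (sroot i))) = \<mu> (- sroot i) \<odot> ?L - \<kappa> (- sroot i) \<odot> ?K"
      using True by (simp add: Omega_linear Omega_diff Omega_generators rho_sm)
    have "\<rho> (Omega (a - b)) = \<rho> (Omega a) - \<rho> (Omega b)" for a b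
      by (simp add: Omega_diff rho_diff)
    from this[of "Eg i * Fg j - Fg j * Eg i" "- Kg (sroot i) + Lg (sroot i)"] show ?thesis
      unfolding f1 f2 using True by (simp only: if_True) simp
  next
    case False
    then show ?thesis
      using eq ef'(2)[of j i] by (simp add: Omega_diff Omega_linear rho_sm)
  qed
qed (simp_all add: Omega_diff Omega_simps rho_sm K_L(1,2,5) KL_commute KL_neg character_0 Ke' Le' Kf' Lf'
    left_commute[OF Ke'] left_commute[OF Le'] left_commute[OF Kf'] left_commute[OF Lf'] bihom_simps[OF X] mult.assoc mult_ac)

lemma rho_Omega_Ut: "x \<in> Ut_ideal X \<Longrightarrow> \<rho> (Omega x) = 0"
proof -
  have "falg.subspace {x. \<rho> (Omega x) = 0}"
    by (rule falg.subspaceI) (auto simp: rho_simps Omega_linear)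
  then have "Ut_ideal X \<subseteq> {x. \<rho> (Omega x) = 0}"
    unfolding Ut_ideal_def ideal_gen_def
    by (intro falg.span_minimal) (auto simp: rho_simps Omega_mult rho_Omega_relators)
  then show "x \<in> Ut_ideal X \<Longrightarrow> ?thesis" by blast
qed

text \<open>The mirror image of \<open>rho_It\<close>. In nonzero degree \<open>Omega Y\<close>
  raises, and it kills \<open>vac\<close> because no word has degree -\<alpha>. As
  \<open>Omega (Eg i)\<close> acts as F_i times an invertible diagonal operator, the vanishing
  propagates along \<open>fword\<close>, but only through \<open>Lmod\<close>.\<close>

lemma rho_Omega_It: "Y \<in> It_minus_deg X \<alpha> \<Longrightarrow> g \<in> L \<Longrightarrow> app (\<rho> (Omega Y)) g = 0"
proof (induction "nat (height \<alpha>)" arbitrary: Y \<alpha> g rule: less_induct)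
  case less
  obtain y where y: "y \<in> words_in (range GenF)" "y \<in> homog (- \<alpha>)" "Y - y \<in> Ut_ideal X"
    using It_representative[OF less.prems(1)] .
  have Yy: "\<rho> (Omega Y) = \<rho> (Omega y)"
    using rho_Omega_Ut[OF y(3)] by (simp add: rho_diff Omega_diff)
  show ?case
  proof (cases "\<alpha> = 0")
    case True
    then show ?thesis
      using less.prems by (simp add: It_minus_deg_unfold rho_Omega_Ut)
  next
    case False
    have comm: "app (commutator (\<rho> (Omega (Eg i))) (\<rho> (Omega Y))) g = 0" if g: "g \<in> L" for i g
    proof -
      have "commutator (\<rho> (Omega (Eg i))) (\<rho> (Omega Y)) = \<rho> (Omega (Eg i * Y - Y * Eg i))"
        by (simp add: commutator_def rho_diff rho_simps(2) Omega_diff Omega_mult)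
      moreover have "app (\<rho> (Omega (Eg i * Y - Y * Eg i))) g = 0"
        using It_commutator[OF less.prems(1) False, of i]
      proof
        assume *: "0 \<le> \<alpha> - sroot i \<and> Eg i * Y - Y * Eg i \<in> It_minus_deg X (\<alpha> - sroot i) * {Kg (sroot i)}
          + It_minus_deg X (\<alpha> - sroot i) * {Lg (sroot i)} + Ut_ideal X"
        then have "0 \<le> height (\<alpha> - sroot i)"
          unfolding height_def by (intro sum_nonneg) (simp add: le_fun_def zero_fun_apply)
        then have "nat (height (\<alpha> - sroot i)) < nat (height \<alpha>)"
          by simp
        then have "app (\<rho> (Omega Y')) g = 0" if "Y' \<in> It_minus_deg X (\<alpha> - sroot i)" "g \<in> L" for Y' g
          using less.hyps that by blast
        moreover obtain a b t where abt: "Eg i * Y - Y * Eg i = a * Kg (sroot i) + b * Lg (sroot i) + t"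
          "a \<in> It_minus_deg X (\<alpha> - sroot i)" "b \<in> It_minus_deg X (\<alpha> - sroot i)" "t \<in> Ut_ideal X"
          using conjunct2[OF *] by (auto elim!: set_plus_elim set_times_elim)
        ultimately show ?thesis
          using rho_Lmod[OF g] by (simp add: Omega_linear Omega_mult rho_simps(1,2) rho_Omega_Ut)
      qed (simp add: rho_Omega_Ut)
      ultimately show ?thesis by simp
    qed
    have "app (\<rho> (Omega Y)) (fword X h u) = 0" for u
    proof (induction u)
      case Nil
      have "app (\<rho> (Omega y)) vac \<in> hom_space (0 - \<alpha>)"
        using hom_op_hom[OF hom_op_rho[OF Omega_homog[OF y(2)]] vac_hom] by simp
      moreover have "0 \<le> \<alpha>"
        using less.prems(1) It_minus_deg_unfold(3) by blast
      then have "wdeg w \<noteq> - \<alpha>" for w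
        using wdeg_nonneg[of w] False by (metis add.inverse_inverse antisym neg_0_le_iff_le neg_le_0_iff_le)
      ultimately have "app (\<rho> (Omega y)) vac w = 0" for w
        unfolding hom_space_def by force
      then have "app (\<rho> (Omega y)) vac = 0"
        by (simp add: fun_eq_iff zero_fun_apply)
      then show ?case by (simp add: Yy)
    next
      case (Cons i u)
      define c where "c = X (wdeg u) (- sroot i)"
      have c: "c \<noteq> 0"
        by (simp add: c_def bihom_simps[OF X])
      have T: "app (\<rho> (Omega (Eg i))) (fword X h u) = fnscale c (fword X h (i # u))"
        using character_inverse(2)[of "sroot i"]
        by (simp add: Omega_generators rho_sm app_Lop_hom[OF fword_hom] c_def mult_ac)
      have "app (commutator (\<rho> (Omega (Eg i))) (\<rho> (Omega Y))) (fword X h u) = 0"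
        by (rule comm[OF fword_in_Lmod])
      then have "fnscale c (app (\<rho> (Omega Y)) (fword X h (i # u))) = 0"
        using Cons by (simp only: commutator_def app_simps T app_lin app_zero) simp
      then show ?case
        using c by simp
    qed
    with less.prems(2) show ?thesis
      by (induction rule: Lmod_induct) simp_all
  qed
qed

lemma U_ideal_annihilates:
  assumes "x \<in> U_ideal X" "g \<in> L"
  shows "app (\<rho> x) g = 0"
proof -
  have 1: "app (\<rho> x) g = 0" if x: "x \<in> Jt_minus X" and g: "g \<in> L" for x g
  proof -
    have "x \<in> {x. app (\<rho> x) g = 0}"
      using x by (rule Jt_minus_induct)
        (auto intro!: falg.subspaceI simp: rho_simps lop_Ut_zero rho_It)
    then show ?thesis by simp
  qed
  have 2: "app (\<rho> (Omega x)) g = 0" if x: "x \<in> Jt_minus X" and g: "g \<in> L" for x g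
  proof -
    have "x \<in> {x. app (\<rho> (Omega x)) g = 0}"
      using x
    proof (rule Jt_minus_induct)
      show "falg.subspace {x. app (\<rho> (Omega x)) g = 0}"
        by (rule falg.subspaceI) (auto simp: rho_simps Omega_linear)
    qed (auto simp: rho_Omega_Ut Omega_mult rho_simps(2) rho_Omega_It rho_Lmod g)
    then show ?thesis by simp
  qed
  obtain a b t where "x = a + Omega b + t" "a \<in> Jt_minus X" "b \<in> Jt_minus X" "t \<in> Ut_ideal X"
    using assms(1) unfolding U_ideal_def by (auto elim!: set_plus_elim)
  then show ?thesis
    using 1 2 assms(2) by (simp add: rho_simps(1) lop_Ut_zero)
qed

end

section \<open>Finite dimensionality of $\mathcal L_\chi(\Lambda)$\<close>

lemma span_closed_under_mult:
  fixes S :: "('g, 'k::field) free_alg set"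
  assumes S: "falg.subspace S" and one: "1 \<in> S" and mult: "\<And>a x. x \<in> S \<Longrightarrow> fvar a * x \<in> S"
  shows "S = UNIV"
proof -
  have "prod_list (map fvar gs) \<in> S" for gs
    by (induction gs) (simp_all add: one mult)
  then have "fscale c (prod_list (map fvar (letters w))) \<in> S" for c w
    by (rule falg.subspace_scale[OF S])
  moreover have "Poly_Mapping.single w c = fscale c (prod_list (map fvar (letters w)))" for w :: "'g fword" and c :: 'k
    by (simp add: fscale_def fconst_def mult_single flip: single_Fword)
  ultimately have "Poly_Mapping.single w c \<in> S" for w c
    by simp
  then have "(\<Sum>w\<in>Poly_Mapping.keys x. Poly_Mapping.single w (Poly_Mapping.lookup x w)) \<in> S" for x
    by (rule falg.subspace_sum[OF S])
  then have "x \<in> S" for x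
    by (simp flip: poly_mapping_expand)
  then show ?thesis by blast
qed

lemma gens_in_alg_zero: "Kg \<alpha> \<in> alg_zero" "Lg \<alpha> \<in> alg_zero"
  by (auto simp: alg_zero_def intro: hull_inc)

lemma alg_zero_subalgebra: "subalgebra alg_zero"
  by (simp add: alg_zero_eq words_in_subalgebra)

lemma alg_minus_subalgebra: "subalgebra alg_minus"
  by (simp add: alg_minus_eq words_in_subalgebra)

lemma Fg_alg_minus: "Fg i \<in> alg_minus"
  by (auto simp: alg_minus_def intro: hull_inc)

locale Ch_weight = character X h \<kappa> \<mu> for X :: "('i::finite, 'k::field) bichar" and h \<kappa> \<mu> +
  fixes \<Lambda> :: "('i, 'k) qalg \<Rightarrow> 'k"
  assumes \<Lambda>: "\<Lambda> \<in> Ch X" "\<And>\<alpha>. \<Lambda> (Kg \<alpha>) = \<kappa> \<alpha>" "\<And>\<alpha>. \<Lambda> (Lg \<alpha>) = \<mu> \<alpha>"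
begin

lemma \<Lambda>_hom: "\<Lambda> 1 = 1" "x \<in> alg_zero \<Longrightarrow> y \<in> alg_zero \<Longrightarrow> \<Lambda> (x + y) = \<Lambda> x + \<Lambda> y"
  "x \<in> alg_zero \<Longrightarrow> y \<in> alg_zero \<Longrightarrow> \<Lambda> (x * y) = \<Lambda> x * \<Lambda> y"
  "x \<in> alg_zero \<Longrightarrow> \<Lambda> (fscale c x) = c * \<Lambda> x"
  using \<Lambda>(1) by (simp_all add: Ch_def)

lemma alg_zero_vac: "Z \<in> alg_zero \<Longrightarrow> app (\<rho> Z) vac = fnscale (\<Lambda> Z) vac"
proof -
  let ?S = "{Z \<in> alg_zero. app (\<rho> Z) vac = fnscale (\<Lambda> Z) vac}"
  have A: "falg.subspace (alg_zero :: ('i, 'k) qalg set)" "1 \<in> (alg_zero :: ('i, 'k) qalg set)"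
    "\<And>x y :: ('i, 'k) qalg. x \<in> alg_zero \<Longrightarrow> y \<in> alg_zero \<Longrightarrow> x * y \<in> alg_zero"
    using alg_zero_subalgebra unfolding subalgebra_def by blast+
  have zero: "\<Lambda> 0 = 0"
    using \<Lambda>_hom(4)[of 1 0] A by simp
  have "alg_zero \<subseteq> ?S"
    unfolding alg_zero_def
  proof (rule hull_minimal)
    have "app (\<rho> (Kg \<alpha>)) vac = fnscale (\<Lambda> (Kg \<alpha>)) vac" "app (\<rho> (Lg \<alpha>)) vac = fnscale (\<Lambda> (Lg \<alpha>)) vac" for \<alpha>
      by (simp_all add: rho_sm \<Lambda> app_Kop_hom[OF vac_hom] app_Lop_hom[OF vac_hom] bihom_simps[OF X])
    then show "range Kg \<union> range Lg \<subseteq> {Z \<in> subalgebra hull (range Kg \<union> range Lg). app (\<rho> Z) vac = fnscale (\<Lambda> Z) vac}"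
      using gens_in_alg_zero unfolding alg_zero_def by auto
    have "subalgebra ?S"
      unfolding subalgebra_def
    proof (intro conjI ballI)
      show "falg.subspace ?S"
        using A by (intro falg.subspaceI)
          (auto simp: rho_sm \<Lambda>_hom zero falg.subspace_0 falg.subspace_add falg.subspace_scale fnv.scale_left_distrib)
      show "1 \<in> ?S"
        using A by (simp add: rho_sm \<Lambda>_hom)
      show "x * y \<in> ?S" if "x \<in> ?S" "y \<in> ?S" for x y
        using A that by (auto simp: rho_sm \<Lambda>_hom mult.commute)
    qed
    then show "subalgebra {Z \<in> subalgebra hull (range Kg \<union> range Lg). app (\<rho> Z) vac = fnscale (\<Lambda> Z) vac}"
      by (simp add: alg_zero_def)
  qed
  then show "Z \<in> alg_zero \<Longrightarrow> ?thesis" by blast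
qed

text \<open>The annihilator of the highest weight vector of the function model; it turns out to be
  \<open>L_ideal\<close>.\<close>

definition Ann :: "('i, 'k) qalg set" where
  "Ann = {x. app (\<rho> x) vac = 0}"

lemma Ann_subspace: "falg.subspace Ann"
  unfolding Ann_def by (rule falg.subspaceI) (auto simp: rho_sm)

lemma Ann_left_ideal: "x \<in> Ann \<Longrightarrow> a * x \<in> Ann"
  by (simp add: Ann_def rho_simps(2))

abbreviation "verma \<equiv> verma_ideal X \<Lambda>"

lemma verma_subspace: "falg.subspace verma"
  by (simp add: verma_ideal_def left_ideal_gen_def)

lemma verma_base: "x \<in> U_ideal X \<union> {Z - fconst (\<Lambda> Z) | Z. Z \<in> alg_zero} \<union> range Eg \<Longrightarrow> a * x \<in> verma"
  unfolding verma_ideal_def left_ideal_gen_def by (rule falg.span_base) blast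

lemma verma_left_ideal: "x \<in> verma \<Longrightarrow> a * x \<in> verma"
proof -
  assume x: "x \<in> verma"
  have "falg.subspace {x. a * x \<in> verma}"
    using verma_subspace
    by (intro falg.subspaceI) (auto simp: distrib_left fscale_mult falg.subspace_0 falg.subspace_add falg.subspace_scale)
  then have "verma \<subseteq> {x. a * x \<in> verma}"
    unfolding verma_ideal_def[of X \<Lambda>] left_ideal_gen_def
  proof (intro falg.span_minimal, clarify)
    fix b s assume "s \<in> U_ideal X \<union> {Z - fconst (\<Lambda> Z) | Z. Z \<in> alg_zero} \<union> range Eg"
    from verma_base[OF this, of "a * b"]
    show "a * (b * s) \<in> falg.span {a * s |a s. s \<in> U_ideal X \<union> {Z - fconst (\<Lambda> Z) |Z. Z \<in> alg_zero} \<union> range Eg}"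
      unfolding verma_ideal_def left_ideal_gen_def by (simp only: mult.assoc)
  qed (simp only: verma_ideal_def left_ideal_gen_def)
  with x show ?thesis by blast
qed

lemma U_ideal_le_verma: "U_ideal X \<subseteq> verma"
  using verma_base[of _ 1] by auto

lemma Ut_ideal_le_verma: "Ut_ideal X \<subseteq> verma"
  using U_ideal_le_verma Ut_ideal_le_U_ideal by blast

lemma verma_le_Ann: "verma \<subseteq> Ann"
  unfolding verma_ideal_def left_ideal_gen_def
proof (rule falg.span_minimal[OF _ Ann_subspace], clarify)
  fix a s assume "s \<in> U_ideal X \<union> {Z - fconst (\<Lambda> Z) | Z. Z \<in> alg_zero} \<union> range Eg"
  then have "s \<in> Ann"
    using U_ideal_annihilates[OF _ vac_in_Lmod] alg_zero_vac
    by (auto simp: Ann_def rho_simps rho_diff)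
  then show "a * s \<in> Ann"
    by (rule Ann_left_ideal)
qed

text \<open>The spanning half of the triangular decomposition: K, L and E are moved to the right of
  all F by the relations and absorbed by the Verma ideal.\<close>

lemma minus_plus_verma: "alg_minus + verma = UNIV"
proof (rule span_closed_under_mult)
  let ?S = "alg_minus + verma"
  have M: "falg.subspace (alg_minus :: ('i, 'k) qalg set)" "1 \<in> (alg_minus :: ('i, 'k) qalg set)"
    "\<And>x y :: ('i, 'k) qalg. x \<in> alg_minus \<Longrightarrow> y \<in> alg_minus \<Longrightarrow> x * y \<in> alg_minus"
    using alg_minus_subalgebra unfolding subalgebra_def by blast+
  show sub: "falg.subspace ?S"
    using M verma_subspace by (intro subspace_plus) auto
  have verma: "x \<in> verma \<Longrightarrow> x \<in> ?S" for x
    using falg.subspace_0[OF M(1)] set_plus_intro[of 0 alg_minus x verma] by simp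
  have one: "x \<in> alg_minus \<Longrightarrow> x \<in> ?S" for x
    using set_plus_intro[of x alg_minus 0 verma] falg.subspace_0[OF verma_subspace] by simp
  show "1 \<in> ?S"
    using M one by simp
  have F: "Fg i * x \<in> ?S" if x: "x \<in> ?S" for i x
  proof -
    obtain y n where "x = y + n" "y \<in> alg_minus" "n \<in> verma"
      using x by (auto elim: set_plus_elim)
    then show ?thesis
      using verma_left_ideal M(3)[OF Fg_alg_minus] by (auto simp: distrib_left intro!: set_plus_intro)
  qed
  have relator: "r * x \<in> ?S" if "r \<in> Ut_relators X" for r x
    using that Ut_ideal_mult(2)[OF Ut_ideal_relator] Ut_ideal_le_verma verma by blast
  have word: "Kg \<alpha> * prod_list (map fvar gs) \<in> ?S \<and> Lg \<alpha> * prod_list (map fvar gs) \<in> ?S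
      \<and> Eg j * prod_list (map fvar gs) \<in> ?S" if "set gs \<subseteq> range GenF" for gs \<alpha> j
    using that
  proof (induction gs arbitrary: \<alpha> j)
    case Nil
    have "fconst c \<in> ?S" for c
      using falg.subspace_scale[OF sub, of 1 c] M one by (simp add: fscale_def)
    moreover have "Kg \<alpha> - fconst (\<Lambda> (Kg \<alpha>)) \<in> verma" "Lg \<alpha> - fconst (\<Lambda> (Lg \<alpha>)) \<in> verma" "Eg j \<in> verma"
      using verma_base[of _ 1] gens_in_alg_zero by fastforce+
    ultimately have "Kg \<alpha> - fconst (\<Lambda> (Kg \<alpha>)) + fconst (\<Lambda> (Kg \<alpha>)) \<in> ?S"
      "Lg \<alpha> - fconst (\<Lambda> (Lg \<alpha>)) + fconst (\<Lambda> (Lg \<alpha>)) \<in> ?S" "Eg j \<in> ?S"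
      using verma by (blast intro: falg.subspace_add[OF sub])+
    then show ?case by simp
  next
    case (Cons g gs)
    then obtain i where g: "g = GenF i"
      by auto
    let ?P = "prod_list (map fvar gs)"
    have IH: "Kg \<alpha> * ?P \<in> ?S" "Lg \<alpha> * ?P \<in> ?S" "Eg j * ?P \<in> ?S" for \<alpha> j
      using Cons by auto
    have "(Kg \<alpha> * Fg i - fscale (X \<alpha> (- sroot i)) (Fg i * Kg \<alpha>)) * ?P + fscale (X \<alpha> (- sroot i)) (Fg i * (Kg \<alpha> * ?P)) \<in> ?S"
      "(Lg \<alpha> * Fg i - fscale (X (sroot i) \<alpha>) (Fg i * Lg \<alpha>)) * ?P + fscale (X (sroot i) \<alpha>) (Fg i * (Lg \<alpha> * ?P)) \<in> ?S"
      by (intro falg.subspace_add[OF sub] falg.subspace_scale[OF sub] F IH relator Ut_relators.intros)+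
    moreover have "(Eg j * Fg i - Fg i * Eg j - (if j = i then - Kg (sroot j) + Lg (sroot j) else 0)) * ?P
      + (Fg i * (Eg j * ?P) + (if j = i then - (Kg (sroot j) * ?P) + Lg (sroot j) * ?P else 0)) \<in> ?S"
    proof (intro falg.subspace_add[OF sub])
      show "(Eg j * Fg i - Fg i * Eg j - (if j = i then - Kg (sroot j) + Lg (sroot j) else 0)) * ?P \<in> ?S"
        by (rule relator[OF Ut_relators.intros(10)])
      show "Fg i * (Eg j * ?P) \<in> ?S"
        by (rule F[OF IH(3)])
      have "- (Kg (sroot j) * ?P) + Lg (sroot j) * ?P \<in> ?S"
        by (rule falg.subspace_add[OF sub falg.subspace_neg[OF sub IH(1)] IH(2)])
      then show "(if j = i then - (Kg (sroot j) * ?P) + Lg (sroot j) * ?P else 0) \<in> ?S"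
        by (cases "j = i") (simp_all only: simp_thms if_True if_False falg.subspace_0[OF sub])
    qed
    ultimately show ?case
      by (auto simp: g Fg_def left_diff_distrib distrib_right fscale_mult mult.assoc split: if_splits)
  qed
  have gen: "T * x \<in> ?S" if x: "x \<in> ?S" and T: "T \<in> range Kg \<union> range Lg \<union> range Eg" for T x
  proof -
    obtain y n where y: "x = y + n" "y \<in> alg_minus" "n \<in> verma"
      using x by (auto elim: set_plus_elim)
    have "T * Poly_Mapping.single w c \<in> ?S" if "w \<in> Poly_Mapping.keys y" for w c
    proof -
      have "set (letters w) \<subseteq> range GenF"
        using that y(2) by (auto simp: alg_minus_eq words_in_def in_keys_iff)
      then have "T * prod_list (map fvar (letters w)) \<in> ?S"
        using word T by blast
      moreover have "Poly_Mapping.single w c = fscale c (prod_list (map fvar (letters w)))"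
        by (simp add: fscale_def fconst_def mult_single flip: single_Fword)
      ultimately show ?thesis
        by (simp add: fscale_mult falg.subspace_scale[OF sub])
    qed
    then have "(\<Sum>w\<in>Poly_Mapping.keys y. T * Poly_Mapping.single w (Poly_Mapping.lookup y w)) \<in> ?S"
      by (intro falg.subspace_sum[OF sub])
    then have "T * y \<in> ?S"
      by (simp flip: sum_distrib_left poly_mapping_expand)
    then show ?thesis
      using verma[OF verma_left_ideal[OF y(3)]] by (simp add: y(1) distrib_left falg.subspace_add[OF sub])
  qed
  show "fvar a * x \<in> ?S" if "x \<in> ?S" for a x
    using F[OF that] gen[OF that] by (cases a) (auto simp: Kg_def Lg_def Eg_def Fg_def)
qed

end

lemma component_sum: "component \<beta> (sum x S) = (\<Sum>s\<in>S. component \<beta> (x s))"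
  by (induction S rule: infinite_finite_induct) (simp_all add: component_lin)

lemma component_rho_vac: "component (- \<beta>) (app (rho X h \<kappa> \<mu> y) vac) = app (rho X h \<kappa> \<mu> (prj \<beta> y)) vac"
proof -
  let ?D = "gdeg ` Poly_Mapping.keys y"
  have c: "component (- \<beta>) (app (rho X h \<kappa> \<mu> (prj \<gamma> y)) vac) = app (rho X h \<kappa> \<mu> (prj \<beta> (prj \<gamma> y))) vac" for \<gamma>
    using component_eq[OF hom_op_hom[OF hom_op_rho[OF prj_homog[of \<gamma> y]] vac_hom], of "- \<beta>" X h \<kappa> \<mu>]
      prj_eq[OF prj_homog[of \<gamma> y], of \<beta>]
    by (auto simp: rho_simps(3))
  have "component (- \<beta>) (app (rho X h \<kappa> \<mu> y) vac) = (\<Sum>\<gamma>\<in>?D. component (- \<beta>) (app (rho X h \<kappa> \<mu> (prj \<gamma> y)) vac))"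
    by (subst sum_prj[of y]) (simp only: rho_sum app_sum_left component_sum)
  also have "\<dots> = (\<Sum>\<gamma>\<in>?D. app (rho X h \<kappa> \<mu> (prj \<beta> (prj \<gamma> y))) vac)"
    by (simp only: c)
  also have "\<dots> = app (rho X h \<kappa> \<mu> (prj \<beta> y)) vac"
    by (subst (2) sum_prj[of y]) (simp only: rho_sum prj_sum app_sum_left)
  finally show ?thesis .
qed

context Ch_weight
begin

lemma Ann_prj: "x \<in> Ann \<Longrightarrow> prj \<beta> x \<in> Ann"
  using component_rho_vac[of \<beta> X h \<kappa> \<mu> x] by (simp add: Ann_def component_lin)

lemma U_ideal_0: "0 \<in> U_ideal X"
  by (rule falg.subspace_0[OF U_ideal_subspace])

lemma verma_degI: "y \<in> alg_minus \<Longrightarrow> y \<in> homog \<beta> \<Longrightarrow> n \<in> verma \<Longrightarrow> y + n \<in> verma_deg X \<Lambda> \<beta>"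
  unfolding verma_deg_def U_minus_deg_def U_minus_def
  using set_plus_intro[OF _ U_ideal_0, of y] by (intro set_plus_intro) auto

lemma Ann_proper: "proper_graded_submodule X \<Lambda> Ann"
  unfolding proper_graded_submodule_def
proof (intro conjI allI ballI)
  show "falg.subspace Ann" "verma \<subseteq> Ann"
    by (rule Ann_subspace verma_le_Ann)+
  show "a * x \<in> Ann" if "x \<in> Ann" for a x
    using that by (rule Ann_left_ideal)
  have "1 \<notin> Ann"
    by (simp add: Ann_def rho_simps(4) vac_neq_0)
  then show "Ann \<noteq> UNIV" by blast
  show "Ann = falg.span (\<Union>\<alpha>. Ann \<inter> verma_deg X \<Lambda> \<alpha>)" (is "_ = falg.span ?W")
  proof
    show "falg.span ?W \<subseteq> Ann"
      by (rule falg.span_minimal[OF _ Ann_subspace]) blast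
    show "Ann \<subseteq> falg.span ?W"
    proof
      fix x assume x: "x \<in> Ann"
      \<comment> \<open>Components of x itself need not be represented in U^-. Those of its part y
        are, while n belongs to the Verma ideal and so may be placed in degree 0.\<close>
      obtain y n where yn: "x = y + n" "y \<in> alg_minus" "n \<in> verma"
        using minus_plus_verma by (metis UNIV_I set_plus_elim)
      have zero: "(0 :: ('i, 'k) qalg) \<in> alg_minus" "0 \<in> verma"
        using alg_minus_subalgebra falg.subspace_0 verma_subspace unfolding subalgebra_def by blast+
      have n: "n \<in> Ann"
        using yn(3) verma_le_Ann by blast
      then have y: "y \<in> Ann"
        using falg.subspace_diff[OF Ann_subspace x, of n] yn(1) by simp
      have "prj \<beta> y \<in> falg.span ?W" for \<beta>
      proof -
        have "prj \<beta> y \<in> alg_minus"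
          using yn(2) by (simp add: alg_minus_eq prj_words_in)
        then have "prj \<beta> y + 0 \<in> verma_deg X \<Lambda> \<beta>"
          by (rule verma_degI[OF _ prj_homog zero(2)])
        then show ?thesis
          using Ann_prj[OF y, of \<beta>] by (intro falg.span_base) auto
      qed
      then have "(\<Sum>\<beta>\<in>gdeg ` Poly_Mapping.keys y. prj \<beta> y) \<in> falg.span ?W"
        by (rule falg.span_sum)
      moreover have "0 + n \<in> verma_deg X \<Lambda> 0"
        using verma_degI[OF zero(1) falg.subspace_0[OF homog_subspace] yn(3)] .
      then have "n \<in> falg.span ?W"
        using n by (intro falg.span_base) auto
      ultimately show "x \<in> falg.span ?W"
        unfolding yn(1) by (subst sum_prj[of y]) (rule falg.span_add)
    qed
  qed
qed

text \<open>The source of irreducibility: the letters of a word with nonzero value are applied as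
  raising operators, the first letter acting first.\<close>

lemma vac_coefficient_nonzero:
  assumes "g \<noteq> 0"
  shows "\<exists>gs. app (\<rho> (prod_list (map Eg gs))) g [] \<noteq> 0"
proof -
  obtain w where "g w \<noteq> 0"
    using assms by (auto simp: fun_eq_iff zero_fun_apply)
  then show ?thesis
  proof (induction w arbitrary: g)
    case Nil
    then show ?case
      by (intro exI[of _ "[]"]) (simp add: rho_simps(4))
  next
    case (Cons i w)
    have "app (eop i) g w \<noteq> 0"
      using Cons.prems by (simp add: app_eop)
    then obtain gs where "app (\<rho> (prod_list (map Eg gs))) (app (eop i) g) [] \<noteq> 0"
      using Cons.IH by blast
    moreover have "\<rho> (prod_list (map Eg (gs @ [i]))) = \<rho> (prod_list (map Eg gs)) * eop i"
      by (simp add: rho_simps(2,10))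
    ultimately show ?case
      by (intro exI[of _ "gs @ [i]"]) simp
  qed
qed

lemma homog_0_words_in_F:
  fixes y :: "('j::finite, 'l::field) qalg"
  assumes "y \<in> words_in (range GenF)" "y \<in> homog 0"
  shows "\<exists>c. y = fconst c"
proof (intro exI poly_mapping_eqI)
  fix w
  have hgt: "set gs \<subseteq> range GenF \<Longrightarrow> height (sum_list (map gen_deg gs)) = - int (length gs)" for gs :: "'j gen list"
  proof (induction gs)
    case (Cons g gs)
    then obtain i where "g = GenF i" by auto
    moreover have "height (- sroot i) = - 1"
      using height_simps(3)[of 0 "sroot i"] by simp
    ultimately show ?case
      using Cons by simp
  qed simp
  have "w = 0" if "Poly_Mapping.lookup y w \<noteq> 0"
  proof -
    have "set (letters w) \<subseteq> range GenF" "gdeg w = 0"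
      using that assms by (simp_all add: words_in_def homog_iff)
    then have "letters w = []"
      using hgt[of "letters w"] by (simp add: gdeg_def)
    then show ?thesis
      by (cases w) (simp add: zero_fword_def)
  qed
  then show "Poly_Mapping.lookup y w = Poly_Mapping.lookup (fconst (Poly_Mapping.lookup y 0)) w"
    by (auto simp: fconst_def lookup_single when_def)
qed

text \<open>An element of S outside \<open>Ann\<close> can be raised to one with nonzero vacuum
  coefficient. Gradedness then provides such an element of a single degree, which must be 0. There
  U^- consists of scalars modulo the ideal, so 1 lies in S.\<close>

lemma Ann_greatest:
  assumes S: "proper_graded_submodule X \<Lambda> S"
  shows "S \<subseteq> Ann"
proof (rule ccontr)
  note P = S[unfolded proper_graded_submodule_def]
  have sub: "falg.subspace S" and left: "\<And>a x. x \<in> S \<Longrightarrow> a * x \<in> S" and verma: "verma \<subseteq> S" and "S \<noteq> UNIV"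
    and span: "S = falg.span (\<Union>\<alpha>. S \<inter> verma_deg X \<Lambda> \<alpha>)"
    using P by blast+
  assume "\<not> S \<subseteq> Ann"
  then obtain x where x: "x \<in> S" "app (\<rho> x) vac \<noteq> 0"
    by (auto simp: Ann_def)
  obtain gs where "app (\<rho> (prod_list (map Eg gs))) (app (\<rho> x) vac) [] \<noteq> 0"
    using vac_coefficient_nonzero[OF x(2)] by blast
  then have a: "prod_list (map Eg gs) * x \<in> S" "app (\<rho> (prod_list (map Eg gs) * x)) vac [] \<noteq> 0"
    using left[OF x(1)] by (simp_all add: rho_simps(2))
  have "\<exists>s\<in>\<Union>\<alpha>. S \<inter> verma_deg X \<Lambda> \<alpha>. app (\<rho> s) vac [] \<noteq> 0"
  proof (rule ccontr)
    assume "\<not> ?thesis"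
    then have "(\<Union>\<alpha>. S \<inter> verma_deg X \<Lambda> \<alpha>) \<subseteq> {s. app (\<rho> s) vac [] = 0}"
      by blast
    moreover have "falg.subspace {s. app (\<rho> s) vac [] = 0}"
      by (rule falg.subspaceI) (auto simp: rho_simps pointwise)
    ultimately have "S \<subseteq> {s. app (\<rho> s) vac [] = 0}"
      using span falg.span_minimal by metis
    with a show False by blast
  qed
  then obtain s \<alpha> where s: "s \<in> S" "s \<in> verma_deg X \<Lambda> \<alpha>" "app (\<rho> s) vac [] \<noteq> 0"
    by blast
  obtain Y n where Y: "s = Y + n" "Y \<in> U_minus_deg X \<alpha>" "n \<in> verma"
    using s(2) unfolding verma_deg_def by (auto elim: set_plus_elim)
  have "Y \<in> (words_in (range GenF) + U_ideal X) \<inter> (homog \<alpha> + U_ideal X)"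
    using Y(2) by (simp add: U_minus_deg_def U_minus_def alg_minus_eq)
  then obtain y where y: "y \<in> words_in (range GenF)" "y \<in> homog \<alpha>" "Y - y \<in> U_ideal X"
    by (rule homog_representative[OF U_ideal_subspace U_ideal_graded])
  have "s - y = (Y - y) + n"
    by (simp add: Y(1))
  also have "\<dots> \<in> verma"
    using U_ideal_le_verma y(3) Y(3) by (intro falg.subspace_add[OF verma_subspace]) auto
  finally have "s - y \<in> verma" .
  then have "app (\<rho> (s - y)) vac = 0" "s - y \<in> S"
    using verma_le_Ann verma by (auto simp: Ann_def)
  then have ys: "app (\<rho> y) vac [] \<noteq> 0" "y \<in> S"
    using s(3) falg.subspace_diff[OF sub s(1), of "s - y"] s(1) by (simp_all add: rho_diff)
  have "\<alpha> = 0"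
  proof (rule ccontr)
    assume "\<alpha> \<noteq> 0"
    moreover have "app (\<rho> y) vac \<in> hom_space (0 - \<alpha>)"
      using hom_op_hom[OF hom_op_rho[OF y(2)] vac_hom] by simp
    ultimately show False
      using ys(1) by (auto simp: hom_space_def)
  qed
  then obtain c where c: "y = fconst c"
    using homog_0_words_in_F y by blast
  then have "c \<noteq> 0"
    using ys(1) by (auto simp: rho_simps(3) zero_fun_apply)
  then have "fconst (inverse c) * y = 1"
    unfolding c by (simp flip: fconst_simps)
  then have "1 \<in> S"
    using left[OF ys(2), of "fconst (inverse c)"] by simp
  then have "a \<in> S" for a
    using left[of 1 a] by simp
  then show False
    using \<open>S \<noteq> UNIV\<close> by blast
qed

lemma L_ideal_eq: "L_ideal X \<Lambda> = Ann"
  unfolding L_ideal_def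
proof (rule Greatest_equality)
  show "proper_graded_submodule X \<Lambda> Ann"
    by (rule Ann_proper)
  show "S \<subseteq> Ann" if "proper_graded_submodule X \<Lambda> S" for S
    using that by (rule Ann_greatest)
qed

lemma fword_rho: "\<exists>c. c \<noteq> 0 \<and> app (\<rho> (prod_list (map Fg u))) vac = fnscale c (fword X h u)"
proof (induction u)
  case Nil
  then show ?case
    by (intro exI[of _ 1]) (simp add: rho_simps(4))
next
  case (Cons i u)
  then obtain c where "c \<noteq> 0" "app (\<rho> (prod_list (map Fg u))) vac = fnscale c (fword X h u)"
    by blast
  then show ?case
    using \<mu>(2) by (intro exI[of _ "\<mu> (sroot i) * c"]) (simp add: rho_simps(2,11))
qed

lemma Lmod_rho:
  assumes "g \<in> L"
  obtains x where "app (\<rho> x) vac = g"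
proof -
  have "L \<subseteq> range (\<lambda>x. app (\<rho> x) vac)"
    unfolding Lmod_def
  proof (rule fnv.span_minimal)
    show "range (fword X h) \<subseteq> range (\<lambda>x. app (\<rho> x) vac)"
    proof clarify
      fix u
      obtain c where "c \<noteq> 0" "app (\<rho> (prod_list (map Fg u))) vac = fnscale c (fword X h u)"
        using fword_rho by blast
      then have "app (\<rho> (fscale (inverse c) (prod_list (map Fg u)))) vac = fword X h u"
        by (simp add: rho_simps(7))
      then show "fword X h u \<in> range (\<lambda>x. app (\<rho> x) vac)"
        by (metis rangeI)
    qed
    show "fnv.subspace (range (\<lambda>x. app (\<rho> x) vac))"
    proof (rule fnv.subspaceI)
      have "app (\<rho> 0) vac = 0"
        by (simp add: rho_simps(3))
      then show "0 \<in> range (\<lambda>x. app (\<rho> x) vac)"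
        by (metis rangeI)
      show "a + b \<in> range (\<lambda>x. app (\<rho> x) vac)"
        if "a \<in> range (\<lambda>x. app (\<rho> x) vac)" "b \<in> range (\<lambda>x. app (\<rho> x) vac)" for a b
        using that by (auto simp flip: rho_simps(1) app_simps(3))
      show "fnscale c a \<in> range (\<lambda>x. app (\<rho> x) vac)" if a: "a \<in> range (\<lambda>x. app (\<rho> x) vac)" for c a
      proof -
        obtain x where "a = app (\<rho> x) vac"
          using a by blast
        then have "fnscale c a = app (\<rho> (fscale c x)) vac"
          by (simp add: rho_simps(7))
        then show ?thesis by blast
      qed
    qed
  qed
  then show ?thesis
    using assms that by blast
qed

text \<open>Acting on the highest weight vector identifies the quotient by \<open>Ann\<close> with
  \<open>Lmod\<close>; bases are transported both ways.\<close>

lemma L_finite_dim_iff: "L_finite_dim X \<Lambda> \<longleftrightarrow> (\<exists>N. dimle L N)"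
proof
  assume "L_finite_dim X \<Lambda>"
  then obtain B where B: "finite B" "falg.span B + Ann = UNIV"
    by (auto simp: L_finite_dim_def finite_dim_quotient_def L_ideal_eq)
  let ?f = "\<lambda>x. app (\<rho> x) vac"
  have span: "?f b \<in> fnv.span (?f ` B)" if "b \<in> falg.span B" for b
    using that
  proof (induction rule: falg.span_induct_alt)
    case base
    then show ?case
      by (simp add: rho_simps(3) fnv.span_zero)
  next
    case (step c b' y)
    then have "fnscale c (?f b') + ?f y \<in> fnv.span (?f ` B)"
      by (intro fnv.span_add[OF fnv.span_scale[OF fnv.span_base]]) auto
    then show ?case
      by (simp add: rho_simps(1,7))
  qed
  have "L \<subseteq> fnv.span (?f ` B)"
  proof
    fix g assume "g \<in> L"
    then obtain x where x: "?f x = g"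
      by (rule Lmod_rho)
    obtain b n where "x = b + n" "b \<in> falg.span B" "n \<in> Ann"
      using B(2) by (metis UNIV_I set_plus_elim)
    then show "g \<in> fnv.span (?f ` B)"
      using x span by (auto simp: rho_simps(1) Ann_def)
  qed
  then show "\<exists>N. dimle L N"
    unfolding dimle_def using B(1) by blast
next
  assume "\<exists>N. dimle L N"
  then obtain N where "dimle L N" by blast
  then obtain B where B: "B \<subseteq> L" "finite B" "L \<subseteq> fnv.span B"
    using dimle_basis by metis
  have "\<exists>x. app (\<rho> x) vac = b" if "b \<in> B" for b
    using Lmod_rho[of b] B(1) that by blast
  then obtain x where x: "app (\<rho> (x b)) vac = b" if "b \<in> B" for b
    by metis
  have "falg.span (x ` B) + Ann = UNIV"
  proof -
    have "y \<in> falg.span (x ` B) + Ann" for y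
    proof -
      have "app (\<rho> y) vac \<in> fnv.span B"
        using rho_Lmod[OF vac_in_Lmod] B(3) by blast
      then obtain c where c: "app (\<rho> y) vac = (\<Sum>b\<in>B. fnscale (c b) b)"
        using fnv.span_finite[OF B(2)] by auto
      define z where "z = (\<Sum>b\<in>B. fscale (c b) (x b))"
      have "app (\<rho> z) vac = app (\<rho> y) vac"
        unfolding z_def c rho_sum app_sum_left by (intro sum.cong) (simp_all add: rho_simps(7) x)
      then have "y - z \<in> Ann"
        by (simp add: Ann_def rho_diff)
      moreover have "z \<in> falg.span (x ` B)"
        unfolding z_def by (intro falg.span_sum falg.span_scale falg.span_base) auto
      ultimately have "z + (y - z) \<in> falg.span (x ` B) + Ann"
        by (intro set_plus_intro)
      then show ?thesis by simp
    qed
    then show ?thesis by blast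
  qed
  then show "L_finite_dim X \<Lambda>"
    unfolding L_finite_dim_def finite_dim_quotient_def L_ideal_eq using B(2) by blast
qed

end

text \<open>The relations among K and L lie in \<open>U_ideal X\<close>, where \<Lambda> vanishes.
  This gives multiplicativity in the lattice, and opposite lattice elements give
  nonvanishing.\<close>

lemma Ch_weightI:
  assumes X: "bihom X" and \<Lambda>: "\<Lambda> \<in> Ch X"
  shows "Ch_weight X (\<lambda>i. \<Lambda> (Kg (sroot i)) / \<Lambda> (Lg (sroot i))) (\<lambda>\<alpha>. \<Lambda> (Kg \<alpha>)) (\<lambda>\<alpha>. \<Lambda> (Lg \<alpha>)) \<Lambda>"
proof -
  have one: "\<Lambda> 1 = 1"
    and add: "\<And>x y. x \<in> alg_zero \<Longrightarrow> y \<in> alg_zero \<Longrightarrow> \<Lambda> (x + y) = \<Lambda> x + \<Lambda> y"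
    and mult: "\<And>x y. x \<in> alg_zero \<Longrightarrow> y \<in> alg_zero \<Longrightarrow> \<Lambda> (x * y) = \<Lambda> x * \<Lambda> y"
    and scale: "\<And>c x. x \<in> alg_zero \<Longrightarrow> \<Lambda> (fscale c x) = c * \<Lambda> x"
    and zero: "\<And>x. x \<in> alg_zero \<Longrightarrow> x \<in> U_ideal X \<Longrightarrow> \<Lambda> x = 0"
    using \<Lambda> by (auto simp: Ch_def)
  have sub: "falg.subspace (alg_zero :: ('a, 'b) qalg set)" "1 \<in> (alg_zero :: ('a, 'b) qalg set)"
    "\<And>x y :: ('a, 'b) qalg. x \<in> alg_zero \<Longrightarrow> y \<in> alg_zero \<Longrightarrow> x * y \<in> alg_zero"
    using alg_zero_subalgebra unfolding subalgebra_def by blast+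
  have eq: "\<Lambda> x = \<Lambda> y" if "x - y \<in> Ut_relators X" "x \<in> alg_zero" "y \<in> alg_zero" for x y
  proof -
    have xy: "x - y \<in> alg_zero" "x - y \<in> U_ideal X"
      using that Ut_ideal_relator Ut_ideal_le_U_ideal falg.subspace_diff[OF sub(1)] by blast+
    have "\<Lambda> ((x - y) + y) = \<Lambda> (x - y) + \<Lambda> y"
      by (rule add[OF xy(1) that(3)])
    then show ?thesis
      using zero[OF xy] by simp
  qed
  note gens = gens_in_alg_zero
  have K: "\<Lambda> (Kg 0) = 1" "\<Lambda> (Kg (\<alpha> + \<beta>)) = \<Lambda> (Kg \<alpha>) * \<Lambda> (Kg \<beta>)" for \<alpha> \<beta>
    using eq[OF Ut_relators.intros(1) gens(1) sub(2)] eq[OF Ut_relators.intros(3) sub(3)[OF gens(1) gens(1)] gens(1), of \<alpha> \<beta>]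
      mult[OF gens(1) gens(1)] one by simp_all
  have L: "\<Lambda> (Lg 0) = 1" "\<Lambda> (Lg (\<alpha> + \<beta>)) = \<Lambda> (Lg \<alpha>) * \<Lambda> (Lg \<beta>)" for \<alpha> \<beta>
    using eq[OF Ut_relators.intros(2) gens(2) sub(2)] eq[OF Ut_relators.intros(4) sub(3)[OF gens(2) gens(2)] gens(2), of \<alpha> \<beta>]
      mult[OF gens(2) gens(2)] one by simp_all
  have "\<Lambda> (Kg \<alpha>) \<noteq> 0" "\<Lambda> (Lg \<alpha>) \<noteq> 0" for \<alpha>
    using K(1) K(2)[of \<alpha> "- \<alpha>"] L(1) L(2)[of \<alpha> "- \<alpha>"] by auto
  then show ?thesis
    by unfold_locales (use X \<Lambda> K L in auto)
qed

section \<open>Growth and Kharchenko bases\<close>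

lemma rho_words_in_F:
  assumes "x \<in> words_in (range GenF)"
  shows "rho X h \<kappa> \<mu> x = rho X h \<kappa>' \<mu> x"
proof -
  have "set gs \<subseteq> range GenF \<Longrightarrow> prod_list (map (gop X h \<kappa> \<mu>) gs) = prod_list (map (gop X h \<kappa>' \<mu>) gs)" for gs
    by (induction gs) auto
  then show ?thesis
    using assms unfolding rho_expand words_in_def in_keys_iff by (intro sum.cong) (simp_all add: in_keys_iff)
qed

lemma rho_F_word: "app (rho X h \<kappa> (\<lambda>_. 1) (prod_list (map Fg u))) vac = fword X h u"
  by (induction u) (simp_all add: rho_simps(2,4,11) lsc_simps(2))

text \<open>Polynomiality is required for each coefficient separately; the degree may depend on the
  word.\<close>

definition poly_family :: "('k::field \<Rightarrow> 'w \<Rightarrow> 'k) \<Rightarrow> bool" where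
  "poly_family g \<longleftrightarrow> (\<forall>w. \<exists>p. \<forall>t. g t w = poly p t)"

lemma poly_family_const: "poly_family (\<lambda>t. g)"
  unfolding poly_family_def by (intro allI exI[of _ "[:g _:]"]) simp

lemma poly_family_add: "poly_family x \<Longrightarrow> poly_family y \<Longrightarrow> poly_family (\<lambda>t. x t + y t)"
  unfolding poly_family_def plus_fun_apply by (metis poly_add)

lemma poly_family_scale: "poly_family x \<Longrightarrow> poly_family (\<lambda>t. fnscale c (x t))"
  unfolding poly_family_def fnscale_apply by (metis poly_smult)

lemma poly_family_sum: "(\<And>s. s \<in> S \<Longrightarrow> poly_family (x s)) \<Longrightarrow> poly_family (\<lambda>t. \<Sum>s\<in>S. x s t)"
  by (induction S rule: infinite_finite_induct) (simp_all add: poly_family_const poly_family_add)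

lemma poly_family_fop:
  assumes "poly_family g"
  shows "poly_family (\<lambda>t. app (fop X (\<lambda>_. t) j) (g t))"
proof -
  have "\<exists>p. \<forall>t. app (fop X (\<lambda>_. t) j) (g t) w = poly p t" for w
    using assms
  proof (induction w arbitrary: g)
    case Nil
    have "\<forall>t. app (fop X (\<lambda>_. t) j) (g t) [] = poly 0 t"
      by (simp add: app_fop)
    then show ?case by blast
  next
    case (Cons i w)
    have "poly_family (\<lambda>t. app (eop i) (g t))"
      using Cons.prems by (simp add: poly_family_def app_eop)
    then obtain p where p: "\<forall>t. app (fop X (\<lambda>_. t) j) (app (eop i) (g t)) w = poly p t"
      using Cons.IH by blast
    obtain r where r: "\<forall>t. g t w = poly r t"
      using Cons.prems unfolding poly_family_def by blast
    have "app (fop X (\<lambda>_. t) j) (g t) (i # w) = poly (p + (if i = j then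
        smult (X (wdeg w) (sroot i)) r - [:0, X (sroot i) (- wdeg w):] * r else 0)) t" for t
      using p r by (simp add: app_fop app_Lop app_Kop algebra_simps)
    then show ?case by blast
  qed
  then show ?thesis
    by (simp add: poly_family_def)
qed

lemma poly_family_rho:
  assumes "x \<in> words_in (range GenF)"
  shows "poly_family (\<lambda>t. app (rho X (\<lambda>_. t) \<kappa> (\<lambda>_. 1) x) vac)"
proof -
  have word: "set gs \<subseteq> range GenF \<Longrightarrow> poly_family (\<lambda>t. app (prod_list (map (gop X (\<lambda>_. t) \<kappa> (\<lambda>_. 1)) gs)) vac)" for gs
  proof (induction gs)
    case Nil
    then show ?case by (simp add: poly_family_const)
  next
    case (Cons g gs)
    then obtain j where j: "g = GenF j" by auto
    have "poly_family (\<lambda>t. app (fop X (\<lambda>_. t) j) (app (prod_list (map (gop X (\<lambda>_. t) \<kappa> (\<lambda>_. 1)) gs)) vac))"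
      using Cons by (intro poly_family_fop) auto
    then show ?case
      by (simp add: j lsc_simps(2))
  qed
  show ?thesis
    unfolding rho_expand app_sum_left app_simps app_lsc
    using assms by (intro poly_family_sum poly_family_scale word) (auto simp: words_in_def in_keys_iff)
qed

text \<open>Polynomials that agree at all nonzero points of an infinite field are equal;
  characteristic 0 makes the field infinite.\<close>

lemma poly_family_at_0:
  fixes x y :: "'k::field_char_0 \<Rightarrow> 'w \<Rightarrow> 'k"
  assumes "poly_family x" "poly_family y" and eq: "\<And>t. t \<noteq> 0 \<Longrightarrow> x t = y t"
  shows "x 0 = y 0"
proof
  fix w
  obtain p r where p: "\<forall>t. x t w = poly p t" and r: "\<forall>t. y t w = poly r t"
    using assms(1,2) unfolding poly_family_def by meson
  have "poly p t = poly r t" if "t \<noteq> 0" for t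
    using p r eq[OF that] by metis
  then have "UNIV - {0} \<subseteq> {t. poly (p - r) t = 0}"
    by auto
  moreover have "infinite (UNIV - {0 :: 'k})"
    by (simp add: infinite_UNIV_char_0)
  ultimately have "p - r = 0"
    using poly_roots_finite finite_subset by blast
  then show "x 0 w = y 0 w"
    using p r by simp
qed

text \<open>A change by an element of the ideal is invisible at any place of the monomial, since the
  factors to its right leave the vector in \<open>Lmod\<close>.\<close>

lemma (in character) pbw_monomial_cong:
  assumes FG: "\<And>r. x r \<noteq> 0 \<Longrightarrow> F r - G r \<in> U_ideal X" and fin: "finite {r. x r \<noteq> 0}"
  shows "app (\<rho> (pbw_monomial F x)) vac = app (\<rho> (pbw_monomial G x)) vac"
proof -
  have one: "app (\<rho> (F r)) g = app (\<rho> (G r)) g" if "x r \<noteq> 0" "g \<in> L" for r g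
    using U_ideal_annihilates[OF FG[OF that(1)] that(2)] by (simp add: rho_diff)
  have power: "app (\<rho> (F r ^ m)) g = app (\<rho> (G r ^ m)) g" if r: "x r \<noteq> 0" and g: "g \<in> L" for r m g
    by (induction m) (simp_all add: rho_simps(2) one[OF r] rho_Lmod g)
  have "app (\<rho> (prod_list (map (\<lambda>r. F r ^ x r) rs))) vac = app (\<rho> (prod_list (map (\<lambda>r. G r ^ x r) rs))) vac"
    if "set rs \<subseteq> {r. x r \<noteq> 0}" for rs
    using that by (induction rs) (simp_all add: rho_simps(2) power rho_Lmod vac_in_Lmod)
  then show ?thesis
    using fin by (simp add: pbw_monomial_def)
qed

lemma pbw_monomial_words_in:
  assumes G: "\<And>r. x r \<noteq> 0 \<Longrightarrow> G r \<in> words_in S" and fin: "finite {r. x r \<noteq> 0}"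
  shows "pbw_monomial G x \<in> words_in S"
proof -
  have one: "1 \<in> words_in S" and mult: "\<And>y z. y \<in> words_in S \<Longrightarrow> z \<in> words_in S \<Longrightarrow> y * z \<in> words_in S"
    using words_in_subalgebra[of S] by (auto simp: subalgebra_def)
  have power: "y \<in> words_in S \<Longrightarrow> y ^ m \<in> words_in S" for y m
    by (induction m) (simp_all add: one mult)
  have "set rs \<subseteq> {r. x r \<noteq> 0} \<Longrightarrow> prod_list (map (\<lambda>r. G r ^ x r) rs) \<in> words_in S" for rs
    by (induction rs) (simp_all add: one mult power G)
  then show ?thesis
    using fin by (simp add: pbw_monomial_def)
qed

text \<open>Every root vector lowers the height by at least 1, so the total height bounds each
  exponent, and bounded height leaves finitely many monomials.\<close>

lemma pbw_monomial_homog: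
  assumes G: "\<And>r. x r \<noteq> 0 \<Longrightarrow> \<exists>\<beta>. G r \<in> homog \<beta> \<and> height \<beta> \<le> - 1" and fin: "finite {r. x r \<noteq> 0}"
  shows "\<exists>\<beta>. pbw_monomial G x \<in> homog \<beta> \<and> (\<forall>r. int (x r) \<le> - height \<beta>)"
proof -
  have power: "\<exists>\<beta>. G r ^ m \<in> homog \<beta> \<and> int m \<le> - height \<beta>" if r: "x r \<noteq> 0" for r m
  proof (induction m)
    case 0
    show ?case
      using generators_homog(5) by (intro exI[of _ 0]) simp
  next
    case (Suc m)
    then obtain \<beta> where \<beta>: "G r ^ m \<in> homog \<beta>" "int m \<le> - height \<beta>" by blast
    obtain \<gamma> where \<gamma>: "G r \<in> homog \<gamma>" "height \<gamma> \<le> - 1"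
      using G[OF r] by blast
    show ?case
      using homog_mult[OF \<gamma>(1) \<beta>(1)] \<beta>(2) \<gamma>(2) by (intro exI[of _ "\<gamma> + \<beta>"]) simp
  qed
  have "set rs \<subseteq> {r. x r \<noteq> 0} \<Longrightarrow> \<exists>\<beta>. prod_list (map (\<lambda>r. G r ^ x r) rs) \<in> homog \<beta> \<and> height \<beta> \<le> 0
      \<and> (\<forall>r\<in>set rs. int (x r) \<le> - height \<beta>)" for rs
  proof (induction rs)
    case Nil
    show ?case
      using generators_homog(5) by (intro exI[of _ 0]) simp
  next
    case (Cons r rs)
    then obtain \<beta> where \<beta>: "prod_list (map (\<lambda>r. G r ^ x r) rs) \<in> homog \<beta>" "height \<beta> \<le> 0"
      "\<forall>r\<in>set rs. int (x r) \<le> - height \<beta>" by auto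
    obtain \<gamma> where \<gamma>: "G r ^ x r \<in> homog \<gamma>" "int (x r) \<le> - height \<gamma>"
      using power[of r "x r"] Cons.prems by auto
    show ?case
      using homog_mult[OF \<gamma>(1) \<beta>(1)] \<beta>(2,3) \<gamma>(2) by (intro exI[of _ "\<gamma> + \<beta>"]) force
  qed
  from this[of "sorted_list_of_set {r. x r \<noteq> 0}"] obtain \<beta> where
    "pbw_monomial G x \<in> homog \<beta>" "height \<beta> \<le> 0" "\<forall>r. x r \<noteq> 0 \<longrightarrow> int (x r) \<le> - height \<beta>"
    using fin by (auto simp: pbw_monomial_def)
  then show ?thesis
    by (metis add.inverse_neutral neg_0_le_iff_le of_nat_0)
qed

lemma card_bounded_exponents:
  fixes P :: "nat set" and M :: nat
  assumes P: "finite P"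
  defines "E \<equiv> {x. {r. x r \<noteq> 0} \<subseteq> P \<and> (\<forall>r. x r \<le> M)}"
  shows "finite E" "card E \<le> (M + 1) ^ card P"
proof -
  let ?e = "\<lambda>g r. if r \<in> P then g r else (0 :: nat)"
  have sub: "E \<subseteq> ?e ` (P \<rightarrow>\<^sub>E {..M})"
  proof
    fix x assume "x \<in> E"
    then have "x = ?e (restrict x P)" "restrict x P \<in> P \<rightarrow>\<^sub>E {..M}"
      by (auto simp: E_def fun_eq_iff)
    then show "x \<in> ?e ` (P \<rightarrow>\<^sub>E {..M})" by blast
  qed
  have fin: "finite (P \<rightarrow>\<^sub>E {..M})"
    using P by (intro finite_PiE) auto
  then show "finite E"
    using sub finite_surj by blast
  have "card E \<le> card (P \<rightarrow>\<^sub>E {..M})"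
    using sub fin surj_card_le by blast
  then show "card E \<le> (M + 1) ^ card P"
    using P by (simp add: card_PiE)
qed

lemma span_image_expand:
  assumes "y \<in> falg.span (b ` T)"
  obtains T' c where "finite T'" "T' \<subseteq> T" "y = (\<Sum>x\<in>T'. fscale (c x) (b x))"
proof -
  obtain t r where t: "finite t" "t \<subseteq> b ` T" "y = (\<Sum>a\<in>t. fscale (r a) a)"
    using assms unfolding falg.span_explicit by blast
  from t(2) obtain T' where T': "T' \<subseteq> T" "inj_on b T'" "t = b ` T'"
    unfolding subset_image_inj by (elim exE conjE)
  show thesis
  proof
    show "finite T'"
      using t(1) T'(2,3) finite_imageD by blast
    show "y = (\<Sum>x\<in>T'. fscale (r (b x)) (b x))"
      using t(3) T'(2,3) by (simp add: sum.reindex)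
  qed (rule T')
qed

lemma height_positive: "0 \<le> \<beta> \<Longrightarrow> \<beta> \<noteq> 0 \<Longrightarrow> 1 \<le> height \<beta>" for \<beta> :: "'i::finite lattice"
proof -
  assume \<beta>: "0 \<le> \<beta>" "\<beta> \<noteq> 0"
  then obtain i where "0 < \<beta> i"
    by (auto simp: le_fun_def fun_eq_iff zero_fun_apply order_less_le)
  then have "0 < height \<beta>"
    unfolding height_def using \<beta>(1) by (intro sum_pos2[of _ i]) (auto simp: le_fun_def zero_fun_apply)
  then show ?thesis by simp
qed

text \<open>Height is additive and equals 1 on simple roots, so this character has the same ratio t
  at every i.\<close>

lemma character_constant:
  fixes X :: "('i::finite, 'k::field) bichar"
  assumes "bihom X" "t \<noteq> 0"
  shows "character X (\<lambda>_. t) (\<lambda>\<alpha>. t powi height \<alpha>) (\<lambda>_. 1)"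
  using assms by unfold_locales (simp_all add: power_int_add)

text \<open>
  The relations of $U(\chi)$ only act by zero on modules whose highest weight takes nonzero values.
  The module with \<open>h = 0\<close>, on which $U^-(\chi)$ acts faithfully, is a limit of such modules: the
  matrix coefficients are polynomials in the common value \<open>t\<close> of \<open>h\<close>.
\<close>

lemma kharchenko_growth:
  fixes X :: "('i::finite, 'k::field_char_0) bichar"
  assumes X: "bihom X" and pair: "kharchenko_pair X R \<phi>" and R: "finite R"
  shows "growth X"
proof -
  note pair' = pair[unfolded kharchenko_pair_def basis_mod_def]
  have R': "R \<subseteq> {\<alpha>. 0 \<le> \<alpha>} - {0}"
    using pair' by (rule conjunct1)
  from conjunct2[OF pair'] obtain k \<psi> F where \<psi>: "\<psi> ` positions k = R"
    and fib: "\<forall>\<alpha>\<in>R. finite {r \<in> positions k. \<psi> r = \<alpha>} \<and> card {r \<in> positions k. \<psi> r = \<alpha>} = \<phi> \<alpha>"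
    and F: "\<forall>r\<in>positions k. F r \<in> U_minus_deg X (- \<psi> r) \<and> F r \<notin> U_ideal X"
    and basis: "U_minus X = falg.span (pbw_monomial F ` exponents X k \<psi>) + U_ideal X"
    by (elim exE conjE)
  define P where "P = positions k"
  have "P = (\<Union>\<alpha>\<in>R. {r \<in> positions k. \<psi> r = \<alpha>})"
    using \<psi> by (auto simp: P_def)
  then have finP: "finite P"
    using fib R by auto
  have "\<exists>G. G \<in> words_in (range GenF) \<and> G \<in> homog (- \<psi> r) \<and> F r - G \<in> U_ideal X" if "r \<in> P" for r
  proof -
    have "F r \<in> (words_in (range GenF) + U_ideal X) \<inter> (homog (- \<psi> r) + U_ideal X)"
      using F that by (simp add: P_def U_minus_deg_def U_minus_def alg_minus_eq)
    then show ?thesis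
      by (rule homog_representative[OF U_ideal_subspace U_ideal_graded]) blast
  qed
  then obtain G where G: "\<And>r. r \<in> P \<Longrightarrow> G r \<in> words_in (range GenF)" "\<And>r. r \<in> P \<Longrightarrow> G r \<in> homog (- \<psi> r)"
    "\<And>r. r \<in> P \<Longrightarrow> F r - G r \<in> U_ideal X"
    by metis
  have hG: "\<exists>\<beta>. G r \<in> homog \<beta> \<and> height \<beta> \<le> - 1" if "r \<in> P" for r
  proof -
    have "height (- \<psi> r) = - height (\<psi> r)"
      using height_simps(3)[of 0 "\<psi> r"] by simp
    moreover have "1 \<le> height (\<psi> r)"
      using that \<psi> R' by (intro height_positive) (auto simp: P_def)
    ultimately show ?thesis
      using G(2)[OF that] by (intro exI[of _ "- \<psi> r"]) simp
  qed
  \<comment> \<open>On words in the F_i the value of \<kappa> does not occur. Taking it constant,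
    instead of a power of t, makes v polynomial in t and defined at t = 0.\<close>
  define v where "v = (\<lambda>t x. app (rho X (\<lambda>_. t) (\<lambda>_. 1) (\<lambda>_. 1) (pbw_monomial G x)) vac)"
  define E where "E = (\<lambda>M :: nat. {x. {r. x r \<noteq> 0} \<subseteq> P \<and> (\<forall>r. x r \<le> M)})"
  have T: "finite {r. x r \<noteq> 0}" "{r. x r \<noteq> 0} \<subseteq> P" if "x \<in> exponents X k \<psi>" for x
    using that by (auto simp: exponents_def P_def)
  have PG: "pbw_monomial G x \<in> words_in (range GenF)" if "x \<in> exponents X k \<psi>" for x
    using T[OF that] G(1) by (intro pbw_monomial_words_in) auto
  have "fword X (\<lambda>_. 0) u \<in> fnv.span (v 0 ` E M)" if u: "length u \<le> M" for u M
  proof -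
    let ?Y = "prod_list (map Fg u) :: ('i, 'k) qalg"
    have A: "1 \<in> (alg_minus :: ('i, 'k) qalg set)" "\<And>x y :: ('i, 'k) qalg. x \<in> alg_minus \<Longrightarrow> y \<in> alg_minus \<Longrightarrow> x * y \<in> alg_minus"
      using alg_minus_subalgebra unfolding subalgebra_def by blast+
    have Y: "?Y \<in> alg_minus"
      by (induction u) (simp_all add: A Fg_alg_minus)
    then have "?Y + 0 \<in> U_minus X"
      unfolding U_minus_def using falg.subspace_0[OF U_ideal_subspace] by (intro set_plus_intro)
    then obtain y n where yn: "?Y = y + n" "y \<in> falg.span (pbw_monomial F ` exponents X k \<psi>)" "n \<in> U_ideal X"
      unfolding basis by (metis add.right_neutral set_plus_elim)
    obtain T' c where T': "finite T'" "T' \<subseteq> exponents X k \<psi>" "y = (\<Sum>x\<in>T'. fscale (c x) (pbw_monomial F x))"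
      using span_image_expand[OF yn(2)] .
    have nonzero: "fword X (\<lambda>_. t) u = (\<Sum>x\<in>T'. fnscale (c x) (v t x))" if "t \<noteq> 0" for t
    proof -
      let ?\<kappa> = "\<lambda>\<alpha>. t powi height \<alpha>"
      interpret character X "\<lambda>_. t" ?\<kappa> "\<lambda>_. 1"
        by (rule character_constant[OF X that])
      have "fword X (\<lambda>_. t) u = app (\<rho> ?Y) vac"
        by (simp add: rho_F_word)
      also have "\<dots> = (\<Sum>x\<in>T'. fnscale (c x) (app (\<rho> (pbw_monomial F x)) vac))"
        unfolding yn(1) T'(3)
        by (simp add: rho_simps(1,7) U_ideal_annihilates[OF yn(3) vac_in_Lmod] rho_sum app_sum_left)
      also have "\<dots> = (\<Sum>x\<in>T'. fnscale (c x) (v t x))"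
      proof (intro sum.cong refl)
        fix x assume "x \<in> T'"
        then have x: "x \<in> exponents X k \<psi>"
          using T'(2) by blast
        have "app (\<rho> (pbw_monomial F x)) vac = app (\<rho> (pbw_monomial G x)) vac"
          using T[OF x] G(3) by (intro pbw_monomial_cong) auto
        then show "fnscale (c x) (app (\<rho> (pbw_monomial F x)) vac) = fnscale (c x) (v t x)"
          unfolding v_def rho_words_in_F[OF PG[OF x], of X "\<lambda>_. t" "\<lambda>_. 1" "\<lambda>_. 1" ?\<kappa>] by simp
      qed
      finally show ?thesis .
    qed
    \<comment> \<open>The coefficients c come from a relation in U(\<chi>) and do not depend on t,
      so the identity for nonzero t extends to t = 0.\<close>
    have "fword X (\<lambda>_. 0) u = (\<Sum>x\<in>T'. fnscale (c x) (v 0 x))"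
    proof (rule poly_family_at_0[OF _ _ nonzero])
      have "?Y \<in> words_in (range GenF)"
        using Y by (simp add: alg_minus_eq)
      from poly_family_rho[OF this, of X "\<lambda>_. 1"] show "poly_family (\<lambda>t. fword X (\<lambda>_. t) u)"
        by (simp add: rho_F_word)
      show "poly_family (\<lambda>t. \<Sum>x\<in>T'. fnscale (c x) (v t x))"
        unfolding v_def using T'(2) PG by (intro poly_family_sum poly_family_scale poly_family_rho) auto
    qed
    \<comment> \<open>Projection to the degree of u discards monomials of other degrees; in those
      that remain no exponent exceeds the length of u.\<close>
    then have "fword X (\<lambda>_. 0) u = (\<Sum>x\<in>T'. fnscale (c x) (component (wdeg u) (v 0 x)))"
      using component_eq[OF fword_hom[of X "\<lambda>_. 0" u], of "wdeg u"] by (simp add: component_sum component_lin)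
    moreover have "component (wdeg u) (v 0 x) \<in> fnv.span (v 0 ` E M)" if "x \<in> T'" for x
    proof -
      have x: "x \<in> exponents X k \<psi>"
        using that T'(2) by blast
      obtain \<beta> where \<beta>: "pbw_monomial G x \<in> homog \<beta>" "\<forall>r. int (x r) \<le> - height \<beta>"
        using pbw_monomial_homog[of x G] T[OF x] hG by blast
      have "v 0 x \<in> hom_space (0 + - \<beta>)"
        unfolding v_def by (rule hom_op_hom[OF hom_op_rho[OF \<beta>(1)] vac_hom])
      then have c: "component (wdeg u) (v 0 x) = (if wdeg u = - \<beta> then v 0 x else 0)"
        using component_eq[of "v 0 x" "- \<beta>"] by simp
      show ?thesis
      proof (cases "wdeg u = - \<beta>")
        case True
        then have "int (length u) = - height \<beta>"
          using height_wdeg[of u] height_simps(3)[of 0 \<beta>] by simp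
        then have "x r \<le> M" for r
          using \<beta>(2) u by (metis le_trans of_nat_le_iff)
        then show ?thesis
          using c True T[OF x] by (intro fnv.span_base) (auto simp: E_def)
      qed (simp add: c fnv.span_zero)
    qed
    ultimately show ?thesis
      by (simp add: fnv.span_sum fnv.span_scale)
  qed
  then have "Ltrunc X (\<lambda>_. 0) M \<subseteq> fnv.span (v 0 ` E M)" for M
    unfolding Ltrunc_def by (intro fnv.span_minimal) auto
  moreover have "finite (E M)" "card (E M) \<le> (M + 1) ^ card P" for M
    unfolding E_def by (rule card_bounded_exponents[OF finP])+
  ultimately have "dimle (Ltrunc X (\<lambda>_. 0) M) (1 * (M + 1) ^ card P)" for M
    unfolding dimle_def
    by (intro exI[of _ "v 0 ` E M"]) (metis card_image_le finite_imageI le_trans mult_1)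
  then show ?thesis
    unfolding growth_def by blast
qed

section \<open>Iterated reflections\<close>

lemma Sup_enat_eqI:
  assumes "P m" "\<not> P (Suc m)" "\<And>k. P (Suc k) \<Longrightarrow> P k"
  shows "Sup (enat ` {m. P m}) = enat m"
proof -
  have "\<not> P (Suc m + d)" for d
    using assms(2,3) by (induction d) auto
  then have "k \<le> m" if "P k" for k
    using that by (metis le_add_diff_inverse not_less_eq_eq)
  then show ?thesis
    using assms(1) by (intro antisym Sup_least) (auto intro!: Sup_upper)
qed

lemma Sup_enat_eq_infinity:
  assumes "Sup (enat ` {m. P m}) = \<infinity>" "\<And>k. P (Suc k) \<Longrightarrow> P k"
  shows "P k"
proof (rule ccontr)
  assume "\<not> P k"
  then have "\<not> P (k + d)" for d
    using assms(2) by (induction d) auto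
  then have "m \<le> k" if "P m" for m
    using that by (metis le_add_diff_inverse nat_le_linear)
  then have "Sup (enat ` {m. P m}) \<le> enat k"
    by (intro Sup_least) auto
  then show False
    using assms(1) by simp
qed

context reflectable
begin

text \<open>The reflection keeps q and replaces p = q_ij q_ji by the inverse of p q^(2m). Hence the
  new factor at k vanishes exactly if 1 - q^(2m-k) p does, and the first zero has to stay at
  m.\<close>

lemma cartan_max_refl:
  assumes j: "j \<noteq> i"
  shows "cartan_max (bichar_refl i X) i j = enat (m j)"
proof -
  define p where "p = X (sroot i) (sroot j) * X (sroot j) (sroot i)"
  define p' where "p' = inverse (p * q ^ (2 * m j))"
  have p: "p \<noteq> 0" "p' \<noteq> 0"
    using bihom_simps(1)[OF X] by (simp_all add: p_def p'_def q)
  have q': "bichar_refl i X (sroot i) (sroot i) = q"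
    "bichar_refl i X (sroot i) (sroot j) * bichar_refl i X (sroot j) (sroot i) = p'"
    using j by (simp_all add: bichar_refl_def srefl_simps srefl_sroot X_replicate bihom_simps[OF X]
        p_def p'_def power_inverse mult_2 power_add)
  have down: "qfact k q * qpoch k q p' \<noteq> 0" if "qfact (Suc k) q * qpoch (Suc k) q p' \<noteq> 0" for k
    by (rule qfact_qpoch_down[OF that])
  have M: "qfact (m j) q * qpoch (m j) q p \<noteq> 0" "qnum (Suc (m j)) q = 0 \<or> q ^ m j * p = 1"
    using cartan_data[OF j] by (auto simp: p_def)
  have eq1: "q ^ k * p' = 1 \<longleftrightarrow> q ^ (2 * m j - k) * p = 1" if "k < m j" for k
  proof -
    have "q ^ (2 * m j) = q ^ k * q ^ (2 * m j - k)"
      using that by (simp flip: power_add)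
    then show ?thesis
      using p(1) q by (auto simp: p'_def field_simps)
  qed
  have "1 - q ^ k * p' \<noteq> 0" if k: "k < m j" for k
  proof
    assume "1 - q ^ k * p' = 0"
    then have *: "q ^ (2 * m j - k) * p = 1"
      using eq1[OF k] by simp
    show False
    proof (cases "qnum (Suc (m j)) q = 0")
      \<comment> \<open>Here q^(m+1) = 1 reduces the exponent 2m - k to m - 1 - k, which belongs to
        a factor known to be nonzero.\<close>
      case True
      then have "q ^ Suc (m j) = 1"
        using qnum_geometric[of q "Suc (m j)"] by simp
      moreover have "2 * m j - k = Suc (m j) + (m j - 1 - k)"
        using k by simp
      ultimately have "q ^ (m j - 1 - k) * p = 1"
        using * by (simp only: power_add) simp
      then show False
        using qfact_qpoch_nonzero(2)[OF M(1), of "m j - 1 - k"] k by simp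
    next
      \<comment> \<open>Now q^m p = 1, so q^(m-k) = 1 while the quantum integer of m - k is nonzero.
        This leaves q = 1, hence p = 1, against the factor for exponent 0.\<close>
      case False
      then have m1: "q ^ m j * p = 1"
        using M(2) by simp
      have "2 * m j - k = (m j - k) + m j"
        using k by simp
      then have "q ^ (m j - k) = 1"
        using * m1 by (simp add: power_add mult.assoc)
      moreover have "qnum (m j - k) q \<noteq> 0"
        using qfact_qpoch_nonzero(1)[OF M(1), of "m j - k - 1"] k by (simp add: Suc_diff_Suc)
      ultimately have "q = 1"
        using qnum_geometric[of q "m j - k"] by simp
      then show False
        using m1 qfact_qpoch_nonzero(2)[OF M(1), of 0] k by simp
    qed
  qed
  then have top: "qpoch (m j) q p' \<noteq> 0"
    by (force simp: qpoch_def)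
  have "q ^ m j * p' = 1" if "q ^ m j * p = 1"
  proof -
    have "p * q ^ (2 * m j) = q ^ m j * (q ^ m j * p)"
      by (simp only: mult_2 power_add) (simp add: mult_ac)
    then show ?thesis
      using that q by (simp add: p'_def)
  qed
  then have "qfact (Suc (m j)) q * qpoch (Suc (m j)) q p' = 0"
    using M(2) by (auto simp: qfact_Suc qpoch_Suc)
  moreover have "qfact (m j) q * qpoch (m j) q p' \<noteq> 0"
    using M(1) top by simp
  ultimately have "Sup (enat ` {k. qfact k q * qpoch k q p' \<noteq> 0}) = enat (m j)"
    by (intro Sup_enat_eqI[OF _ _ down]; blast)
  then show ?thesis
    by (simp add: cartan_max_def Let_def q')
qed

lemma srefl_refl: "srefl (bichar_refl i X) i = srefl X i"
proof -
  have "cartan (bichar_refl i X) i = cartan X i"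
    by (auto simp: fun_eq_iff cartan_def cartan_max_refl m)
  then show ?thesis
    by (simp add: fun_eq_iff srefl_def)
qed

lemma infinite_dimensional:
  assumes "\<And>k. ncoef k \<noteq> 0"
  shows "\<not> dimle (Lmod X h) N"
proof
  assume N: "dimle (Lmod X h) N"
  have "card {..N} \<le> N"
  proof (rule dimle_family[OF N, of frow])
    show "frow ` {..N} \<subseteq> Lmod X h"
      using fword_in_Lmod by blast
    show "\<forall>a\<in>{..N}. c a = 0" if c: "(\<Sum>a\<le>N. fnscale (c a) (frow a)) = 0" for c
    proof
      fix a assume a: "a \<in> {..N}"
      have off: "frow b (replicate a i) = 0" if "b \<noteq> a" for b
      proof (rule ccontr)
        assume "frow b (replicate a i) \<noteq> 0"
        then have "wdeg (replicate a i) = wdeg (replicate b i)"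
          using fword_hom[of X h "replicate b i"] unfolding hom_space_def by blast
        then show False
          using wdeg_eq_replicate that by (metis length_replicate)
      qed
      have "(\<Sum>b\<le>N. fnscale (c b) (frow b)) (replicate a i) = (\<Sum>b\<le>N. if b = a then c a * ncoef a else 0)"
        unfolding sum_apply by (intro sum.cong) (auto simp: fnscale_apply off frow_replicate)
      then have "c a * ncoef a = 0"
        using a by (simp add: c zero_fun_apply)
      then show "c a = 0"
        using assms by simp
    qed
  qed simp
  then show False by simp
qed

end

definition hwt :: "(('i, 'k::field) qalg \<Rightarrow> 'k) \<Rightarrow> 'i \<Rightarrow> 'k" where
  "hwt \<Lambda> i = \<Lambda> (Kg (sroot i)) / \<Lambda> (Lg (sroot i))"

text \<open>
  \<open>wt_refl\<close> does not yield an element of \<open>Ch\<close> a priori; \<open>stage\<close> only records its values on the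
  products of the diagonal generators.
\<close>

definition stage :: "('i::finite, 'k::field) bichar \<Rightarrow> (('i, 'k) qalg \<Rightarrow> 'k) \<Rightarrow> bool" where
  "stage X \<Lambda> \<longleftrightarrow> bihom X \<and> growth X \<and>
     (\<forall>\<alpha> \<beta>. \<Lambda> (Kg (\<alpha> + \<beta>)) = \<Lambda> (Kg \<alpha>) * \<Lambda> (Kg \<beta>)) \<and> (\<forall>\<alpha> \<beta>. \<Lambda> (Lg (\<alpha> + \<beta>)) = \<Lambda> (Lg \<alpha>) * \<Lambda> (Lg \<beta>)) \<and>
     (\<forall>\<alpha> \<beta>. \<Lambda> (Kg \<alpha> * Lg \<beta>) = \<Lambda> (Kg \<alpha>) * \<Lambda> (Lg \<beta>)) \<and> (\<forall>\<alpha>. \<Lambda> (Kg \<alpha>) \<noteq> 0 \<and> \<Lambda> (Lg \<alpha>) \<noteq> 0)"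

lemma wt_refl_values:
  assumes "wt_height X \<Lambda> i = enat n"
  defines "s \<equiv> srefl (bichar_refl i X) i"
  shows "wt_refl X i \<Lambda> (Kg \<alpha>) = \<Lambda> (Kg (s \<alpha>)) * inverse (X (s \<alpha>) (sroot i) ^ n)"
    "wt_refl X i \<Lambda> (Lg \<alpha>) = \<Lambda> (Lg (s \<alpha>)) * X (sroot i) (s \<alpha>) ^ n"
    "wt_refl X i \<Lambda> (Kg \<alpha> * Lg \<beta>) = wt_refl X i \<Lambda> (Kg \<alpha>) * wt_refl X i \<Lambda> (Lg \<beta>)"
proof -
  have *: "wt_refl X i \<Lambda> (fvar g) = wt_refl_gen X i \<Lambda> g" for g
    by (simp add: wt_refl_def feval_fvar)
  show "wt_refl X i \<Lambda> (Kg \<alpha>) = \<Lambda> (Kg (s \<alpha>)) * inverse (X (s \<alpha>) (sroot i) ^ n)"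
    "wt_refl X i \<Lambda> (Lg \<alpha>) = \<Lambda> (Lg (s \<alpha>)) * X (sroot i) (s \<alpha>) ^ n"
    unfolding Kg_def[of \<alpha>] Lg_def[of \<alpha>] * by (simp_all add: assms Let_def)
  show "wt_refl X i \<Lambda> (Kg \<alpha> * Lg \<beta>) = wt_refl X i \<Lambda> (Kg \<alpha>) * wt_refl X i \<Lambda> (Lg \<beta>)"
    unfolding wt_refl_def by (rule feval_mult) (simp_all add: algebra_simps)
qed

context
  fixes X :: "('i::finite, 'k::field) bichar" and \<Lambda> :: "('i, 'k) qalg \<Rightarrow> 'k"
  assumes stage: "stage X \<Lambda>"
begin

lemma stage_facts: "bihom X" "growth X"
  "\<Lambda> (Kg (\<alpha> + \<beta>)) = \<Lambda> (Kg \<alpha>) * \<Lambda> (Kg \<beta>)" "\<Lambda> (Lg (\<alpha> + \<beta>)) = \<Lambda> (Lg \<alpha>) * \<Lambda> (Lg \<beta>)"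
  "\<Lambda> (Kg \<alpha> * Lg \<beta>) = \<Lambda> (Kg \<alpha>) * \<Lambda> (Lg \<beta>)" "\<Lambda> (Kg \<alpha>) \<noteq> 0" "\<Lambda> (Lg \<alpha>) \<noteq> 0"
  using stage unfolding stage_def by simp_all

lemma stage_neg: "\<Lambda> (Kg 0) = 1" "\<Lambda> (Lg 0) = 1"
  "\<Lambda> (Kg (- \<alpha>)) = inverse (\<Lambda> (Kg \<alpha>))" "\<Lambda> (Lg (- \<alpha>)) = inverse (\<Lambda> (Lg \<alpha>))"
proof -
  show 0: "\<Lambda> (Kg 0) = 1" "\<Lambda> (Lg 0) = 1"
    using stage_facts(3,4)[of 0 0] stage_facts(6,7)[of 0] by simp_all
  show "\<Lambda> (Kg (- \<alpha>)) = inverse (\<Lambda> (Kg \<alpha>))" "\<Lambda> (Lg (- \<alpha>)) = inverse (\<Lambda> (Lg \<alpha>))"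
    using stage_facts(3,4)[of "- \<alpha>" \<alpha>] 0 stage_facts(6,7)[of \<alpha>] by (simp_all add: field_simps)
qed

lemma stage_replicate: "\<Lambda> (Kg (wdeg (replicate n i))) = \<Lambda> (Kg (sroot i)) ^ n"
  "\<Lambda> (Lg (wdeg (replicate n i))) = \<Lambda> (Lg (sroot i)) ^ n"
  by (induction n) (simp_all add: stage_facts stage_neg)

lemma stage_reflectable:
  obtains m where "reflectable X (hwt \<Lambda>) i m"
proof -
  have "\<forall>j. \<exists>m. j \<noteq> i \<longrightarrow> cartan_max X i j = enat m"
    using cartan_max_finite[OF stage_facts(1,2)] by metis
  then obtain m where "\<And>j. j \<noteq> i \<Longrightarrow> cartan_max X i j = enat (m j)"
    by metis
  then have "reflectable X (hwt \<Lambda>) i m"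
    by unfold_locales (auto simp: stage_facts hwt_def)
  then show thesis
    by (rule that)
qed

lemma wt_height_eq: "wt_height X \<Lambda> i =
    Sup (enat ` {k. qfact k (X (sroot i) (sroot i)) * qpoch k (inverse (X (sroot i) (sroot i))) (hwt \<Lambda> i) \<noteq> 0})"
  by (simp add: wt_height_def Let_def hwt_def stage_facts stage_neg divide_inverse)

lemma wt_height_finite:
  assumes "dimle (Lmod X (hwt \<Lambda>)) N"
  shows "wt_height X \<Lambda> i < \<infinity>"
proof -
  obtain m where "reflectable X (hwt \<Lambda>) i m"
    by (rule stage_reflectable)
  then interpret reflectable X "hwt \<Lambda>" i m .
  have "wt_height X \<Lambda> i \<noteq> \<infinity>"
  proof
    assume "wt_height X \<Lambda> i = \<infinity>"
    then have "ncoef k \<noteq> 0" for k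
      unfolding wt_height_eq ncoef_def by (rule Sup_enat_eq_infinity) (rule qfact_qpoch_down)
    then show False
      using assms infinite_dimensional by blast
  qed
  then show ?thesis by simp
qed

lemma stage_step:
  assumes ht: "wt_height X \<Lambda> i = enat n"
  defines "X' \<equiv> bichar_refl i X" and "\<Lambda>' \<equiv> wt_refl X i \<Lambda>"
  shows "stage X' \<Lambda>'"
    and "\<exists>T. bij_betw (app T) (Lmod X (hwt \<Lambda>)) (Lmod X' (hwt \<Lambda>')) \<and>
      (\<forall>\<beta>. \<forall>g\<in>hom_space \<beta>. app T g \<in> hom_space (srefl X' i (\<beta> - wdeg (replicate n i))))"
    and "srefl X' i (srefl X' i \<alpha>) = \<alpha>"
proof -
  obtain m where "reflectable X (hwt \<Lambda>) i m"
    by (rule stage_reflectable)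
  then interpret reflectable X "hwt \<Lambda>" i m .
  note fin = Sup_enat_eqD[OF ht[unfolded wt_height_eq]]
  have "ncoef n \<noteq> 0" "\<not> ncoef (Suc n) \<noteq> 0"
    unfolding ncoef_def using qfact_qpoch_down by (intro fin; auto)+
  then interpret reflection X "hwt \<Lambda>" i m n
    by unfold_locales simp_all
  note vals = wt_refl_values[OF ht, unfolded srefl_refl]
  \<comment> \<open>Here the abstract reflection meets the definition of the reflected weight: the
    K-L ratios of the latter at the simple roots are those of \<open>h'\<close>.\<close>
  have "hwt \<Lambda>' j = h' j" for j
  proof (cases "j = i")
    case True
    then show ?thesis
      by (simp add: \<Lambda>'_def hwt_def vals h'_def srefl_simps stage_neg power_inverse power_mult_distrib divide_inverse mult_ac)
  next
    case False
    then show ?thesis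
      by (simp add: \<Lambda>'_def hwt_def vals h'_def srefl_sroot stage_facts stage_replicate power_divide
          power_inverse power_mult_distrib divide_inverse mult_ac)
  qed
  then have h': "hwt \<Lambda>' = h'" by blast
  show "srefl X' i (srefl X' i \<alpha>) = \<alpha>"
    by (simp add: X'_def srefl_refl srefl_involution)
  show "\<exists>T. bij_betw (app T) (Lmod X (hwt \<Lambda>)) (Lmod X' (hwt \<Lambda>')) \<and>
      (\<forall>\<beta>. \<forall>g\<in>hom_space \<beta>. app T g \<in> hom_space (srefl X' i (\<beta> - wdeg (replicate n i))))"
    unfolding h' X'_def srefl_refl using Phi_bij Phi_hom by blast
  show "stage X' \<Lambda>'"
    unfolding stage_def X'_def \<Lambda>'_def
    using X'_bihom growth_reflection[OF stage_facts(1,2) m]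
    by (simp add: vals stage_facts srefl_simps bihom_simps[OF X] power_mult_distrib mult_ac)
qed

end

lemma stage_seq:
  assumes "stage X \<Lambda>" "\<And>k. k < t \<Longrightarrow> wt_height (bichar_seq X f k) (wt_seq X \<Lambda> f k) (f (Suc k)) < \<infinity>"
  shows "stage (bichar_seq X f t) (wt_seq X \<Lambda> f t)"
  using assms(2)
proof (induction t)
  case 0
  then show ?case using assms(1) by simp
next
  case (Suc t)
  then show ?case
    using stage_step(1)[of "bichar_seq X f t" "wt_seq X \<Lambda> f t" "f (Suc t)"] by fastforce
qed

text \<open>A finite bound forces the next height to be finite, which makes the next reflection
  available; being bijective, it hands on the same N.\<close>

lemma finite_dimensional_heights:
  assumes "stage X \<Lambda>" "dimle (Lmod X (hwt \<Lambda>)) N"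
  shows "stage (bichar_seq X f t) (wt_seq X \<Lambda> f t) \<and> dimle (Lmod (bichar_seq X f t) (hwt (wt_seq X \<Lambda> f t))) N"
proof (induction t)
  case 0
  then show ?case using assms by simp
next
  case (Suc t)
  let ?X = "bichar_seq X f t" and ?\<Lambda> = "wt_seq X \<Lambda> f t"
  have "wt_height ?X ?\<Lambda> (f (Suc t)) < \<infinity>"
    using Suc wt_height_finite by blast
  then obtain n where n: "wt_height ?X ?\<Lambda> (f (Suc t)) = enat n"
    by auto
  note step = stage_step(1,2)[OF conjunct1[OF Suc] n]
  then obtain T where "bij_betw (app T) (Lmod ?X (hwt ?\<Lambda>)) (Lmod (bichar_seq X f (Suc t)) (hwt (wt_seq X \<Lambda> f (Suc t))))"
    by auto
  then show ?case
    using step(1) dimle_image[OF conjunct2[OF Suc], of T] by (simp add: bij_betw_def)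
qed

section \<open>Weights along a word of reflections\<close>

definition is_weight :: "('i::finite, 'k::field) bichar \<Rightarrow> (('i, 'k) qalg \<Rightarrow> 'k) \<Rightarrow> 'i lattice \<Rightarrow> bool" where
  "is_weight X \<Lambda> \<beta> \<longleftrightarrow> (\<exists>g\<in>Lmod X (hwt \<Lambda>) \<inter> hom_space \<beta>. g \<noteq> 0)"

lemma is_weight_wdeg:
  fixes X :: "('i::finite, 'k::field) bichar"
  assumes "is_weight X \<Lambda> \<beta>"
  obtains u where "\<beta> = wdeg u"
proof -
  obtain g :: "'i list \<Rightarrow> 'k" where g: "g \<in> hom_space \<beta>" "g \<noteq> 0"
    using assms by (auto simp: is_weight_def)
  then obtain u where "g u \<noteq> 0"
    by (metis ext zero_fun_apply)
  then show thesis
    using g(1) that unfolding hom_space_def by blast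
qed

lemma weights_reflected:
  assumes "stage X \<Lambda>" "\<And>k. k < t \<Longrightarrow> wt_height (bichar_seq X f k) (wt_seq X \<Lambda> f k) (f (Suc k)) < \<infinity>"
  shows "\<exists>c. \<forall>\<beta>. is_weight X \<Lambda> \<beta> \<longrightarrow>
    (\<exists>\<gamma>. is_weight (bichar_seq X f t) (wt_seq X \<Lambda> f t) \<gamma> \<and> \<beta> = srefl_seq X f t \<gamma> + c)"
    and "srefl_seq X f t (\<alpha> + \<beta>) = srefl_seq X f t \<alpha> + srefl_seq X f t \<beta>"
proof -
  have "(\<exists>c. \<forall>\<beta>. is_weight X \<Lambda> \<beta> \<longrightarrow>
      (\<exists>\<gamma>. is_weight (bichar_seq X f t) (wt_seq X \<Lambda> f t) \<gamma> \<and> \<beta> = srefl_seq X f t \<gamma> + c))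
    \<and> (\<forall>\<alpha> \<beta>. srefl_seq X f t (\<alpha> + \<beta>) = srefl_seq X f t \<alpha> + srefl_seq X f t \<beta>)"
    using assms(2)
  proof (induction t)
    case 0
    show ?case by (intro conjI exI[of _ 0]) auto
  next
    case (Suc t)
    let ?X = "bichar_seq X f t" and ?\<Lambda> = "wt_seq X \<Lambda> f t" and ?w = "srefl_seq X f t"
    let ?X' = "bichar_seq X f (Suc t)" and ?\<Lambda>' = "wt_seq X \<Lambda> f (Suc t)" and ?s = "srefl (bichar_seq X f (Suc t)) (f (Suc t))"
    obtain c where c: "\<And>\<beta>. is_weight X \<Lambda> \<beta> \<Longrightarrow> \<exists>\<gamma>. is_weight ?X ?\<Lambda> \<gamma> \<and> \<beta> = ?w \<gamma> + c"
      and add: "\<And>\<alpha> \<beta>. ?w (\<alpha> + \<beta>) = ?w \<alpha> + ?w \<beta>"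
      using Suc by auto
    have st: "stage ?X ?\<Lambda>"
      using Suc.prems by (intro stage_seq assms(1)) auto
    obtain n where n: "wt_height ?X ?\<Lambda> (f (Suc t)) = enat n"
      using Suc.prems[of t] by auto
    note step = stage_step[OF st n, folded bichar_seq.simps wt_seq.simps]
    obtain T where T: "bij_betw (app T) (Lmod ?X (hwt ?\<Lambda>)) (Lmod ?X' (hwt ?\<Lambda>'))"
      "\<And>\<beta> g. g \<in> hom_space \<beta> \<Longrightarrow> app T g \<in> hom_space (?s (\<beta> - wdeg (replicate n (f (Suc t)))))"
      using step(2) by blast
    let ?d = "wdeg (replicate n (f (Suc t)))"
    \<comment> \<open>The new reflection is an involution up to the shift by n simple roots. By
      additivity of the composed map the shift goes into the constant.\<close>
    have "\<exists>\<gamma>. is_weight ?X' ?\<Lambda>' \<gamma> \<and> \<beta> = (?w \<circ> ?s) \<gamma> + (?w ?d + c)" if \<beta>: "is_weight X \<Lambda> \<beta>" for \<beta>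
    proof -
      obtain \<gamma> where \<gamma>: "is_weight ?X ?\<Lambda> \<gamma>" "\<beta> = ?w \<gamma> + c"
        using c[OF \<beta>] by blast
      then obtain g where g: "g \<in> Lmod ?X (hwt ?\<Lambda>)" "g \<in> hom_space \<gamma>" "g \<noteq> 0"
        by (auto simp: is_weight_def)
      have "app T g \<noteq> app T 0"
        using T(1) g(1,3) fnv.subspace_0[OF Lmod_subspace] unfolding bij_betw_def inj_on_def by metis
      then have "is_weight ?X' ?\<Lambda>' (?s (\<gamma> - ?d))"
        using T g unfolding is_weight_def bij_betw_def by (intro bexI[of _ "app T g"]) auto
      moreover have "\<gamma> = (\<gamma> - ?d) + ?d"
        by simp
      then have "\<beta> = (?w \<circ> ?s) (?s (\<gamma> - ?d)) + (?w ?d + c)"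
        using \<gamma>(2) add[of "\<gamma> - ?d" ?d] step(3)[of "\<gamma> - ?d"] by (simp add: add.assoc)
      ultimately show ?thesis by blast
    qed
    moreover have "(?w \<circ> ?s) (\<alpha> + \<beta>) = (?w \<circ> ?s) \<alpha> + (?w \<circ> ?s) \<beta>" for \<alpha> \<beta>
    proof -
      have "hw ?X'"
        using stage_facts(1)[OF step(1)] by unfold_locales
      then show ?thesis
        using hw.srefl_simps(1) add by fastforce
    qed
    ultimately show ?case
      unfolding srefl_seq.simps by blast
  qed
  then show "\<exists>c. \<forall>\<beta>. is_weight X \<Lambda> \<beta> \<longrightarrow>
      (\<exists>\<gamma>. is_weight (bichar_seq X f t) (wt_seq X \<Lambda> f t) \<gamma> \<and> \<beta> = srefl_seq X f t \<gamma> + c)"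
    "srefl_seq X f t (\<alpha> + \<beta>) = srefl_seq X f t \<alpha> + srefl_seq X f t \<beta>"
    by blast+
qed

lemma finite_lattice_interval: "finite {\<beta> :: 'i::finite lattice. 0 \<le> \<beta> \<and> \<beta> \<le> c}"
proof -
  have "{\<beta>. 0 \<le> \<beta> \<and> \<beta> \<le> c} \<subseteq> (UNIV \<rightarrow>\<^sub>E (\<Union>i. {0..c i}))"
    by (auto simp: le_fun_def zero_fun_apply)
  moreover have "finite ((UNIV :: 'i set) \<rightarrow>\<^sub>E (\<Union>i. {0..c i}))"
    by (intro finite_PiE) auto
  ultimately show ?thesis
    by (rule finite_subset)
qed

lemma finite_heights_finite_dimensional:
  assumes st: "stage X \<Lambda>" and hts: "\<And>k. k < t \<Longrightarrow> wt_height (bichar_seq X f k) (wt_seq X \<Lambda> f k) (f (Suc k)) < \<infinity>"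
    and w: "longest_element X (srefl_seq X f t)"
  shows "\<exists>N. dimle (Lmod X (hwt \<Lambda>)) N"
proof -
  let ?w = "srefl_seq X f t"
  have add: "?w (\<alpha> + \<beta>) = ?w \<alpha> + ?w \<beta>" for \<alpha> \<beta>
    by (rule weights_reflected(2)[OF st hts])
  obtain c where c: "\<And>\<beta>. is_weight X \<Lambda> \<beta> \<Longrightarrow>
      \<exists>\<gamma>. is_weight (bichar_seq X f t) (wt_seq X \<Lambda> f t) \<gamma> \<and> \<beta> = ?w \<gamma> + c"
    using weights_reflected(1)[OF st hts] by blast
  have simple: "?w (sroot i) \<le> 0" for i
  proof -
    have "?w (sroot i) \<in> uminus ` range sroot"
      using w unfolding longest_element_def by blast
    then show ?thesis
      by (auto simp: le_fun_def uminus_apply zero_fun_apply sroot_def)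
  qed
  have neg: "?w (wdeg u) \<le> 0" for u
  proof (induction u)
    case Nil
    show ?case
      using add[of 0 0] by simp
  next
    case (Cons i u)
    then show ?case
      using add_mono[OF simple[of i]] by (simp add: add)
  qed
  let ?D = "{\<beta>. 0 \<le> \<beta> \<and> \<beta> \<le> c}"
  have "\<beta> \<in> ?D" if \<beta>: "is_weight X \<Lambda> \<beta>" for \<beta>
  proof -
    obtain \<gamma> where \<gamma>: "is_weight (bichar_seq X f t) (wt_seq X \<Lambda> f t) \<gamma>" "\<beta> = ?w \<gamma> + c"
      using c[OF \<beta>] by blast
    then have "?w \<gamma> \<le> 0"
      using neg is_weight_wdeg by metis
    then have "\<beta> \<le> c"
      using add_right_mono[of "?w \<gamma>" 0 c] \<gamma>(2) by simp
    then show ?thesis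
      using is_weight_wdeg[OF \<beta>] wdeg_nonneg by blast
  qed
  \<comment> \<open>Each \<open>fword\<close> is either zero or a weight vector of its degree, so
    only the words with degree in a finite box matter for the span.\<close>
  then have "fword X (hwt \<Lambda>) u \<in> fnv.span (fword X (hwt \<Lambda>) ` {u. wdeg u \<in> ?D})" for u
  proof (cases "fword X (hwt \<Lambda>) u = 0")
    case False
    then have "is_weight X \<Lambda> (wdeg u)"
      unfolding is_weight_def using fword_hom fword_in_Lmod by blast
    then show ?thesis
      using \<open>\<And>\<beta>. is_weight X \<Lambda> \<beta> \<Longrightarrow> \<beta> \<in> ?D\<close> by (intro fnv.span_base) blast
  qed (simp add: fnv.span_zero)
  then have "Lmod X (hwt \<Lambda>) \<subseteq> fnv.span (fword X (hwt \<Lambda>) ` {u. wdeg u \<in> ?D})"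
    unfolding Lmod_def by (intro fnv.span_minimal) auto
  moreover have "finite (fword X (hwt \<Lambda>) ` {u. wdeg u \<in> ?D})"
    by (intro finite_imageI finite_wdeg finite_lattice_interval)
  ultimately show ?thesis
    unfolding dimle_def by blast
qed

text \<open>The set under \<open>Max\<close> contains 0 and is bounded by n, so the maximum is
  attained and equals n exactly if n belongs to the set. Positions are counted from 0 on the
  right-hand side.\<close>

lemma H_max_eq_iff: "H_max X \<Lambda> f n = n \<longleftrightarrow>
    (\<forall>k<n. wt_height (bichar_seq X f k) (wt_seq X \<Lambda> f k) (f (Suc k)) < \<infinity>)"
proof -
  define A where "A = {t. t \<le> n \<and> (\<forall>k<t. wt_height (bichar_seq X f k) (wt_seq X \<Lambda> f k) (f (Suc k)) < \<infinity>)}"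
  have "(\<forall>k\<in>{1..t}. P k) \<longleftrightarrow> (\<forall>k<t. P (Suc k))" for t and P :: "nat \<Rightarrow> bool"
    using image_Suc_lessThan[of t] by (metis Suc_eq_plus1 imageE image_eqI lessThan_iff)
  then have A: "H_max X \<Lambda> f n = Max A"
    unfolding H_max_def A_def by simp
  have fin: "finite A"
    by (rule finite_subset[of _ "{..n}"]) (auto simp: A_def)
  have "Max A \<in> A"
    by (rule Max_in[OF fin]) (auto simp: A_def)
  moreover have "Max A = n" if "n \<in> A"
    by (rule Max_eqI[OF fin _ that]) (simp add: A_def)
  ultimately have "Max A = n \<longleftrightarrow> n \<in> A"
    by metis
  also have "\<dots> \<longleftrightarrow> (\<forall>k<n. wt_height (bichar_seq X f k) (wt_seq X \<Lambda> f k) (f (Suc k)) < \<infinity>)"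
    unfolding A_def by simp
  finally show ?thesis
    unfolding A .
qed

theorem lemma6p5:
  fixes X :: "('i::finite, 'k::field_char_0) bichar"
    and R :: "'i lattice set" and \<phi> :: "'i lattice \<Rightarrow> nat"
    and n :: nat and f :: "nat \<Rightarrow> 'i" and \<Lambda> :: "('i, 'k) qalg \<Rightarrow> 'k"
  assumes "bihom X"
    and "kharchenko_pair X R \<phi>" and "finite R" and "n = card R"
    and "longest_element X (srefl_seq X f n)"
    and "\<Lambda> \<in> Ch X"
  shows "L_finite_dim X \<Lambda> \<longleftrightarrow> H_max X \<Lambda> f n = n"
proof -
  interpret Ch_weight X "hwt \<Lambda>" "\<lambda>\<alpha>. \<Lambda> (Kg \<alpha>)" "\<lambda>\<alpha>. \<Lambda> (Lg \<alpha>)" \<Lambda>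
    unfolding hwt_def[abs_def] by (rule Ch_weightI[OF assms(1,6)])
  \<comment> \<open>The finite set of roots enters through the growth component; the remaining
    components express that \<Lambda> is a character.\<close>
  have st: "stage X \<Lambda>"
    unfolding stage_def
    using assms(1) kharchenko_growth[OF assms(1-3)] \<kappa> \<mu> \<Lambda>_hom(3)[OF gens_in_alg_zero] by simp
  show ?thesis
    unfolding L_finite_dim_iff H_max_eq_iff
  proof
    assume "\<exists>N. dimle L N"
    then obtain N where "dimle L N" by blast
    then show "\<forall>k<n. wt_height (bichar_seq X f k) (wt_seq X \<Lambda> f k) (f (Suc k)) < \<infinity>"
      using finite_dimensional_heights[OF st] wt_height_finite by blast
  next
    assume "\<forall>k<n. wt_height (bichar_seq X f k) (wt_seq X \<Lambda> f k) (f (Suc k)) < \<infinity>"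
    then show "\<exists>N. dimle L N"
      using assms(5) by (intro finite_heights_finite_dimensional[OF st]) auto
  qed
qed

end
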